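(* Let $X\subset\mathbb{P}^N$ be an irreducible, almost everywhere smooth variety of dimension $n$ with a degenerate Gauss map of rank $r$, $0<r<n$. Then $X$ is dually degenerate (i.e. $\dim X^*<N-l-1$, where $l=n-r$ and $X^*\subset(\mathbb{P}^N)^*$ is the dual variety of $X$) if and only if at any smooth point $x\in X$ every quadratic form $\Phi=\xi_\alpha\Phi^\alpha$ belonging to the second fundamental form $II$ of the variety $X$ is singular.
   Context: $\mathbb{P}^N$ is complex projective space and $(\mathbb{P}^N)^*$ is the dual projective space of its hyperplanes. For a smooth point $x$ of $X$, $T_x X\cong\mathbb{P}^n$ denotes the embedded projective tangent subspace. Gauss map and rank. The Gauss map is $\gamma:X\to\mathbb{G}(n,N)$, $\gamma(x)=T_xX$ (defined at smooth points). The rank $r$ of $X$ is the (generic) rank of $\gamma$; $X$ has a degenerate Gauss map if $r<n$. Put $l=n-r$. The leaves $L$ of $\gamma$ (the fibers of $\gamma$) are $l$-dimensional projective subspaces or open parts of such subspaces, and the tangent subspace is constant along $L$; it is denoted $T_L$. Dual variety. A hyperplane $\xi$ is tangent to $X$ at a smooth point $x$ if $T_xX\subseteq\xi$. With $X_{sm}$ the set of smooth points of $X$, the dual variety is $$X^*=\overline{\{\xi\in(\mathbb{P}^N)^* \mid \exists\, x\in X_{sm}\text{ with }T_xX\subseteq\xi\}}.$$ Dual degeneracy (refined definition). The expected dimension of $X^*$ is $(N-n-1)+r=N-l-1$. The variety $X$ of rank $r$ is called dually degenerate if $\dim X^*<N-l-1$. Second fundamental form. Index ranges: $a=1,\dots,l$;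 $p,q=l+1,\dots,n$; $\alpha=n+1,\dots,N$. Summation over repeated indices is understood. Take moving frames $\{A_0,\dots,A_N\}$ of $\mathbb{P}^N$ with $A_0=x$ a smooth point of $X$, the points $A_0,A_a$ spanning the leaf $L$ through $x$, the points $A_0,A_a,A_p$ spanning $T_L$, and the $A_\alpha$ outside $T_L$. Write $dA_u=\omega_u^vA_v$ and $\omega^q:=\omega^q_0$. Then $\omega_0^\alpha=0$, $\omega_a^\alpha=0$, and $\omega_p^\alpha=b^\alpha_{pq}\omega^q$ with $b^\alpha_{pq}=b^\alpha_{qp}$. The second fundamental form $II$ of $X$ at $x$ is the linear span of the quadratic forms $\Phi^\alpha=b^\alpha_{pq}\omega^p\omega^q$, so its members are the forms $$\Phi=\xi_\alpha\Phi^\alpha=\xi_\alpha b^\alpha_{pq}\omega^p\omega^q,$$ where $(\xi_\alpha)$ are the coefficients of a hyperplane $\xi_\alpha x^\alpha=0$ containing $T_L$. Such a form is called singular if the determinant of its $r\times r$ matrix vanishes, $\det(\xi_\alpha b^\alpha_{pq})=0$. Equivalently, $\Phi$ has rank less than $r$ when viewed as a quadratic form on the $n$-dimensional tangent space of $X$ at $x$. *)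

theory Defs
  imports
    "HOL-Analysis.Analysis"
    "HOL-Library.Poly_Mapping"
    "Jordan_Normal_Form.Determinant"
begin

section \<open>Polynomials\<close>

text \<open>
  Polynomials with variables in \<open>'v\<close> are finitely supported families of coefficients, indexed by
  finitely supported exponent vectors; \<^theory>\<open>HOL-Library.Poly_Mapping\<close> supplies the ring structure.
\<close>

type_synonym 'v cpoly = "('v \<Rightarrow>\<^sub>0 nat) \<Rightarrow>\<^sub>0 complex"

definition poly_eval :: "'v cpoly \<Rightarrow> ('v \<Rightarrow> complex) \<Rightarrow> complex" where
  "poly_eval f x = (\<Sum>m\<in>Poly_Mapping.keys f. Poly_Mapping.lookup f m *
      (\<Prod>i\<in>Poly_Mapping.keys m. x i ^ Poly_Mapping.lookup m i))"

definition homogeneous :: "'v cpoly \<Rightarrow> bool" where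
  "homogeneous f \<longleftrightarrow> (\<exists>d. \<forall>m\<in>Poly_Mapping.keys f.
      (\<Sum>i\<in>Poly_Mapping.keys m. Poly_Mapping.lookup m i) = d)"

abbreviation poly_fun :: "'m::finite cpoly \<Rightarrow> complex ^ 'm \<Rightarrow> complex" where
  "poly_fun f \<equiv> (\<lambda>y. poly_eval f (vec_nth y))"

definition polynomial_map :: "(complex ^ 'm::finite \<Rightarrow> complex ^ 'm) \<Rightarrow> bool" where
  "polynomial_map F \<longleftrightarrow> (\<exists>P. \<forall>y i. vec_nth (F y) i = poly_fun (P i) y)"

section \<open>Projective space\<close>

text \<open>
  Points of the projective space of \<open>complex ^ 'm\<close>, of dimension \<open>CARD('m) - 1\<close>, are the complex
  lines through the origin.
\<close>

typedef 'm proj = "{L :: (complex ^ 'm::finite) set. \<exists>v. v \<noteq> 0 \<and> L = vec.span {v}}"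
  morphisms line_of Proj
proof -
  have "(axis undefined 1 :: complex ^ 'm) \<noteq> 0"
    by (simp add: axis_eq_0_iff)
  then show ?thesis by blast
qed

definition point :: "complex ^ 'm::finite \<Rightarrow> 'm proj" where
  "point v = Proj (vec.span {v})"

definition proj_subspace :: "(complex ^ 'm::finite) set \<Rightarrow> 'm proj set" where
  "proj_subspace W = {q. line_of q \<subseteq> W}"

text \<open>
  A point of the dual projective space is given by the homogeneous coordinates of the hyperplane,
  so that the dual space is again of type \<open>'m proj\<close>.
\<close>

definition hyperplane :: "'m::finite proj \<Rightarrow> 'm proj set" where
  "hyperplane \<xi> =
     {q. \<forall>u\<in>line_of \<xi>. \<forall>v\<in>line_of q. (\<Sum>i\<in>UNIV. vec_nth u i * vec_nth v i) = 0}"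

section \<open>Projective varieties\<close>

definition cone :: "'m::finite proj set \<Rightarrow> (complex ^ 'm) set" where
  "cone X = (\<Union>p\<in>X. line_of p)"

definition zariski_closed :: "'m::finite proj set \<Rightarrow> bool" where
  "zariski_closed X \<longleftrightarrow> (\<exists>F. (\<forall>f\<in>F. homogeneous f) \<and>
      X = {p. \<forall>f\<in>F. \<forall>v\<in>line_of p. poly_fun f v = 0})"

definition zariski_closure :: "'m::finite proj set \<Rightarrow> 'm proj set" where
  "zariski_closure S = \<Inter>{Z. zariski_closed Z \<and> S \<subseteq> Z}"

definition irreducible_variety :: "'m::finite proj set \<Rightarrow> bool" where
  "irreducible_variety X \<longleftrightarrow> zariski_closed X \<and> X \<noteq> {} \<and>
     (\<forall>Y Z. zariski_closed Y \<and> zariski_closed Z \<and> X \<subseteq> Y \<union> Z \<longrightarrow> X \<subseteq> Y \<or> X \<subseteq> Z)"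

text \<open>
  The transcendence degree over the complex numbers of the ring of polynomial functions on
  \<open>C\<close>: the largest \<open>k\<close> such that some \<open>k\<close> polynomial functions on \<open>C\<close> are algebraically
  independent.
\<close>

definition alg_independent_on ::
    "(complex ^ 'm::finite) set \<Rightarrow> nat \<Rightarrow> (nat \<Rightarrow> 'm cpoly) \<Rightarrow> bool" where
  "alg_independent_on C k f \<longleftrightarrow> (\<forall>P :: nat cpoly.
     (\<forall>m\<in>Poly_Mapping.keys P. Poly_Mapping.keys m \<subseteq> {..<k}) \<and>
     (\<forall>y\<in>C. poly_eval P (\<lambda>i. poly_fun (f i) y) = 0) \<longrightarrow> P = 0)"

definition transcendence_degree :: "(complex ^ 'm::finite) set \<Rightarrow> nat" where
  "transcendence_degree C = Sup {k. \<exists>f. alg_independent_on C k f}"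

text \<open>
  The homogeneous coordinate ring of \<open>X\<close> is the coordinate ring of its affine cone, and has
  transcendence degree one more than the dimension of \<open>X\<close>. The empty set has dimension \<open>-1\<close>.
\<close>

definition proj_dim :: "'m::finite proj set \<Rightarrow> int" where
  "proj_dim X = int (transcendence_degree (cone X)) - 1"

section \<open>Tangent subspaces, the Gauss map and the dual variety\<close>

text \<open>
  The affine cone over the embedded tangent subspace. The condition does not depend on the
  choice of the representative \<open>v\<close>, as the ideal of the cone is invariant under scaling.
  Derivatives of polynomials are complex linear, so the real derivative
  \<^const>\<open>frechet_derivative\<close> is the complex one.
\<close>

definition affine_tangent :: "'m::finite proj set \<Rightarrow> 'm proj \<Rightarrow> (complex ^ 'm) set" where
  "affine_tangent X p = {w. \<forall>f. (\<forall>y\<in>cone X. poly_fun f y = 0) \<longrightarrow>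
     (\<forall>v\<in>line_of p - {0}. frechet_derivative (poly_fun f) (at v) w = 0)}"

definition smooth_points :: "'m::finite proj set \<Rightarrow> 'm proj set" where
  "smooth_points X = {p\<in>X. int (vec.dim (affine_tangent X p)) = proj_dim X + 1}"

definition tangent_subspace :: "'m::finite proj set \<Rightarrow> 'm proj \<Rightarrow> 'm proj set" where
  "tangent_subspace X p = proj_subspace (affine_tangent X p)"

definition dual_variety :: "'m::finite proj set \<Rightarrow> 'm proj set" where
  "dual_variety X =
     zariski_closure {\<xi>. \<exists>p\<in>smooth_points X. tangent_subspace X p \<subseteq> hyperplane \<xi>}"

definition tangent_section ::
    "'m::finite proj set \<Rightarrow> (complex ^ 'm \<Rightarrow> complex ^ 'm) \<Rightarrow> bool" where
  "tangent_section X s \<longleftrightarrow> polynomial_map s \<and>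
     (\<forall>y. y \<noteq> 0 \<and> point y \<in> smooth_points X \<longrightarrow> s y \<in> affine_tangent X (point y))"

text \<open>
  Let \<open>T\<close> be the affine tangent space at \<open>v\<close>. The tangent space at \<open>T\<close> of the Grassmannian is
  the space of linear maps from \<open>T\<close> to the quotient of \<open>complex ^ 'm\<close> by \<open>T\<close>. The differential
  of the Gauss map \<open>p \<mapsto> tangent_subspace X p\<close> sends \<open>w\<close> in \<open>T\<close> to the linear map which takes
  \<open>s v\<close> to the class of \<open>ds(w)\<close>, for every section \<open>s\<close> of the tangent spaces. Minors of the
  Jacobian matrix give polynomial sections spanning the tangent space at any given smooth point,
  so these suffice. The kernel contains the line through \<open>v\<close>, which is also divided out of \<open>T\<close> to
  obtain the tangent space of \<open>X\<close>.
\<close>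

definition gauss_kernel :: "'m::finite proj set \<Rightarrow> complex ^ 'm \<Rightarrow> (complex ^ 'm) set" where
  "gauss_kernel X v = {w \<in> affine_tangent X (point v).
     \<forall>s. tangent_section X s \<longrightarrow> frechet_derivative s (at v) w \<in> affine_tangent X (point v)}"

definition gauss_rank_at :: "'m::finite proj set \<Rightarrow> complex ^ 'm \<Rightarrow> nat" where
  "gauss_rank_at X v = vec.dim (affine_tangent X (point v)) - vec.dim (gauss_kernel X v)"

text \<open>The rank is the one at a generic smooth point.\<close>

definition has_gauss_rank :: "'m::finite proj set \<Rightarrow> nat \<Rightarrow> bool" where
  "has_gauss_rank X r \<longleftrightarrow> (\<exists>Z. zariski_closed Z \<and> \<not> X \<subseteq> Z \<and>
     (\<forall>v. v \<noteq> 0 \<and> point v \<in> smooth_points X - Z \<longrightarrow> gauss_rank_at X v = r))"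

section \<open>Moving frames and the second fundamental form\<close>

text \<open>
  A leaf through \<open>p\<close> is an \<open>l\<close>-dimensional projective subspace along which the tangent subspace
  is constant; the fibre of the Gauss map is an open part of it in general, so constancy is
  required at the smooth points of \<open>X\<close> only. The argument \<open>W\<close> is the affine cone of the leaf.
\<close>

definition leaf_through ::
    "'m::finite proj set \<Rightarrow> nat \<Rightarrow> 'm proj \<Rightarrow> (complex ^ 'm) set \<Rightarrow> bool" where
  "leaf_through X l p W \<longleftrightarrow> vec.subspace W \<and> vec.dim W = l + 1 \<and>
     p \<in> proj_subspace W \<and> proj_subspace W \<subseteq> X \<and>
     (\<forall>q\<in>proj_subspace W \<inter> smooth_points X. tangent_subspace X q = tangent_subspace X p)"

text \<open>
  A moving frame \<open>A 0, \<dots>, A N\<close>, where \<open>N = CARD('m) - 1\<close>, consists of functions of the point \<open>y\<close>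
  of the cone over \<open>X\<close>, with \<open>A 0\<close> the point itself; the points \<open>A 0, \<dots>, A n\<close> lie in the tangent
  subspace at every smooth point. Vertices are points of projective space, so a frame that is
  regular near \<open>v\<close> becomes polynomial after rescaling its vertices. At \<open>v\<close> the frame is a basis,
  its first \<open>l + 1\<close> vertices span a leaf, and its first \<open>n + 1\<close> vertices span the tangent subspace.
  The coefficients \<open>b\<close> below depend on the frame through its value at \<open>v\<close> only, so it need not be
  adapted to the leaves at other points.
\<close>

definition adapted_frame ::
    "'m::finite proj set \<Rightarrow> nat \<Rightarrow> nat \<Rightarrow> complex ^ 'm \<Rightarrow> (nat \<Rightarrow> complex ^ 'm \<Rightarrow> complex ^ 'm) \<Rightarrow> bool"
  where
  "adapted_frame X l n v A \<longleftrightarrow>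
     A 0 = (\<lambda>y. y) \<and>
     (\<forall>u<CARD('m). polynomial_map (A u)) \<and>
     (\<forall>u\<le>n. tangent_section X (A u)) \<and>
     leaf_through X l (point v) (vec.span ((\<lambda>u. A u v) ` {..l})) \<and>
     vec.span ((\<lambda>u. A u v) ` {..n}) = affine_tangent X (point v) \<and>
     vec.span ((\<lambda>u. A u v) ` {..<CARD('m)}) = UNIV"

text \<open>The structure equations \<open>dA\<^sub>u = \<omega>\<^sub>u\<^sup>k A\<^sub>k\<close> at \<open>v\<close>, on tangent vectors \<open>w\<close>.\<close>

definition connection_forms ::
    "'m::finite proj set \<Rightarrow> complex ^ 'm \<Rightarrow> (nat \<Rightarrow> complex ^ 'm \<Rightarrow> complex ^ 'm) \<Rightarrow>
     (nat \<Rightarrow> nat \<Rightarrow> complex ^ 'm \<Rightarrow> complex) \<Rightarrow> bool" where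
  "connection_forms X v A \<omega> \<longleftrightarrow>
     (\<forall>u<CARD('m). \<forall>w\<in>affine_tangent X (point v).
        frechet_derivative (A u) (at v) w = (\<Sum>k<CARD('m). \<omega> u k w *s A k v))"

text \<open>
  \<open>b \<alpha> p q\<close> is the coefficient in \<open>\<omega>\<^sub>p\<^sup>\<alpha> = b\<^sup>\<alpha>\<^sub>p\<^sub>q \<omega>\<^sup>q\<close>, with \<open>\<omega>\<^sup>q = \<omega> 0 q\<close>. These equations
  determine \<open>b\<close>, which is then symmetric in \<open>p\<close> and \<open>q\<close>.
\<close>

definition fundamental_coefficients ::
    "'m::finite proj set \<Rightarrow> nat \<Rightarrow> nat \<Rightarrow> complex ^ 'm \<Rightarrow> (nat \<Rightarrow> complex ^ 'm \<Rightarrow> complex ^ 'm) \<Rightarrow>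
     (nat \<Rightarrow> nat \<Rightarrow> nat \<Rightarrow> complex) \<Rightarrow> bool" where
  "fundamental_coefficients X l n v A b \<longleftrightarrow> (\<exists>\<omega>. connection_forms X v A \<omega> \<and>
     (\<forall>\<alpha>\<in>{n<..<CARD('m)}. \<forall>p\<in>{l<..n}. \<forall>w\<in>affine_tangent X (point v).
        \<omega> p \<alpha> w = (\<Sum>q\<in>{l<..n}. b \<alpha> p q * \<omega> 0 q w)))"

text \<open>
  A member \<open>\<Phi> = \<xi>\<^sub>\<alpha> b\<^sup>\<alpha>\<^sub>p\<^sub>q \<omega>\<^sup>p \<omega>\<^sup>q\<close> of the second fundamental form is represented by its
  square matrix of size \<open>n - l\<close>, whose indices \<open>0, \<dots>, n - l - 1\<close> stand for \<open>l + 1, \<dots>, n\<close>. All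
  adapted frames at the point \<open>x\<close> contribute; a change of frame is a congruence of matrices, up to
  scaling.
\<close>

definition second_fundamental_form ::
    "'m::finite proj set \<Rightarrow> nat \<Rightarrow> nat \<Rightarrow> 'm proj \<Rightarrow> complex mat set" where
  "second_fundamental_form X l n x =
     {Matrix.mat (n - l) (n - l)
        (\<lambda>(i, j). \<Sum>\<alpha>\<in>{n<..<CARD('m)}. \<xi> \<alpha> * b \<alpha> (l + 1 + i) (l + 1 + j)) | v A b \<xi>.
      v \<noteq> 0 \<and> point v = x \<and> adapted_frame X l n v A \<and> fundamental_coefficients X l n v A b}"

definition singular_form :: "complex mat \<Rightarrow> bool" where
  "singular_form \<Phi> \<longleftrightarrow> Determinant.det \<Phi> = 0"

end

theory Submission
  imports Defs
begin

text \<open>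
  Let \<open>C\<close> be the affine cone over \<open>X\<close>, of dimension \<open>n + 1\<close>. Near a smooth point choose
  \<open>c = N - n\<close> polynomials \<open>f\<^sub>i\<close> in the ideal of \<open>C\<close> with independent gradients. A hyperplane
  containing the tangent space at \<open>y\<close> has coordinates \<open>\<Sum> \<mu>\<^sub>i \<nabla>f\<^sub>i(y)\<close>, so the dual variety is the
  closure of the image of the conormal map \<open>(y, \<mu>) \<mapsto> \<Sum> \<mu>\<^sub>i \<nabla>f\<^sub>i(y)\<close> on \<open>C \<times> \<complex>\<^sup>c\<close>. The
  vectors orthogonal to the image of its differential are those in the radical of the Hessian form
  \<open>\<Sum> \<mu>\<^sub>i Hess f\<^sub>i(y)\<close> on the tangent space \<open>T\<close>. In characteristic zero the dimension of the image
  is the generic rank of the differential. Therefore the cone over the dual variety has dimension at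
  least \<open>N - l\<close> if and only if at a generic \<open>(y, \<mu>)\<close> the radical has dimension at most \<open>l + 1\<close>.

  Differentiating \<open>df\<^sub>i(s) = 0\<close> for a tangent section \<open>s\<close> gives \<open>Hess f\<^sub>i(w, s) = - df\<^sub>i(ds(w))\<close>.
  Hence, in an adapted frame, the Hessian form is minus the member of the second fundamental form
  that belongs to the hyperplane, bordered by zeros along the leaf. Nonsingularity of this member
  says that the radical is at most the cone over the leaf, of dimension \<open>l + 1\<close>. This settles one
  direction (\<open>radical_bound_of_nonsingular_form\<close>, \<open>dual_transcendence_lower_bound\<close>).

  For the other direction, a generic point with a small radical is available
  (\<open>generic_radical_bound\<close>), and there the radical equals the kernel of the Gauss map, which always
  lies in it. To see a member of the second fundamental form an adapted frame is needed, and thus a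
  leaf: the kernel \<open>W\<close> of the Gauss map at \<open>y\<close>, as a linear subspace, must lie in \<open>C\<close> and have
  constant tangent space (\<open>leaf_through_generic\<close>). This is proved without integrating
  distributions. Cramer's rule gives polynomial vector fields that span the kernels near \<open>y\<close>. They
  are closed under differentiation along each other, so by induction all iterated derivatives at
  \<open>y\<close> of a function of the ideal along vectors of \<open>W\<close> are zero; a polynomial with this property
  vanishes on \<open>W\<close>.

  The link between transcendence degrees and ranks of differentials has two halves. Independent
  differentials force algebraic independence, because a polynomial relation between functions passes
  to its partial derivatives (\<open>alg_indep_of_differentials\<close>). Conversely, algebraically independent
  functions are extended by coordinates until every coordinate is algebraic over them; then their
  differentials span the cotangent spaces, and they are independent because their number is at most
  the dimension (\<open>differentials_of_alg_indep\<close>). The bound on their number comes from counting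
  monomials (\<open>alg_indep_bound\<close>).
\<close>

section \<open>Algebras of functions\<close>

text \<open>
  Polynomials are treated as functions, in order that the same inductions serve the affine cone, the
  space of parameters of a polynomial relation and the conormal variety.
\<close>

inductive_set fun_alg :: "('a \<Rightarrow> complex) set \<Rightarrow> ('a \<Rightarrow> complex) set" for B where
  fun_alg_const: "(\<lambda>_. c) \<in> fun_alg B"
| fun_alg_base: "b \<in> B \<Longrightarrow> b \<in> fun_alg B"
| fun_alg_add: "f \<in> fun_alg B \<Longrightarrow> g \<in> fun_alg B \<Longrightarrow> (\<lambda>x. f x + g x) \<in> fun_alg B"
| fun_alg_mult: "f \<in> fun_alg B \<Longrightarrow> g \<in> fun_alg B \<Longrightarrow> (\<lambda>x. f x * g x) \<in> fun_alg B"

lemmas fun_alg_intros = fun_alg_const fun_alg_add fun_alg_mult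

lemma fun_alg_uminus: "f \<in> fun_alg B \<Longrightarrow> (\<lambda>x. - f x) \<in> fun_alg B"
  using fun_alg_mult[OF fun_alg_const[of "-1"], of f B] by simp

lemma fun_alg_diff: "f \<in> fun_alg B \<Longrightarrow> g \<in> fun_alg B \<Longrightarrow> (\<lambda>x. f x - g x) \<in> fun_alg B"
  using fun_alg_add[OF _ fun_alg_uminus, of f B g] by simp

lemma fun_alg_sum: "(\<And>i. i \<in> A \<Longrightarrow> f i \<in> fun_alg B) \<Longrightarrow> (\<lambda>x. \<Sum>i\<in>A. f i x) \<in> fun_alg B"
  by (induction A rule: infinite_finite_induct) (auto intro: fun_alg_intros)

lemma fun_alg_prod: "(\<And>i. i \<in> A \<Longrightarrow> f i \<in> fun_alg B) \<Longrightarrow> (\<lambda>x. \<Prod>i\<in>A. f i x) \<in> fun_alg B"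
  by (induction A rule: infinite_finite_induct) (auto intro: fun_alg_intros)

lemma fun_alg_power: "f \<in> fun_alg B \<Longrightarrow> (\<lambda>x. f x ^ k) \<in> fun_alg B"
  by (induction k) (auto intro: fun_alg_intros)

lemma fun_alg_subst:
  assumes "F \<in> fun_alg B" "\<And>b. b \<in> B \<Longrightarrow> (\<lambda>y. b (g y)) \<in> fun_alg B'"
  shows "(\<lambda>y. F (g y)) \<in> fun_alg B'"
  using assms(1) by induction (auto intro: fun_alg_intros assms(2))

lemma fun_alg_mono: "F \<in> fun_alg B \<Longrightarrow> B \<subseteq> B' \<Longrightarrow> F \<in> fun_alg B'"
  using fun_alg_subst[of F B "\<lambda>x. x" B'] by (auto intro: fun_alg_base)

definition polys :: "'v set \<Rightarrow> (('v \<Rightarrow> complex) \<Rightarrow> complex) set" where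
  "polys S = fun_alg ((\<lambda>i x. x i) ` S)"

lemma polys_coord: "i \<in> S \<Longrightarrow> (\<lambda>x. x i) \<in> polys S"
  unfolding polys_def by (rule fun_alg_base) auto

lemma polys_mono: "F \<in> polys S \<Longrightarrow> S \<subseteq> S' \<Longrightarrow> F \<in> polys S'"
  unfolding polys_def by (erule fun_alg_mono) auto

lemma polys_subst:
  assumes "F \<in> polys S" "\<And>i. i \<in> S \<Longrightarrow> g i \<in> fun_alg B"
  shows "(\<lambda>y. F (\<lambda>i. g i y)) \<in> fun_alg B"
  using assms unfolding polys_def by (auto elim!: fun_alg_subst)

lemma polys_cong:
  assumes "F \<in> polys S" "\<And>i. i \<in> S \<Longrightarrow> x i = y i"
  shows "F x = F y"
  using assms(1) unfolding polys_def by induction (auto simp: assms(2))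

section \<open>Polynomials as functions\<close>

definition monom_val :: "('v \<Rightarrow>\<^sub>0 nat) \<Rightarrow> ('v \<Rightarrow> complex) \<Rightarrow> complex" where
  "monom_val m x = (\<Prod>i\<in>Poly_Mapping.keys m. x i ^ Poly_Mapping.lookup m i)"

lemma monom_val_superset:
  "finite S \<Longrightarrow> Poly_Mapping.keys m \<subseteq> S \<Longrightarrow>
     monom_val m x = (\<Prod>i\<in>S. x i ^ Poly_Mapping.lookup m i)"
  unfolding monom_val_def
  by (rule prod.mono_neutral_left) (auto simp: in_keys_iff)

lemma monom_val_plus: "monom_val (m + m') x = monom_val m x * monom_val m' x"
proof -
  let ?S = "Poly_Mapping.keys m \<union> Poly_Mapping.keys m'"
  have "Poly_Mapping.keys (m + m') \<subseteq> ?S"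
    by (rule Poly_Mapping.keys_add)
  then show ?thesis
    by (simp add: monom_val_superset[of ?S] lookup_add power_add prod.distrib)
qed

lemma poly_eval_superset:
  "finite A \<Longrightarrow> Poly_Mapping.keys f \<subseteq> A \<Longrightarrow>
     poly_eval f x = (\<Sum>m\<in>A. Poly_Mapping.lookup f m * monom_val m x)"
  unfolding poly_eval_def monom_val_def[symmetric]
  by (rule sum.mono_neutral_left) (auto simp: in_keys_iff)

lemma poly_eval_plus: "poly_eval (f + g) x = poly_eval f x + poly_eval g x"
proof -
  let ?S = "Poly_Mapping.keys f \<union> Poly_Mapping.keys g"
  have "Poly_Mapping.keys (f + g) \<subseteq> ?S"
    by (rule Poly_Mapping.keys_add)
  then show ?thesis
    by (simp add: poly_eval_superset[of ?S] lookup_add algebra_simps sum.distrib)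
qed

lemma poly_eval_0 [simp]: "poly_eval 0 x = 0"
  by (simp add: poly_eval_def)

lemma poly_eval_sum: "poly_eval (\<Sum>i\<in>A. f i) x = (\<Sum>i\<in>A. poly_eval (f i) x)"
  by (induction A rule: infinite_finite_induct) (auto simp: poly_eval_plus)

lemma poly_eval_single: "poly_eval (Poly_Mapping.single m c) x = c * monom_val m x"
  by (simp add: poly_eval_superset[of "{m}"])

definition vars_in :: "'v set \<Rightarrow> 'v cpoly \<Rightarrow> bool" where
  "vars_in S P \<longleftrightarrow> (\<forall>m\<in>Poly_Mapping.keys P. Poly_Mapping.keys m \<subseteq> S)"

lemma vars_in_plus: "vars_in S P \<Longrightarrow> vars_in S Q \<Longrightarrow> vars_in S (P + Q)"
  using Poly_Mapping.keys_add[of P Q] unfolding vars_in_def by blast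

lemma vars_in_sum: "(\<And>i. i \<in> A \<Longrightarrow> vars_in S (f i)) \<Longrightarrow> vars_in S (\<Sum>i\<in>A. f i)"
  by (induction A rule: infinite_finite_induct) (auto simp: vars_in_plus vars_in_def[of _ 0])

lemma vars_in_single: "Poly_Mapping.keys m \<subseteq> S \<Longrightarrow> vars_in S (Poly_Mapping.single m c)"
  by (simp add: vars_in_def)

lemma poly_eval_in_polys: "vars_in S P \<Longrightarrow> poly_eval P \<in> polys S"
proof -
  assume "vars_in S P"
  then have "(\<lambda>x. \<Sum>m\<in>Poly_Mapping.keys P. Poly_Mapping.lookup P m *
      (\<Prod>i\<in>Poly_Mapping.keys m. x i ^ Poly_Mapping.lookup m i)) \<in> fun_alg ((\<lambda>i x. x i) ` S)"
    unfolding vars_in_def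
    by (intro fun_alg_sum fun_alg_mult fun_alg_const fun_alg_prod fun_alg_power fun_alg_base) auto
  then show ?thesis
    unfolding poly_eval_def[abs_def] polys_def .
qed

lemma polys_imp_poly_eval:
  assumes "F \<in> polys S"
  shows "\<exists>P. vars_in S P \<and> F = poly_eval P"
  using assms unfolding polys_def
proof induction
  case (fun_alg_const c)
  show ?case
    by (rule exI[of _ "Poly_Mapping.single 0 c"])
      (auto simp: vars_in_single fun_eq_iff poly_eval_single monom_val_def)
next
  case (fun_alg_base b)
  then obtain i where i: "i \<in> S" "b = (\<lambda>x. x i)" by auto
  show ?case
    by (rule exI[of _ "Poly_Mapping.single (Poly_Mapping.single i 1) 1"])
      (use i in \<open>auto simp: vars_in_single fun_eq_iff poly_eval_single monom_val_def\<close>)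
next
  case (fun_alg_add f g)
  then obtain P Q where "vars_in S P" "f = poly_eval P" "vars_in S Q" "g = poly_eval Q" by auto
  then show ?case
    by (intro exI[of _ "P + Q"]) (auto simp: vars_in_plus poly_eval_plus)
next
  case (fun_alg_mult f g)
  then obtain P Q where *: "vars_in S P" "f = poly_eval P" "vars_in S Q" "g = poly_eval Q" by auto
  define R where "R = (\<Sum>m\<in>Poly_Mapping.keys P. \<Sum>m'\<in>Poly_Mapping.keys Q.
    Poly_Mapping.single (m + m') (Poly_Mapping.lookup P m * Poly_Mapping.lookup Q m'))"
  have "vars_in S R"
    unfolding R_def using * Poly_Mapping.keys_add
    by (intro vars_in_sum vars_in_single) (fastforce simp: vars_in_def)
  moreover have "poly_eval R x = f x * g x" for x
    unfolding R_def *(2,4) poly_eval_sum poly_eval_single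
    by (simp add: poly_eval_superset[OF finite_keys order_refl] sum_product monom_val_plus mult_ac)
  ultimately show ?case
    by (intro exI[of _ R]) auto
qed

text \<open>
  Dedekind's argument: doubling one variable multiplies every monomial by a power of 2, so that a
  suitable difference of two relations is a shorter one, still nontrivial as two monomials differ in
  some exponent.
\<close>
lemma monom_val_independent:
  assumes "finite A" "\<And>x. (\<Sum>m\<in>A. c m * monom_val m x) = 0" "m \<in> A"
  shows "c m = 0"
  using assms
proof (induction A arbitrary: c m rule: finite_induct)
  case (insert a A)
  have zero: "c k = 0" if "k \<in> A" for k
  proof -
    have "k \<noteq> a" using that insert by auto
    then obtain i where i: "Poly_Mapping.lookup k i \<noteq> Poly_Mapping.lookup a i"
      by (auto simp: poly_mapping_eq_iff fun_eq_iff)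
    have scale: "monom_val m (x(i := 2 * x i)) = 2 ^ Poly_Mapping.lookup m i * monom_val m x" for m x
    proof -
      have "monom_val m y = y i ^ Poly_Mapping.lookup m i *
          (\<Prod>j\<in>Poly_Mapping.keys m - {i}. y j ^ Poly_Mapping.lookup m j)" for y
        unfolding monom_val_superset[of "insert i (Poly_Mapping.keys m)" m y, simplified, OF subset_insertI]
        by (rule prod.insert_remove) simp
      moreover have "(\<Prod>j\<in>Poly_Mapping.keys m - {i}. (x(i := 2 * x i)) j ^ Poly_Mapping.lookup m j)
          = (\<Prod>j\<in>Poly_Mapping.keys m - {i}. x j ^ Poly_Mapping.lookup m j)"
        by (rule prod.cong) auto
      ultimately show ?thesis by (simp add: power_mult_distrib)
    qed
    have "(\<Sum>m\<in>A. (c m * (2 ^ Poly_Mapping.lookup m i - 2 ^ Poly_Mapping.lookup a i)) * monom_val m x) = 0" for x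
    proof -
      have "(\<Sum>m\<in>insert a A. c m * monom_val m (x(i := 2 * x i))) -
          2 ^ Poly_Mapping.lookup a i * (\<Sum>m\<in>insert a A. c m * monom_val m x) = 0"
        using insert.prems(1) by simp
      then show ?thesis
        unfolding sum_distrib_left scale sum_subtractf[symmetric] using insert.hyps
        by (simp add: algebra_simps)
    qed
    from insert.IH[OF this that]
    have "c k = 0 \<or> of_nat (2 ^ Poly_Mapping.lookup k i) = (of_nat (2 ^ Poly_Mapping.lookup a i) :: complex)"
      by simp
    then show ?thesis
      unfolding of_nat_eq_iff using i by (simp del: of_nat_power)
  qed
  then have "c a * monom_val a (\<lambda>_. 1) = 0"
    using insert.prems(1)[of "\<lambda>_. 1"] insert.hyps by simp
  then have "c a = 0" by (simp add: monom_val_def)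
  with zero insert.prems(2) show ?case by auto
qed simp

lemma poly_eval_eq_0D:
  assumes "\<And>x. poly_eval P x = 0"
  shows "P = 0"
proof -
  have "\<forall>m\<in>Poly_Mapping.keys P. Poly_Mapping.lookup P m = 0"
    using monom_val_independent[of "Poly_Mapping.keys P" "Poly_Mapping.lookup P"] assms
    by (simp add: poly_eval_superset[OF finite_keys order_refl])
  then show ?thesis
    by (auto simp: in_keys_iff poly_mapping_eq_iff fun_eq_iff)
qed

section \<open>Algebraic independence\<close>

text \<open>
  Relations are polynomial functions of \<open>k\<close> parameters instead of coefficient families; over an
  infinite field this is the same.
\<close>
definition alg_indep :: "'a set \<Rightarrow> nat \<Rightarrow> (nat \<Rightarrow> 'a \<Rightarrow> complex) \<Rightarrow> bool" where
  "alg_indep Y k h \<longleftrightarrow> (\<forall>\<phi>\<in>polys {..<k}. (\<forall>y\<in>Y. \<phi> (\<lambda>i. h i y) = 0) \<longrightarrow> (\<forall>x. \<phi> x = 0))"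

lemma alg_independent_on_iff: "alg_independent_on Y k f \<longleftrightarrow> alg_indep Y k (\<lambda>i. poly_fun (f i))"
proof
  assume L: "alg_independent_on Y k f"
  show "alg_indep Y k (\<lambda>i. poly_fun (f i))"
    unfolding alg_indep_def
  proof (intro ballI impI)
    fix \<phi> :: "(nat \<Rightarrow> complex) \<Rightarrow> complex"
    assume \<phi>: "\<phi> \<in> polys {..<k}" "\<forall>y\<in>Y. \<phi> (\<lambda>i. poly_fun (f i) y) = 0"
    obtain P where "vars_in {..<k} P" "\<phi> = poly_eval P" using polys_imp_poly_eval[OF \<phi>(1)] by auto
    with L \<phi>(2) show "\<forall>x. \<phi> x = 0" unfolding alg_independent_on_def vars_in_def by fastforce
  qed
next
  assume R: "alg_indep Y k (\<lambda>i. poly_fun (f i))"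
  show "alg_independent_on Y k f"
    unfolding alg_independent_on_def
  proof (intro allI impI)
    fix P :: "nat cpoly"
    assume "(\<forall>m\<in>Poly_Mapping.keys P. Poly_Mapping.keys m \<subseteq> {..<k}) \<and>
       (\<forall>y\<in>Y. poly_eval P (\<lambda>i. poly_fun (f i) y) = 0)"
    with R have "\<forall>x. poly_eval P x = 0"
      unfolding alg_indep_def using poly_eval_in_polys[of "{..<k}" P] by (auto simp: vars_in_def)
    then show "P = 0" using poly_eval_eq_0D by blast
  qed
qed

lemma alg_indep_mono:
  assumes "alg_indep Y k h" "k' \<le> k" "\<And>i. i < k' \<Longrightarrow> h' i = h i"
  shows "alg_indep Y k' h'"
  unfolding alg_indep_def
proof (intro ballI impI)
  fix \<phi> :: "(nat \<Rightarrow> complex) \<Rightarrow> complex"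
  assume \<phi>: "\<phi> \<in> polys {..<k'}" "\<forall>y\<in>Y. \<phi> (\<lambda>i. h' i y) = 0"
  have "\<phi> (\<lambda>i. h i y) = \<phi> (\<lambda>i. h' i y)" for y
    by (rule polys_cong[OF \<phi>(1)]) (auto simp: assms(3))
  moreover have "\<phi> \<in> polys {..<k}" using \<phi>(1) assms(2) by (auto elim: polys_mono)
  ultimately show "\<forall>x. \<phi> x = 0" using assms(1) \<phi>(2) unfolding alg_indep_def by auto
qed

section \<open>Linear systems and Taylor expansion\<close>

text \<open>Elimination: one equation is solved for an unknown with a nonzero coefficient.\<close>
lemma underdetermined_system:
  fixes a :: "'i \<Rightarrow> 'j \<Rightarrow> 'k::field"
  assumes "finite A" "finite J" "card A < card J"
  shows "\<exists>x. (\<exists>j\<in>J. x j \<noteq> 0) \<and> (\<forall>i\<in>A. (\<Sum>j\<in>J. a i j * x j) = 0)"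
  using assms
proof (induction A arbitrary: J a rule: finite_induct)
  case empty
  then have "J \<noteq> {}" by auto
  then show ?case by (intro exI[of _ "\<lambda>_. 1"]) auto
next
  case (insert i A)
  show ?case
  proof (cases "\<forall>j\<in>J. a i j = 0")
    case True
    obtain x where "\<exists>j\<in>J. x j \<noteq> 0" "\<forall>i\<in>A. (\<Sum>j\<in>J. a i j * x j) = 0"
      using insert.IH[of J a] insert.prems insert.hyps by auto
    with True show ?thesis by (intro exI[of _ x]) auto
  next
    case False
    then obtain j0 where j0: "j0 \<in> J" "a i j0 \<noteq> 0" by auto
    define a' where "a' k j = a k j - a k j0 * a i j / a i j0" for k j
    have "card A < card (J - {j0})"
      using insert.prems insert.hyps j0 by auto
    then obtain x where x: "\<exists>j\<in>J - {j0}. x j \<noteq> 0" "\<forall>k\<in>A. (\<Sum>j\<in>J - {j0}. a' k j * x j) = 0"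
      using insert.IH[of "J - {j0}" a'] insert.prems by auto
    define s where "s = (\<Sum>j\<in>J - {j0}. a i j * x j)"
    define y where "y = x(j0 := - s / a i j0)"
    have split: "(\<Sum>j\<in>J. a k j * y j) = - a k j0 * s / a i j0 + (\<Sum>j\<in>J - {j0}. a k j * x j)" for k
    proof -
      have "(\<Sum>j\<in>J. a k j * y j) = a k j0 * y j0 + (\<Sum>j\<in>J - {j0}. a k j * y j)"
        using insert.prems j0 by (simp add: sum.remove)
      also have "(\<Sum>j\<in>J - {j0}. a k j * y j) = (\<Sum>j\<in>J - {j0}. a k j * x j)"
        by (rule sum.cong) (auto simp: y_def)
      finally show ?thesis by (simp add: y_def)
    qed
    have "(\<Sum>j\<in>J. a k j * y j) = 0" if "k \<in> insert i A" for k
    proof (cases "k = i")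
      case True
      then show ?thesis unfolding split using j0 by (simp add: s_def)
    next
      case False
      then have "(\<Sum>j\<in>J - {j0}. a' k j * x j) = 0" using x that by auto
      then have "(\<Sum>j\<in>J - {j0}. a k j * x j) = a k j0 / a i j0 * s"
        by (simp add: a'_def s_def algebra_simps sum_subtractf sum_distrib_left diff_divide_distrib)
      then show ?thesis unfolding split by simp
    qed
    moreover have "\<exists>j\<in>J. y j \<noteq> 0" using x(1) by (auto simp: y_def)
    ultimately show ?thesis by blast
  qed
qed

definition poly_along :: "(complex \<Rightarrow> complex) \<Rightarrow> bool" where
  "poly_along f \<longleftrightarrow> (\<exists>p. f = poly p)"

lemma poly_along_fun_alg:
  assumes "F \<in> fun_alg B" "\<And>b. b \<in> B \<Longrightarrow> poly_along (\<lambda>t. b (\<gamma> t))"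
  shows "poly_along (\<lambda>t. F (\<gamma> t))"
  using assms(1)
proof induction
  case (fun_alg_const c)
  show ?case unfolding poly_along_def by (intro exI[of _ "[:c:]"]) auto
next
  case (fun_alg_add f g)
  then obtain p q where "(\<lambda>t. f (\<gamma> t)) = poly p" "(\<lambda>t. g (\<gamma> t)) = poly q"
    unfolding poly_along_def by auto
  then show ?case unfolding poly_along_def by (intro exI[of _ "p + q"]) (auto simp: fun_eq_iff)
next
  case (fun_alg_mult f g)
  then obtain p q where "(\<lambda>t. f (\<gamma> t)) = poly p" "(\<lambda>t. g (\<gamma> t)) = poly q"
    unfolding poly_along_def by auto
  then show ?case unfolding poly_along_def by (intro exI[of _ "p * q"]) (auto simp: fun_eq_iff)
qed (use assms(2) in auto)

text \<open>
  A polynomial whose derivatives of all orders vanish at 0 is zero. The derivatives of all orders come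
  from a set of functions that is closed under differentiation along the curve.
\<close>
lemma taylor_vanishing:
  fixes \<N> :: "('a \<Rightarrow> complex) set"
  assumes poly: "\<And>F. F \<in> \<N> \<Longrightarrow> poly_along (\<lambda>t. F (\<gamma> t))"
    and deriv: "\<And>F. F \<in> \<N> \<Longrightarrow> \<exists>F'\<in>\<N>. \<forall>t. ((\<lambda>t. F (\<gamma> t)) has_field_derivative F' (\<gamma> t)) (at t)"
    and zero: "\<And>F. F \<in> \<N> \<Longrightarrow> F (\<gamma> 0) = 0"
    and F: "F \<in> \<N>"
  shows "F (\<gamma> t) = 0"
proof -
  have "p = 0" if "F \<in> \<N>" "degree p \<le> d" "\<And>t. F (\<gamma> t) = poly p t" for F p d
    using that
  proof (induction d arbitrary: F p)
    case 0
    then obtain c where "p = [:c:]" by (metis degree_eq_zeroE le_zero_eq)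
    with 0 zero[of F] show ?case by auto
  next
    case (Suc d)
    obtain F' where F': "F' \<in> \<N>" "\<And>t. ((\<lambda>t. F (\<gamma> t)) has_field_derivative F' (\<gamma> t)) (at t)"
      using deriv[OF Suc.prems(1)] by auto
    have "F' (\<gamma> t) = poly (pderiv p) t" for t
      using F'(2)[of t] unfolding Suc.prems(3) by (rule DERIV_unique) (rule poly_DERIV)
    with Suc.IH[OF F'(1)] Suc.prems(2) have "pderiv p = 0" by (simp add: degree_pderiv)
    then obtain c where "p = [:c:]" by (metis degree_eq_zeroE pderiv_eq_0_iff)
    with Suc.prems zero[of F] show ?case by auto
  qed
  moreover obtain p where "(\<lambda>t. F (\<gamma> t)) = poly p" using poly[OF F] unfolding poly_along_def by auto
  ultimately show ?thesis using F by (metis order_refl poly_0)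
qed

section \<open>Domains of functions\<close>

text \<open>
  The functions of \<open>R\<close> vanishing on \<open>Y\<close> form a prime ideal: this is irreducibility of \<open>Y\<close>, in the
  form of a common point for two generic conditions.
\<close>
definition prime_on :: "('a \<Rightarrow> complex) set \<Rightarrow> 'a set \<Rightarrow> bool" where
  "prime_on R Y \<longleftrightarrow> Y \<noteq> {} \<and> (\<forall>F\<in>R. \<forall>G\<in>R. (\<exists>y\<in>Y. F y \<noteq> 0) \<longrightarrow> (\<exists>y\<in>Y. G y \<noteq> 0) \<longrightarrow>
     (\<exists>y\<in>Y. F y \<noteq> 0 \<and> G y \<noteq> 0))"

lemma prime_onD:
  "prime_on R Y \<Longrightarrow> F \<in> R \<Longrightarrow> G \<in> R \<Longrightarrow> \<exists>y\<in>Y. F y \<noteq> 0 \<Longrightarrow> \<exists>y\<in>Y. G y \<noteq> 0 \<Longrightarrow>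
     \<exists>y\<in>Y. F y \<noteq> 0 \<and> G y \<noteq> 0"
  unfolding prime_on_def by blast

lemma prime_on_vanishing:
  assumes "prime_on R Y" "F \<in> R" "G \<in> R" "\<exists>y\<in>Y. F y \<noteq> 0" "\<And>y. y \<in> Y \<Longrightarrow> F y \<noteq> 0 \<Longrightarrow> G y = 0" "y \<in> Y"
  shows "G y = 0"
  using prime_onD[OF assms(1-4)] assms(5,6) by blast

lemma prime_on_prod:
  assumes "prime_on (fun_alg B) Y" "finite A" "\<And>i. i \<in> A \<Longrightarrow> F i \<in> fun_alg B"
    "\<And>i. i \<in> A \<Longrightarrow> \<exists>y\<in>Y. F i y \<noteq> 0"
  shows "\<exists>y\<in>Y. (\<Prod>i\<in>A. F i y) \<noteq> 0"
  using assms(2-)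
proof (induction A rule: finite_induct)
  case empty
  then show ?case using assms(1) by (auto simp: prime_on_def)
next
  case (insert i A)
  have "\<exists>y\<in>Y. F i y \<noteq> 0 \<and> (\<Prod>i\<in>A. F i y) \<noteq> 0"
    using insert by (intro prime_onD[OF assms(1)] fun_alg_prod) auto
  with insert show ?case by auto
qed

section \<open>Derivations\<close>

definition pd :: "'v \<Rightarrow> (('v \<Rightarrow> complex) \<Rightarrow> complex) \<Rightarrow> ('v \<Rightarrow> complex) \<Rightarrow> complex" where
  "pd i \<phi> x = deriv (\<lambda>t. \<phi> (x(i := t))) (x i)"

lemma pd_DERIV:
  assumes "\<phi> \<in> polys S"
  shows "((\<lambda>t. \<phi> (x(i := t))) has_field_derivative pd i \<phi> x) (at (x i))"
proof -
  have "poly_along (\<lambda>t. \<phi> (x(i := t)))"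
  proof (rule poly_along_fun_alg[OF assms[unfolded polys_def]])
    fix b :: "('a \<Rightarrow> complex) \<Rightarrow> complex"
    assume "b \<in> (\<lambda>i x. x i) ` S"
    then obtain j where "b = (\<lambda>x. x j)" by auto
    then have "(\<lambda>t. b (x(i := t))) = poly (if i = j then [:0, 1:] else [:x j:])"
      by (auto simp: fun_eq_iff)
    then show "poly_along (\<lambda>t. b (x(i := t)))" unfolding poly_along_def by blast
  qed
  then obtain p where "(\<lambda>t. \<phi> (x(i := t))) = poly p" unfolding poly_along_def by auto
  then show ?thesis unfolding pd_def by (metis DERIV_imp_deriv poly_DERIV)
qed

lemma pd_const [simp]: "pd i (\<lambda>_. c) x = 0"
  by (simp add: pd_def)

lemma pd_coord: "pd i (\<lambda>x. x j) x = (if i = j then 1 else 0)"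
  by (simp add: pd_def)

lemma pd_add: "\<phi> \<in> polys S \<Longrightarrow> \<psi> \<in> polys S \<Longrightarrow> pd i (\<lambda>x. \<phi> x + \<psi> x) x = pd i \<phi> x + pd i \<psi> x"
  unfolding pd_def[of i "\<lambda>x. \<phi> x + \<psi> x"]
  by (intro DERIV_imp_deriv DERIV_add pd_DERIV)

lemma pd_mult: "\<phi> \<in> polys S \<Longrightarrow> \<psi> \<in> polys S \<Longrightarrow>
    pd i (\<lambda>x. \<phi> x * \<psi> x) x = \<phi> x * pd i \<psi> x + \<psi> x * pd i \<phi> x"
  unfolding pd_def[of i "\<lambda>x. \<phi> x * \<psi> x"]
  using DERIV_mult[OF pd_DERIV[of \<phi> S x i] pd_DERIV[of \<psi> S x i]]
  by (intro DERIV_imp_deriv) (auto simp: algebra_simps)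

lemma pd_polys: "\<phi> \<in> polys S \<Longrightarrow> pd i \<phi> \<in> polys S"
  unfolding polys_def
proof (induction rule: fun_alg.induct)
  case (fun_alg_const c)
  show ?case by (simp add: fun_alg.fun_alg_const pd_const[abs_def])
next
  case (fun_alg_base b)
  then obtain j where j: "b = (\<lambda>x. x j)" by auto
  have "pd i b = (\<lambda>_. if i = j then 1 else 0)" unfolding j by (auto simp: fun_eq_iff pd_coord)
  then show ?case by (simp add: fun_alg_const)
next
  case (fun_alg_add f g)
  then have "pd i (\<lambda>x. f x + g x) = (\<lambda>x. pd i f x + pd i g x)"
    using pd_add[of f S g i] by (auto simp: polys_def)
  with fun_alg_add show ?case by (auto intro: fun_alg_intros)
next
  case (fun_alg_mult f g)
  then have "pd i (\<lambda>x. f x * g x) = (\<lambda>x. f x * pd i g x + g x * pd i f x)"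
    using pd_mult[of f S g i] by (auto simp: polys_def)
  with fun_alg_mult show ?case by (auto intro: fun_alg_intros)
qed

lemma pd_curve:
  assumes "\<phi> \<in> polys S" "finite S" "\<And>i. i \<in> S \<Longrightarrow> (\<gamma> i has_field_derivative \<gamma>' i) (at t)"
  shows "((\<lambda>t. \<phi> (\<lambda>i. \<gamma> i t)) has_field_derivative (\<Sum>i\<in>S. pd i \<phi> (\<lambda>i. \<gamma> i t) * \<gamma>' i)) (at t)"
  using assms(1) unfolding polys_def
proof (induction)
  case (fun_alg_base b)
  then obtain j where j: "j \<in> S" "b = (\<lambda>x. x j)" by auto
  have "(\<Sum>i\<in>S. pd i b (\<lambda>i. \<gamma> i t) * \<gamma>' i) = (\<Sum>i\<in>S. if i = j then \<gamma>' i else 0)"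
    unfolding j(2) pd_coord by (rule sum.cong) auto
  with j assms(2,3) show ?case by (simp add: sum.delta)
next
  case (fun_alg_add f g)
  then have "f \<in> polys S" "g \<in> polys S" by (auto simp: polys_def)
  then show ?case
    using DERIV_add[OF fun_alg_add.IH] by (simp add: pd_add distrib_right sum.distrib)
next
  case (fun_alg_mult f g)
  then have "f \<in> polys S" "g \<in> polys S" by (auto simp: polys_def)
  then show ?case
    using DERIV_mult[OF fun_alg_mult.IH]
    by (simp add: pd_mult algebra_simps sum.distrib sum_distrib_left)
qed simp

text \<open>
  Tangent vectors are derivations at a point. The chain rule is then algebraic, and applies to the cone
  and to the conormal variety alike, whose coordinates are of different kinds.
\<close>
definition point_derivation :: "('a \<Rightarrow> complex) set \<Rightarrow> 'a \<Rightarrow> (('a \<Rightarrow> complex) \<Rightarrow> complex) \<Rightarrow> bool" where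
  "point_derivation R z \<delta> \<longleftrightarrow> (\<forall>c. \<delta> (\<lambda>_. c) = 0) \<and> (\<forall>F\<in>R. \<forall>G\<in>R.
     \<delta> (\<lambda>x. F x + G x) = \<delta> F + \<delta> G \<and> \<delta> (\<lambda>x. F x * G x) = F z * \<delta> G + G z * \<delta> F)"

lemma point_derivation_chain:
  assumes \<delta>: "point_derivation (fun_alg B) z \<delta>"
    and "\<phi> \<in> polys S" and S: "finite S" and g: "\<And>i. i \<in> S \<Longrightarrow> g i \<in> fun_alg B"
  shows "\<delta> (\<lambda>y. \<phi> (\<lambda>i. g i y)) = (\<Sum>i\<in>S. pd i \<phi> (\<lambda>i. g i z) * \<delta> (g i))"
  using assms(2) unfolding polys_def
proof (induction)
  case (fun_alg_const c)
  then show ?case using \<delta> by (simp add: point_derivation_def)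
next
  case (fun_alg_base b)
  then obtain j where j: "j \<in> S" "b = (\<lambda>x. x j)" by auto
  have "(\<Sum>i\<in>S. pd i b (\<lambda>i. g i z) * \<delta> (g i)) = (\<Sum>i\<in>S. if i = j then \<delta> (g i) else 0)"
    unfolding j(2) pd_coord by (rule sum.cong) auto
  with j S show ?case by (simp add: sum.delta)
next
  case (fun_alg_add f h)
  then have *: "f \<in> polys S" "h \<in> polys S" by (auto simp: polys_def)
  then have "(\<lambda>y. f (\<lambda>i. g i y)) \<in> fun_alg B" "(\<lambda>y. h (\<lambda>i. g i y)) \<in> fun_alg B"
    by (auto intro: polys_subst g)
  with * fun_alg_add.IH \<delta> show ?case
    by (simp add: pd_add distrib_right sum.distrib point_derivation_def)
next
  case (fun_alg_mult f h)
  then have *: "f \<in> polys S" "h \<in> polys S" by (auto simp: polys_def)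
  then have "(\<lambda>y. f (\<lambda>i. g i y)) \<in> fun_alg B" "(\<lambda>y. h (\<lambda>i. g i y)) \<in> fun_alg B"
    by (auto intro: polys_subst g)
  with * fun_alg_mult.IH \<delta> show ?case
    by (simp add: pd_mult algebra_simps sum.distrib sum_distrib_left point_derivation_def)
qed

lemma point_derivation_linear:
  assumes \<delta>: "point_derivation (fun_alg B) z \<delta>" and A: "finite A" and F: "\<And>j. j \<in> A \<Longrightarrow> F j \<in> fun_alg B"
  shows "\<delta> (\<lambda>x. \<Sum>j\<in>A. c j * F j x) = (\<Sum>j\<in>A. c j * \<delta> (F j))"
  using A F
proof (induction A rule: finite_induct)
  case empty
  then show ?case using \<delta> by (simp add: point_derivation_def)
next
  case (insert j A)
  have 1: "(\<lambda>x. c j * F j x) \<in> fun_alg B" "(\<lambda>x. \<Sum>j\<in>A. c j * F j x) \<in> fun_alg B"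
    using insert by (auto intro!: fun_alg_mult fun_alg_const fun_alg_sum)
  have "\<delta> (\<lambda>x. c j * F j x) = c j * \<delta> (F j)"
    using \<delta> fun_alg_const[of "c j" B] insert.prems[of j] unfolding point_derivation_def by auto
  then show ?case
    using \<delta> 1 insert unfolding point_derivation_def by auto
qed

definition tangent_vector :: "('a \<Rightarrow> complex) set \<Rightarrow> 'a set \<Rightarrow> 'a \<Rightarrow> (('a \<Rightarrow> complex) \<Rightarrow> complex) \<Rightarrow> bool" where
  "tangent_vector R Y z \<delta> \<longleftrightarrow> point_derivation R z \<delta> \<and> (\<forall>F\<in>R. (\<forall>y\<in>Y. F y = 0) \<longrightarrow> \<delta> F = 0)"

text \<open>
  Differentiating a relation \<open>\<phi>(g) = 0\<close> on \<open>Y\<close> along tangent vectors gives a linear relation between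
  the differentials with coefficients \<open>\<partial>\<^sub>i\<phi>(g)\<close>. These are therefore zero generically, thus on \<open>Y\<close>, so
  all partial derivatives of \<open>\<phi>\<close> are again relations. The Taylor series of \<open>\<phi>\<close> at \<open>g(y\<^sub>0)\<close> is zero.
\<close>
lemma alg_indep_of_differentials:
  assumes prime: "prime_on (fun_alg B) Y" and g: "\<And>i. i < k \<Longrightarrow> g i \<in> fun_alg B"
    and Q: "Q \<in> fun_alg B" "y0 \<in> Y" "Q y0 \<noteq> 0"
    and indep: "\<And>y c. y \<in> Y \<Longrightarrow> Q y \<noteq> 0 \<Longrightarrow>
      (\<And>\<delta>. tangent_vector (fun_alg B) Y y \<delta> \<Longrightarrow> (\<Sum>i<k. c i * \<delta> (g i)) = 0) \<Longrightarrow> \<forall>i<k. c i = 0"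
  shows "alg_indep Y k g"
proof -
  define N where "N = {\<phi> \<in> polys {..<k}. \<forall>y\<in>Y. \<phi> (\<lambda>i. g i y) = 0}"
  have pdN: "pd j \<phi> \<in> N" if \<phi>: "\<phi> \<in> N" and j: "j < k" for j \<phi>
  proof -
    have pol: "\<phi> \<in> polys {..<k}" "pd j \<phi> \<in> polys {..<k}" using \<phi> by (auto simp: N_def pd_polys)
    have gen: "pd j \<phi> (\<lambda>i. g i y) = 0" if y: "y \<in> Y" "Q y \<noteq> 0" for y
    proof -
      have "(\<Sum>i<k. pd i \<phi> (\<lambda>i. g i y) * \<delta> (g i)) = 0" if "tangent_vector (fun_alg B) Y y \<delta>" for \<delta>
      proof -
        have "\<delta> (\<lambda>y. \<phi> (\<lambda>i. g i y)) = (\<Sum>i<k. pd i \<phi> (\<lambda>i. g i y) * \<delta> (g i))"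
          using that pol g by (intro point_derivation_chain) (auto simp: tangent_vector_def)
        moreover have "\<delta> (\<lambda>y. \<phi> (\<lambda>i. g i y)) = 0"
          using that \<phi> polys_subst[OF pol(1), of g B] g unfolding tangent_vector_def N_def by auto
        ultimately show ?thesis by simp
      qed
      from indep[OF y this] j show ?thesis by blast
    qed
    have "pd j \<phi> (\<lambda>i. g i y) = 0" if "y \<in> Y" for y
      using prime_on_vanishing[OF prime Q(1) polys_subst[OF pol(2), of g B]] g Q gen that by auto
    then show ?thesis using pol by (auto simp: N_def)
  qed
  show ?thesis
    unfolding alg_indep_def
  proof (intro ballI impI allI)
    fix \<phi> x assume "\<phi> \<in> polys {..<k}" "\<forall>y\<in>Y. \<phi> (\<lambda>i. g i y) = 0"
    then have \<phi>: "\<phi> \<in> N" by (auto simp: N_def)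
    define \<gamma> where "\<gamma> t i = g i y0 + t * (x i - g i y0)" for t i
    have "\<phi> (\<gamma> 1) = 0"
    proof (rule taylor_vanishing[of N \<gamma>])
      fix F assume F: "F \<in> N"
      then have Fp: "F \<in> polys {..<k}" by (auto simp: N_def)
      show "poly_along (\<lambda>t. F (\<gamma> t))"
      proof (rule poly_along_fun_alg[OF Fp[unfolded polys_def]])
        fix b :: "(nat \<Rightarrow> complex) \<Rightarrow> complex"
        assume "b \<in> (\<lambda>i x. x i) ` {..<k}"
        then obtain j where "b = (\<lambda>x. x j)" by auto
        then have "(\<lambda>t. b (\<gamma> t)) = poly [:g j y0, x j - g j y0:]"
          by (auto simp: fun_eq_iff \<gamma>_def)
        then show "poly_along (\<lambda>t. b (\<gamma> t))" unfolding poly_along_def by blast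
      qed
      let ?F' = "\<lambda>y. \<Sum>i<k. pd i F y * (x i - g i y0)"
      have "?F' \<in> N"
        using pdN[OF F] unfolding N_def
        by (auto simp: polys_def intro!: fun_alg_sum fun_alg_mult fun_alg_const)
      moreover have "((\<lambda>t. F (\<lambda>i. \<gamma> t i)) has_field_derivative
          (\<Sum>i<k. pd i F (\<lambda>i. \<gamma> t i) * (x i - g i y0))) (at t)" for t
        by (rule pd_curve[OF Fp]) (auto simp: \<gamma>_def intro!: derivative_eq_intros)
      ultimately show "\<exists>F'\<in>N. \<forall>t. ((\<lambda>t. F (\<gamma> t)) has_field_derivative F' (\<gamma> t)) (at t)"
        by (intro bexI[of _ ?F'] allI)
      have "\<gamma> 0 = (\<lambda>i. g i y0)" by (simp add: \<gamma>_def fun_eq_iff)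
      then show "F (\<gamma> 0) = 0" using F Q(2) by (simp add: N_def)
    qed (rule \<phi>)
    moreover have "\<gamma> 1 = x" by (simp add: \<gamma>_def fun_eq_iff)
    ultimately show "\<phi> x = 0" by simp
  qed
qed

section \<open>A bound for the transcendence degree\<close>

text \<open>
  Every generator \<open>b\<^sub>j\<close> of the function algebra is algebraic over \<open>u\<^sub>1, \<dots>, u\<^sub>d\<close>. Functions on \<open>Y\<close> are
  compared with combinations of the products of \<open>u\<^sup>\<beta>\<close> and \<open>b\<^sup>\<epsilon>\<close>, where each \<open>\<beta>\<^sub>i\<close> is at most \<open>t\<close> and
  \<open>\<epsilon>\<^sub>j\<close> is less than the degree of \<open>b\<^sub>j\<close>. The dimension of this space grows like \<open>t\<^sup>d\<close>.
\<close>
locale algebraic_generators =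
  fixes Y :: "'a set" and J :: "'j set" and b :: "'j \<Rightarrow> 'a \<Rightarrow> complex"
    and d :: nat and u :: "nat \<Rightarrow> 'a \<Rightarrow> complex"
    and e :: "'j \<Rightarrow> nat" and a :: "'j \<Rightarrow> nat \<Rightarrow> (nat \<Rightarrow> complex) \<Rightarrow> complex"
  assumes prime: "prime_on (fun_alg (b ` J)) Y"
    and J: "finite J"
    and u: "\<And>i. i < d \<Longrightarrow> u i \<in> fun_alg (b ` J)"
    and a: "\<And>j i. j \<in> J \<Longrightarrow> i \<le> e j \<Longrightarrow> a j i \<in> polys {..<d}"
    and lead: "\<And>j. j \<in> J \<Longrightarrow> \<exists>y\<in>Y. a j (e j) (\<lambda>i. u i y) \<noteq> 0"
    and relation: "\<And>j y. j \<in> J \<Longrightarrow> y \<in> Y \<Longrightarrow> (\<Sum>i\<le>e j. a j i (\<lambda>i. u i y) * b j y ^ i) = 0"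
begin

definition box_exponents :: "nat \<Rightarrow> ((nat \<Rightarrow> nat) \<times> ('j \<Rightarrow> nat)) set" where
  "box_exponents t = ({..<d} \<rightarrow>\<^sub>E {..t}) \<times> (\<Pi>\<^sub>E j\<in>J. {..<e j})"

definition mono_fun :: "(nat \<Rightarrow> nat) \<times> ('j \<Rightarrow> nat) \<Rightarrow> 'a \<Rightarrow> complex" where
  "mono_fun p y = (\<Prod>i<d. u i y ^ fst p i) * (\<Prod>j\<in>J. b j y ^ snd p j)"

definition box_span :: "nat \<Rightarrow> ('a \<Rightarrow> complex) set" where
  "box_span t = {F. \<exists>c. \<forall>y\<in>Y. F y = (\<Sum>p\<in>box_exponents t. c p * mono_fun p y)}"

definition raises :: "('a \<Rightarrow> complex) \<Rightarrow> nat \<Rightarrow> bool" where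
  "raises G h \<longleftrightarrow> (\<forall>t. \<forall>F\<in>box_span t. (\<lambda>y. G y * F y) \<in> box_span (t + h))"

lemma raisesD: "raises G h \<Longrightarrow> F \<in> box_span t \<Longrightarrow> (\<lambda>y. G y * F y) \<in> box_span (t + h)"
  unfolding raises_def by blast

lemma finite_box_exponents: "finite (box_exponents t)"
  unfolding box_exponents_def using J by (intro finite_cartesian_product finite_PiE) auto

lemma card_box_exponents: "card (box_exponents t) = (t + 1) ^ d * (\<Prod>j\<in>J. e j)"
  unfolding box_exponents_def using J by (simp add: card_cartesian_product card_PiE)

lemma box_span_cong: "F \<in> box_span t \<Longrightarrow> (\<And>y. y \<in> Y \<Longrightarrow> F y = G y) \<Longrightarrow> G \<in> box_span t"
  unfolding box_span_def by auto

lemma box_span_0: "(\<lambda>_. 0) \<in> box_span t"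
  unfolding box_span_def by (auto intro!: exI[of _ "\<lambda>_. 0"])

lemma box_span_add: "F \<in> box_span t \<Longrightarrow> G \<in> box_span t \<Longrightarrow> (\<lambda>y. F y + G y) \<in> box_span t"
proof -
  assume "F \<in> box_span t" "G \<in> box_span t"
  then obtain c c' where "\<forall>y\<in>Y. F y = (\<Sum>p\<in>box_exponents t. c p * mono_fun p y)"
    "\<forall>y\<in>Y. G y = (\<Sum>p\<in>box_exponents t. c' p * mono_fun p y)" unfolding box_span_def by auto
  then show ?thesis
    unfolding box_span_def by (auto intro!: exI[of _ "\<lambda>p. c p + c' p"] simp: distrib_right sum.distrib)
qed

lemma box_span_scale: "F \<in> box_span t \<Longrightarrow> (\<lambda>y. s * F y) \<in> box_span t"
proof -
  assume "F \<in> box_span t"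
  then obtain c where "\<forall>y\<in>Y. F y = (\<Sum>p\<in>box_exponents t. c p * mono_fun p y)" unfolding box_span_def by auto
  then show ?thesis
    unfolding box_span_def by (auto intro!: exI[of _ "\<lambda>p. s * c p"] simp: sum_distrib_left mult.assoc)
qed

lemma box_span_sum: "(\<And>i. i \<in> A \<Longrightarrow> F i \<in> box_span t) \<Longrightarrow> (\<lambda>y. \<Sum>i\<in>A. F i y) \<in> box_span t"
  by (induction A rule: infinite_finite_induct) (auto intro: box_span_0 box_span_add)

lemma box_span_mono_fun: "p \<in> box_exponents t \<Longrightarrow> mono_fun p \<in> box_span t"
  unfolding box_span_def using finite_box_exponents
  by (auto intro!: exI[of _ "\<lambda>q. if q = p then 1 else 0"] simp: if_distrib[of "\<lambda>x. x * _"] sum.delta cong: if_cong)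

lemma box_exponents_mono: "t \<le> t' \<Longrightarrow> box_exponents t \<subseteq> box_exponents t'"
  unfolding box_exponents_def by (intro Sigma_mono PiE_mono) auto

lemma mult_box_span:
  assumes "\<And>p. p \<in> box_exponents t \<Longrightarrow> (\<lambda>y. G y * mono_fun p y) \<in> box_span t'" "F \<in> box_span t"
  shows "(\<lambda>y. G y * F y) \<in> box_span t'"
proof -
  obtain c where c: "\<forall>y\<in>Y. F y = (\<Sum>p\<in>box_exponents t. c p * mono_fun p y)"
    using assms(2) unfolding box_span_def by auto
  have "(\<lambda>y. \<Sum>p\<in>box_exponents t. c p * (G y * mono_fun p y)) \<in> box_span t'"
    by (intro box_span_sum box_span_scale assms(1))
  then show ?thesis
    by (rule box_span_cong) (use c in \<open>auto simp: sum_distrib_left mult_ac\<close>)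
qed

lemma box_span_mono: "F \<in> box_span t \<Longrightarrow> t \<le> t' \<Longrightarrow> F \<in> box_span t'"
  using mult_box_span[of t "\<lambda>_. 1" t' F] box_span_mono_fun box_exponents_mono[of t t'] by auto

lemma raises_mono: "raises G h \<Longrightarrow> h \<le> h' \<Longrightarrow> raises G h'"
  unfolding raises_def using box_span_mono by (meson add_le_cancel_left)

lemma raises_mult: "raises G h \<Longrightarrow> raises G' h' \<Longrightarrow> raises (\<lambda>y. G y * G' y) (h + h')"
  unfolding raises_def
proof (intro allI ballI)
  fix t F assume *: "\<forall>t. \<forall>F\<in>box_span t. (\<lambda>y. G y * F y) \<in> box_span (t + h)"
    "\<forall>t. \<forall>F\<in>box_span t. (\<lambda>y. G' y * F y) \<in> box_span (t + h')" "F \<in> box_span t"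
  then have "(\<lambda>y. G' y * F y) \<in> box_span (t + h')" by blast
  from bspec[OF spec[OF *(1)] this] have "(\<lambda>y. G y * (G' y * F y)) \<in> box_span (t + h' + h)" .
  then show "(\<lambda>y. G y * G' y * F y) \<in> box_span (t + (h + h'))" by (simp add: mult.assoc add_ac)
qed

lemma raises_add: "raises G h \<Longrightarrow> raises G' h \<Longrightarrow> raises (\<lambda>y. G y + G' y) h"
  unfolding raises_def using box_span_add by (fastforce simp: distrib_right)

lemma raises_const: "raises (\<lambda>_. c) 0"
  unfolding raises_def using box_span_scale by auto

lemma raises_power: "raises G h \<Longrightarrow> raises (\<lambda>y. G y ^ n) (n * h)"
proof (induction n)
  case 0
  then show ?case using raises_const[of 1] by simp
next
  case (Suc n)
  then show ?case using raises_mult[of G h "\<lambda>y. G y ^ n" "n * h"] by simp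
qed

lemma raises_prod:
  "finite A \<Longrightarrow> (\<And>i. i \<in> A \<Longrightarrow> raises (G i) h) \<Longrightarrow> raises (\<lambda>y. \<Prod>i\<in>A. G i y) (card A * h)"
proof (induction A rule: finite_induct)
  case empty
  then show ?case using raises_const[of 1] by simp
next
  case (insert i A)
  then have "raises (\<lambda>y. G i y * (\<Prod>i\<in>A. G i y)) (h + card A * h)"
    by (intro raises_mult) auto
  then show ?case using insert by simp
qed

lemma raises_u:
  assumes i: "i < d"
  shows "raises (u i) 1"
  unfolding raises_def
proof (intro allI ballI, erule mult_box_span[rotated])
  fix t p assume p: "p \<in> box_exponents t"
  obtain \<beta> \<epsilon> where p_eq: "p = (\<beta>, \<epsilon>)" by (cases p)
  let ?q = "(\<beta>(i := Suc (\<beta> i)), \<epsilon>)"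
  have "u i y * (\<Prod>i<d. u i y ^ \<beta> i) = (\<Prod>k<d. u k y ^ (\<beta>(i := Suc (\<beta> i))) k)" for y
  proof -
    have *: "(\<Prod>k<d. u k y ^ g k) = u i y ^ g i * (\<Prod>k\<in>{..<d} - {i}. u k y ^ g k)" for g
      using i by (simp add: prod.remove)
    have "(\<Prod>k\<in>{..<d} - {i}. u k y ^ (\<beta>(i := Suc (\<beta> i))) k) = (\<Prod>k\<in>{..<d} - {i}. u k y ^ \<beta> k)"
      by (rule prod.cong) auto
    then show ?thesis unfolding * by simp
  qed
  then have "mono_fun ?q = (\<lambda>y. u i y * mono_fun p y)"
    by (auto simp: fun_eq_iff mono_fun_def p_eq)
  moreover have "?q \<in> box_exponents (t + 1)"
    using p i unfolding box_exponents_def p_eq by (auto simp: PiE_iff extensional_def le_SucI)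
  ultimately show "(\<lambda>y. u i y * mono_fun p y) \<in> box_span (t + 1)"
    using box_span_mono_fun by metis
qed

lemma raises_polys: "\<phi> \<in> polys {..<d} \<Longrightarrow> \<exists>h. raises (\<lambda>y. \<phi> (\<lambda>i. u i y)) h"
  unfolding polys_def
proof (induction rule: fun_alg.induct)
  case (fun_alg_const c)
  then show ?case using raises_const by blast
next
  case (fun_alg_base b)
  then show ?case using raises_u by auto
next
  case (fun_alg_add f g)
  then obtain h h' where "raises (\<lambda>y. f (\<lambda>i. u i y)) h" "raises (\<lambda>y. g (\<lambda>i. u i y)) h'" by auto
  then show ?case
    by (intro exI[of _ "max h h'"] raises_add) (auto elim: raises_mono)
next
  case (fun_alg_mult f g)
  then show ?case using raises_mult by blast
qed

text \<open>
  The common denominator: after multiplication by it, the power of a generator at the degree of its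
  equation can be replaced by lower powers.
\<close>
definition lead_prod :: "'a \<Rightarrow> complex" where
  "lead_prod y = (\<Prod>j\<in>J. a j (e j) (\<lambda>i. u i y))"

lemma lead_prod_polys: "(\<lambda>x. \<Prod>j\<in>J. a j (e j) x) \<in> polys {..<d}"
  using a unfolding polys_def by (auto intro: fun_alg_prod)

lemma lead_prod_raises: "\<exists>h. raises lead_prod h"
  using raises_polys[OF lead_prod_polys] by (simp add: lead_prod_def[abs_def])

lemma raises_generator:
  assumes j: "j \<in> J"
  shows "\<exists>h. raises (\<lambda>y. lead_prod y * b j y) h"
proof -
  obtain h0 where h0: "raises lead_prod h0" using lead_prod_raises by auto
  let ?c = "\<lambda>i x. (\<Prod>j\<in>J - {j}. a j (e j) x) * - a j i x"
  have "\<forall>i\<in>{..e j}. \<exists>h. raises (\<lambda>y. ?c i (\<lambda>i. u i y)) h"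
    using a j unfolding polys_def
    by (intro ballI raises_polys[unfolded polys_def] fun_alg_mult fun_alg_prod fun_alg_uminus) auto
  then obtain h1 where h1: "\<And>i. i \<le> e j \<Longrightarrow> raises (\<lambda>y. ?c i (\<lambda>i. u i y)) (h1 i)"
    by (auto dest!: bchoice)
  define h where "h = max h0 (Max (h1 ` {..e j}))"
  have hi: "raises (\<lambda>y. ?c i (\<lambda>i. u i y)) h" if "i \<le> e j" for i
    using h1[OF that] that by (rule_tac raises_mono) (auto simp: h_def le_max_iff_disj)
  have h0': "raises lead_prod h" using h0 by (rule raises_mono) (simp add: h_def)
  have "raises (\<lambda>y. lead_prod y * b j y) h"
    unfolding raises_def
  proof (intro allI ballI, erule mult_box_span[rotated])
    fix t p assume p: "p \<in> box_exponents t"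
    obtain \<beta> \<epsilon> where p_eq: "p = (\<beta>, \<epsilon>)" by (cases p)
    define q where "q i = (\<beta>, \<epsilon>(j := i))" for i
    have q: "q i \<in> box_exponents t" if "i < e j" for i
      using p that j unfolding box_exponents_def q_def p_eq by (auto simp: PiE_iff extensional_def)
    have \<epsilon>: "\<epsilon> j < e j" using p j unfolding box_exponents_def p_eq by auto
    have mono_q: "mono_fun (q i) y = b j y ^ i * mono_fun (q 0) y" for i y
    proof -
      have *: "(\<Prod>k\<in>J. b k y ^ g k) = b j y ^ g j * (\<Prod>k\<in>J - {j}. b k y ^ g k)" for g
        using J j by (simp add: prod.remove)
      have "(\<Prod>k\<in>J - {j}. b k y ^ (\<epsilon>(j := i)) k) = (\<Prod>k\<in>J - {j}. b k y ^ \<epsilon> k)" for i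
        by (rule prod.cong) auto
      then show ?thesis by (simp add: mono_fun_def q_def *)
    qed
    have mono_p: "mono_fun p y = b j y ^ \<epsilon> j * mono_fun (q 0) y" for y
      using mono_q[of "\<epsilon> j"] by (simp add: q_def p_eq)
    show "(\<lambda>y. lead_prod y * b j y * mono_fun p y) \<in> box_span (t + h)"
    proof (cases "Suc (\<epsilon> j) < e j")
      case True
      have "(\<lambda>y. lead_prod y * mono_fun (q (Suc (\<epsilon> j))) y) \<in> box_span (t + h)"
        using h0' box_span_mono_fun[OF q[OF True]] unfolding raises_def by blast
      then show ?thesis by (simp add: mono_p mono_q[of "Suc (\<epsilon> j)"] mult_ac)
    next
      case False
      then have e_eq: "e j = Suc (\<epsilon> j)" using \<epsilon> by simp
      have "(\<lambda>y. \<Sum>i<e j. ?c i (\<lambda>i. u i y) * mono_fun (q i) y) \<in> box_span (t + h)"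
      proof (rule box_span_sum)
        fix i assume "i \<in> {..<e j}"
        then show "(\<lambda>y. ?c i (\<lambda>i. u i y) * mono_fun (q i) y) \<in> box_span (t + h)"
          using hi[of i] box_span_mono_fun[OF q, of i] unfolding raises_def by auto
      qed
      then show ?thesis
      proof (rule box_span_cong)
        fix y assume y: "y \<in> Y"
        let ?A = "\<lambda>i. a j i (\<lambda>i. u i y)" and ?P = "\<Prod>j\<in>J - {j}. a j (e j) (\<lambda>i. u i y)"
        have rel: "?A (e j) * b j y ^ e j = - (\<Sum>i<e j. ?A i * b j y ^ i)"
          using relation[OF j y] by (simp add: lessThan_Suc_atMost[symmetric] add_eq_0_iff)
        have lp: "lead_prod y = ?P * ?A (e j)"
          unfolding lead_prod_def using J j by (simp add: prod.remove mult.commute)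
        have reassoc: "x * A * z * (z ^ \<epsilon> j * m) = x * (A * z ^ e j) * m" for x A z m :: complex
          by (simp add: e_eq mult_ac)
        have "lead_prod y * b j y * mono_fun p y = ?P * (?A (e j) * b j y ^ e j) * mono_fun (q 0) y"
          unfolding mono_p lp by (rule reassoc)
        also have "\<dots> = ?P * - (\<Sum>i<e j. ?A i * b j y ^ i) * mono_fun (q 0) y"
          unfolding rel ..
        also have "\<dots> = (\<Sum>i<e j. ?P * - ?A i * mono_fun (q i) y)"
        proof -
          have key: "?P * - ?A i * mono_fun (q i) y = ?P * - (?A i * b j y ^ i) * mono_fun (q 0) y" for i
            by (subst mono_q[of i]) (simp add: mult_ac)
          show ?thesis
            unfolding sum_negf[symmetric] sum_distrib_left sum_distrib_right
            by (intro sum.cong refl key[symmetric])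
        qed
        finally show "(\<Sum>i<e j. ?P * - ?A i * mono_fun (q i) y) = lead_prod y * b j y * mono_fun p y" ..
      qed
    qed
  qed
  then show ?thesis ..
qed

lemma raises_fun_alg:
  assumes "F \<in> fun_alg (b ` J)"
  shows "\<exists>q h. raises (\<lambda>y. lead_prod y ^ q * F y) h"
  using assms
proof induction
  case (fun_alg_const c)
  show ?case using raises_const by (intro exI[of _ 0]) auto
next
  case (fun_alg_base f)
  then obtain j where "j \<in> J" "f = b j" by auto
  then obtain h where "raises (\<lambda>y. lead_prod y ^ 1 * f y) h"
    using raises_generator[of j] by auto
  then show ?case by blast
next
  case (fun_alg_add f g)
  then obtain q h q' h' where *: "raises (\<lambda>y. lead_prod y ^ q * f y) h"
    "raises (\<lambda>y. lead_prod y ^ q' * g y) h'" by auto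
  obtain h0 where h0: "raises lead_prod h0" using lead_prod_raises by auto
  let ?H = "max (q' * h0 + h) (q * h0 + h')"
  have "raises (\<lambda>y. lead_prod y ^ q' * (lead_prod y ^ q * f y)) ?H"
    by (rule raises_mono[OF raises_mult[OF raises_power[OF h0] *(1)]]) simp
  moreover have "raises (\<lambda>y. lead_prod y ^ q * (lead_prod y ^ q' * g y)) ?H"
    by (rule raises_mono[OF raises_mult[OF raises_power[OF h0] *(2)]]) simp
  ultimately have "raises (\<lambda>y. lead_prod y ^ (q + q') * (f y + g y)) ?H"
    using raises_add by (fastforce simp: power_add algebra_simps)
  then show ?case by blast
next
  case (fun_alg_mult f g)
  then obtain q h q' h' where *: "raises (\<lambda>y. lead_prod y ^ q * f y) h"
    "raises (\<lambda>y. lead_prod y ^ q' * g y) h'" by auto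
  from raises_mult[OF this] have "raises (\<lambda>y. lead_prod y ^ (q + q') * (f y * g y)) (h + h')"
    by (simp add: power_add mult_ac)
  then show ?case by blast
qed

lemma one_box_span: "(\<lambda>_. 1) \<in> box_span 0"
proof -
  have e: "0 < e j" if j: "j \<in> J" for j
  proof (rule ccontr)
    assume "\<not> 0 < e j"
    then have "a j (e j) (\<lambda>i. u i y) = 0" if "y \<in> Y" for y using relation[OF j that] by simp
    with lead[OF j] show False by blast
  qed
  let ?p = "(\<lambda>i. if i < d then 0 else undefined, \<lambda>j. if j \<in> J then 0 else undefined)"
  have "?p \<in> box_exponents 0" unfolding box_exponents_def using e by (auto simp: PiE_iff extensional_def)
  then have "mono_fun ?p \<in> box_span 0" by (rule box_span_mono_fun)
  moreover have "mono_fun ?p = (\<lambda>_. 1)" by (auto simp: mono_fun_def fun_eq_iff)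
  ultimately show ?thesis by simp
qed

text \<open>
  After multiplication by a power of the common denominator, the \<open>(E + 1)\<^bsup>d+1\<^esup>\<close> monomials in \<open>d + 1\<close>
  functions with exponents at most \<open>E\<close> lie in a space of dimension of the order \<open>E\<^sup>d\<close>. For large \<open>E\<close>
  they are linearly dependent, which is an algebraic relation.
\<close>
theorem alg_indep_bound:
  assumes h: "\<And>i. i < k \<Longrightarrow> h i \<in> fun_alg (b ` J)" and indep: "alg_indep Y k h"
  shows "k \<le> d"
proof (rule ccontr)
  assume "\<not> k \<le> d"
  define K where "K = Suc d"
  have hK: "h i \<in> fun_alg (b ` J)" if "i < K" for i using h that \<open>\<not> k \<le> d\<close> K_def by auto
  have indepK: "alg_indep Y K h" using alg_indep_mono[OF indep, of K h] \<open>\<not> k \<le> d\<close> K_def by auto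
  obtain h0 where h0: "raises lead_prod h0" using lead_prod_raises by auto
  have "\<forall>i\<in>{..<K}. \<exists>qH. raises (\<lambda>y. lead_prod y ^ fst qH * h i y) (snd qH)"
    using raises_fun_alg hK by fastforce
  from bchoice[OF this] obtain qH where
    "\<forall>i\<in>{..<K}. raises (\<lambda>y. lead_prod y ^ fst (qH i) * h i y) (snd (qH i))" by blast
  then have qH: "raises (\<lambda>y. lead_prod y ^ fst (qH i) * h i y) (snd (qH i))" if "i < K" for i
    using that by blast
  define q where "q = Max (fst ` qH ` {..<K})"
  define H where "H = q * h0 + Max (snd ` qH ` {..<K})"
  have q: "fst (qH i) \<le> q" if "i < K" for i unfolding q_def using that by (intro Max_ge) auto
  have rh: "raises (\<lambda>y. lead_prod y ^ q * h i y) H" if i: "i < K" for i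
  proof -
    have "raises (\<lambda>y. lead_prod y ^ (q - fst (qH i)) * (lead_prod y ^ fst (qH i) * h i y))
        ((q - fst (qH i)) * h0 + snd (qH i))"
      by (intro raises_mult raises_power h0 qH i)
    moreover have "lead_prod y ^ (q - fst (qH i)) * (lead_prod y ^ fst (qH i) * h i y)
       = lead_prod y ^ q * h i y" for y
      using q[OF i] by (simp add: power_add[symmetric] mult.assoc[symmetric])
    moreover have "(q - fst (qH i)) * h0 + snd (qH i) \<le> H"
      unfolding H_def using i by (intro add_mono mult_right_mono Max_ge) auto
    ultimately show ?thesis using raises_mono by simp
  qed
  have rl: "raises (\<lambda>y. lead_prod y ^ q) H"
    by (rule raises_mono[OF raises_power[OF h0]]) (simp add: H_def)
  define W where "W = (\<Prod>j\<in>J. e j)"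
  \<comment> \<open>Chosen so that \<open>(K E H + 1)\<^sup>d W \<le> E (E + 1)\<^sup>d < (E + 1)\<^bsup>d+1\<^esup>\<close>.\<close>
  define E where "E = (K * H + 1) ^ d * W"
  let ?T = "K * (E * H)"
  define \<Gamma> where "\<Gamma> = ({..<K} \<rightarrow>\<^sub>E {..E})"
  have fin\<Gamma>: "finite \<Gamma>" unfolding \<Gamma>_def by (intro finite_PiE) auto
  let ?G = "\<lambda>\<gamma> y. \<Prod>i<K. (lead_prod y ^ q) ^ E * h i y ^ \<gamma> i"
  have "?G \<gamma> \<in> box_span ?T" if \<gamma>: "\<gamma> \<in> \<Gamma>" for \<gamma>
  proof -
    have "raises (\<lambda>y. (lead_prod y ^ q) ^ E * h i y ^ \<gamma> i) (E * H)" if i: "i < K" for i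
    proof -
      have le: "\<gamma> i \<le> E" using \<gamma> i unfolding \<Gamma>_def by auto
      have "raises (\<lambda>y. (lead_prod y ^ q * h i y) ^ \<gamma> i * (lead_prod y ^ q) ^ (E - \<gamma> i))
          (\<gamma> i * H + (E - \<gamma> i) * H)"
        by (intro raises_mult raises_power rh[OF i] rl)
      moreover have "\<gamma> i * H + (E - \<gamma> i) * H = E * H"
        using le by (simp add: add_mult_distrib[symmetric])
      moreover have "(lead_prod y ^ q * h i y) ^ \<gamma> i * (lead_prod y ^ q) ^ (E - \<gamma> i)
          = (lead_prod y ^ q) ^ E * h i y ^ \<gamma> i" for y
      proof -
        have "(x * z) ^ \<gamma> i * x ^ (E - \<gamma> i) = x ^ (\<gamma> i + (E - \<gamma> i)) * z ^ \<gamma> i" for x z :: complex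
          by (simp only: power_mult_distrib power_add mult_ac)
        then show ?thesis using le by simp
      qed
      ultimately show ?thesis by simp
    qed
    then have "raises (?G \<gamma>) ?T" using raises_prod[of "{..<K}"] by simp
    then have "(\<lambda>y. ?G \<gamma> y * 1) \<in> box_span (0 + ?T)" by (rule raisesD) (rule one_box_span)
    then show ?thesis by simp
  qed
  then have "\<forall>\<gamma>\<in>\<Gamma>. \<exists>c. \<forall>y\<in>Y. ?G \<gamma> y = (\<Sum>p\<in>box_exponents ?T. c p * mono_fun p y)"
    unfolding box_span_def by blast
  then obtain c where c: "\<And>\<gamma> y. \<gamma> \<in> \<Gamma> \<Longrightarrow> y \<in> Y \<Longrightarrow> ?G \<gamma> y = (\<Sum>p\<in>box_exponents ?T. c \<gamma> p * mono_fun p y)"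
    by (auto dest!: bchoice)
  have "card (box_exponents ?T) < card \<Gamma>"
  proof -
    have "?T + 1 \<le> (K * H + 1) * (E + 1)" by (simp add: algebra_simps)
    then have "(?T + 1) ^ d * W \<le> ((K * H + 1) * (E + 1)) ^ d * W"
      by (intro mult_right_mono power_mono) auto
    also have "\<dots> = E * (E + 1) ^ d" by (simp only: power_mult_distrib E_def mult_ac)
    also have "\<dots> < (E + 1) ^ K" unfolding K_def by simp
    also have "\<dots> = card \<Gamma>" unfolding \<Gamma>_def by (simp add: card_PiE)
    finally show ?thesis unfolding card_box_exponents W_def .
  qed
  then obtain x where x: "\<exists>\<gamma>\<in>\<Gamma>. x \<gamma> \<noteq> 0" "\<And>p. p \<in> box_exponents ?T \<Longrightarrow> (\<Sum>\<gamma>\<in>\<Gamma>. c \<gamma> p * x \<gamma>) = 0"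
    using underdetermined_system[OF finite_box_exponents fin\<Gamma>, of ?T "\<lambda>p \<gamma>. c \<gamma> p"] by auto
  define \<phi> where "\<phi> z = (\<Sum>\<gamma>\<in>\<Gamma>. x \<gamma> * (\<Prod>i<K. z i ^ \<gamma> i))" for z :: "nat \<Rightarrow> complex"
  have \<phi>: "\<phi> \<in> polys {..<K}"
    unfolding \<phi>_def[abs_def] polys_def
    by (intro fun_alg_sum fun_alg_mult fun_alg_const fun_alg_prod fun_alg_power fun_alg_base) auto
  have vanish: "lead_prod y ^ (q * E * K) * \<phi> (\<lambda>i. h i y) = 0" if y: "y \<in> Y" for y
  proof -
    have "lead_prod y ^ (q * E * K) * \<phi> (\<lambda>i. h i y) = (\<Sum>\<gamma>\<in>\<Gamma>. x \<gamma> * ?G \<gamma> y)"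
      unfolding \<phi>_def by (simp add: sum_distrib_left prod.distrib power_mult[symmetric] mult_ac)
    also have "\<dots> = (\<Sum>\<gamma>\<in>\<Gamma>. \<Sum>p\<in>box_exponents ?T. c \<gamma> p * x \<gamma> * mono_fun p y)"
      using c y by (intro sum.cong) (auto simp: sum_distrib_left mult_ac)
    also have "\<dots> = (\<Sum>p\<in>box_exponents ?T. (\<Sum>\<gamma>\<in>\<Gamma>. c \<gamma> p * x \<gamma>) * mono_fun p y)"
      by (subst sum.swap) (simp add: sum_distrib_right)
    also have "\<dots> = 0" using x(2) by simp
    finally show ?thesis .
  qed
  have "lead_prod \<in> fun_alg (b ` J)"
    using polys_subst[OF lead_prod_polys, of u] u by (simp add: lead_prod_def[abs_def])
  moreover have "(\<lambda>y. \<phi> (\<lambda>i. h i y)) \<in> fun_alg (b ` J)"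
    by (rule polys_subst[OF \<phi>]) (use hK in auto)
  moreover have "\<exists>y\<in>Y. lead_prod y \<noteq> 0"
    unfolding lead_prod_def
  proof (rule prime_on_prod[OF prime J])
    show "(\<lambda>y. a j (e j) (\<lambda>i. u i y)) \<in> fun_alg (b ` J)" if "j \<in> J" for j
      using polys_subst[OF a[OF that order_refl], of u] u by auto
  qed (rule lead)
  ultimately have "\<phi> (\<lambda>i. h i y) = 0" if "y \<in> Y" for y
    using prime_on_vanishing[OF prime, of lead_prod "\<lambda>y. \<phi> (\<lambda>i. h i y)" y] vanish that by auto
  with indepK \<phi> have zero: "\<phi> z = 0" for z unfolding alg_indep_def by blast
  define pm where "pm \<gamma> = Abs_poly_mapping (\<lambda>i. if i < K then \<gamma> i else (0::nat))" for \<gamma>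
  have lookup_pm: "Poly_Mapping.lookup (pm \<gamma>) = (\<lambda>i. if i < K then \<gamma> i else 0)" for \<gamma>
    unfolding pm_def by (rule lookup_Abs_poly_mapping) (auto intro: finite_subset[of _ "{..<K}"])
  have inj: "inj_on pm \<Gamma>"
  proof (rule inj_onI)
    fix \<gamma> \<gamma>' assume *: "\<gamma> \<in> \<Gamma>" "\<gamma>' \<in> \<Gamma>" "pm \<gamma> = pm \<gamma>'"
    have "\<gamma> i = \<gamma>' i" if "i < K" for i
      using fun_cong[OF lookup_pm[of \<gamma>, unfolded *(3) lookup_pm], of i] that by simp
    with * show "\<gamma> = \<gamma>'" unfolding \<Gamma>_def by (intro PiE_ext) auto
  qed
  have "monom_val (pm \<gamma>) z = (\<Prod>i<K. z i ^ \<gamma> i)" for \<gamma> z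
  proof -
    have "Poly_Mapping.keys (pm \<gamma>) \<subseteq> {..<K}" by (auto simp: in_keys_iff lookup_pm split: if_splits)
    then show ?thesis by (simp add: monom_val_superset[of "{..<K}"] lookup_pm)
  qed
  then have "(\<Sum>m\<in>pm ` \<Gamma>. x (inv_into \<Gamma> pm m) * monom_val m z) = 0" for z
    using zero[of z] unfolding sum.reindex[OF inj] \<phi>_def by (simp add: inv_into_f_f[OF inj])
  then have "x (inv_into \<Gamma> pm (pm \<gamma>)) = 0" if "\<gamma> \<in> \<Gamma>" for \<gamma>
    using monom_val_independent[of "pm ` \<Gamma>" "\<lambda>m. x (inv_into \<Gamma> pm m)" "pm \<gamma>"] fin\<Gamma> that by auto
  with x(1) inj show False by (simp add: inv_into_f_f)
qed

end

section \<open>Algebraic dependence as a polynomial equation\<close>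

lemma polys_expand_last:
  assumes "\<phi> \<in> polys {..<Suc d}"
  shows "\<exists>E a. (\<forall>i. a i \<in> polys {..<d}) \<and> (\<forall>x. \<phi> x = (\<Sum>i\<le>E. a i x * x d ^ i))"
proof -
  obtain P where P: "vars_in {..<Suc d} P" "\<phi> = poly_eval P" using polys_imp_poly_eval[OF assms] by auto
  let ?K = "Poly_Mapping.keys P" and ?l = "\<lambda>m. Poly_Mapping.lookup m d"
  define E where "E = (\<Sum>m\<in>?K. ?l m)"
  define a where "a i x = (\<Sum>m\<in>{m\<in>?K. ?l m = i}. Poly_Mapping.lookup P m *
      (\<Prod>k<d. x k ^ Poly_Mapping.lookup m k))" for i and x :: "nat \<Rightarrow> complex"
  have le: "?l m \<le> E" if "m \<in> ?K" for m unfolding E_def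
    using that by (intro member_le_sum[of m ?K "\<lambda>m. ?l m"]) auto
  have "a i \<in> polys {..<d}" for i
    unfolding a_def[abs_def] polys_def
    by (intro fun_alg_sum fun_alg_mult fun_alg_const fun_alg_prod fun_alg_power fun_alg_base) auto
  moreover have "\<phi> x = (\<Sum>i\<le>E. a i x * x d ^ i)" for x
  proof -
    have "\<phi> x = (\<Sum>m\<in>?K. Poly_Mapping.lookup P m * ((\<Prod>k<d. x k ^ Poly_Mapping.lookup m k) * x d ^ ?l m))"
      unfolding P(2) poly_eval_superset[OF finite_keys order_refl]
      using P(1) by (intro sum.cong refl) (simp add: monom_val_superset[of "{..<Suc d}"] vars_in_def)
    also have "\<dots> = (\<Sum>i\<le>E. \<Sum>m\<in>{m\<in>?K. ?l m = i}.
        Poly_Mapping.lookup P m * ((\<Prod>k<d. x k ^ Poly_Mapping.lookup m k) * x d ^ ?l m))"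
      using le by (intro sum.group[symmetric]) auto
    also have "\<dots> = (\<Sum>i\<le>E. a i x * x d ^ i)"
      unfolding a_def sum_distrib_right by (intro sum.cong) (auto simp: mult_ac)
    finally show ?thesis .
  qed
  ultimately show ?thesis by blast
qed

text \<open>
  The relation is expanded in powers of the last variable. The highest nonzero coefficient does not vanish
  on \<open>C\<close>, by independence of \<open>u\<close>.
\<close>
lemma algebraic_relation:
  assumes u: "alg_indep C d u" and dep: "\<not> alg_indep C (Suc d) (u(d := g))"
  shows "\<exists>e a. (\<forall>i\<le>e. a i \<in> polys {..<d}) \<and> (\<exists>y\<in>C. a e (\<lambda>i. u i y) \<noteq> 0) \<and>
    (\<forall>y\<in>C. (\<Sum>i\<le>e. a i (\<lambda>i. u i y) * g y ^ i) = 0)"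
proof -
  obtain \<phi> x where \<phi>: "\<phi> \<in> polys {..<Suc d}" "\<And>y. y \<in> C \<Longrightarrow> \<phi> (\<lambda>i. (u(d := g)) i y) = 0" "\<phi> x \<noteq> 0"
    using dep unfolding alg_indep_def by blast
  obtain E a where a: "\<And>i. a i \<in> polys {..<d}" "\<And>x. \<phi> x = (\<Sum>i\<le>E. a i x * x d ^ i)"
    using polys_expand_last[OF \<phi>(1)] by blast
  define Z where "Z = {i. i \<le> E \<and> (\<exists>x. a i x \<noteq> 0)}"
  have "finite Z" unfolding Z_def by simp
  have "\<exists>i\<le>E. a i x * x d ^ i \<noteq> 0" using \<phi>(3) a(2)[of x] by (metis (no_types, lifting) atMost_iff sum.neutral)
  then have "Z \<noteq> {}" unfolding Z_def by auto
  define e where "e = Max Z"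
  have e: "e \<in> Z" unfolding e_def using \<open>finite Z\<close> \<open>Z \<noteq> {}\<close> by (rule Max_in)
  have zero: "a i x = 0" if "e < i" "i \<le> E" for i x
  proof (rule ccontr)
    assume "a i x \<noteq> 0"
    then have "i \<in> Z" using that unfolding Z_def by blast
    then have "i \<le> e" unfolding e_def using \<open>finite Z\<close> by simp
    with that show False by simp
  qed
  have "(\<Sum>i\<le>e. a i (\<lambda>i. u i y) * g y ^ i) = 0" if y: "y \<in> C" for y
  proof -
    let ?x = "\<lambda>i. (u(d := g)) i y"
    have ax: "a i ?x = a i (\<lambda>i. u i y)" for i by (rule polys_cong[OF a(1)]) auto
    have "(\<Sum>i\<le>e. a i ?x * ?x d ^ i) = (\<Sum>i\<le>E. a i ?x * ?x d ^ i)"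
      using e zero by (intro sum.mono_neutral_left) (auto simp: Z_def)
    also have "\<dots> = 0" using \<phi>(2)[OF y] a(2)[of ?x] by simp
    finally show ?thesis unfolding ax by simp
  qed
  moreover have "\<exists>y\<in>C. a e (\<lambda>i. u i y) \<noteq> 0"
    using e u a(1)[of e] unfolding Z_def alg_indep_def by blast
  ultimately show ?thesis using a(1) by blast
qed

section \<open>Generic differentials of independent functions\<close>

text \<open>
  The family is extended by coordinates to a maximal independent family \<open>h'\<close> of size \<open>d \<le> D\<close>. Each
  coordinate then satisfies a relation \<open>\<phi>\<^sub>j(h', b\<^sub>j) = 0\<close> with \<open>\<partial>\<phi>\<^sub>j / \<partial>b\<^sub>j\<close> not zero on \<open>Y\<close>, since otherwise
  the Taylor expansion in the last variable would show independence. So at a generic point a tangent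
  vector annihilated by all \<open>dh'\<^sub>i\<close> is zero. If there are \<open>D \<ge> d\<close> independent tangent vectors, no
  \<open>dh'\<^sub>i\<close> can be spared.
\<close>
lemma differentials_of_alg_indep:
  fixes b :: "'j \<Rightarrow> 'a \<Rightarrow> complex"
  assumes prime: "prime_on (fun_alg (b ` J)) Y" and J: "finite J"
    and bound: "\<And>d h. (\<And>i. i < d \<Longrightarrow> h i \<in> fun_alg (b ` J)) \<Longrightarrow> alg_indep Y d h \<Longrightarrow> d \<le> D"
    and h: "\<And>i. i < k \<Longrightarrow> h i \<in> fun_alg (b ` J)" "alg_indep Y k h"
  shows "\<exists>Q\<in>fun_alg (b ` J). (\<exists>y\<in>Y. Q y \<noteq> 0) \<and> (\<forall>z\<in>Y. Q z \<noteq> 0 \<longrightarrow> (\<forall>\<tau>.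
      (\<forall>t<D. tangent_vector (fun_alg (b ` J)) Y z (\<tau> t)) \<longrightarrow>
      (\<forall>x. (\<forall>j\<in>J. (\<Sum>t<D. x t * \<tau> t (b j)) = 0) \<longrightarrow> (\<forall>t<D. x t = 0)) \<longrightarrow>
      (\<forall>c. (\<forall>t<D. (\<Sum>i<k. c i * \<tau> t (h i)) = 0) \<longrightarrow> (\<forall>i<k. c i = 0))))"
proof -
  let ?R = "fun_alg (b ` J)"
  define ext where "ext d h' \<longleftrightarrow> k \<le> d \<and> (\<forall>i<k. h' i = h i) \<and> (\<forall>i<d. h' i \<in> ?R) \<and> alg_indep Y d h'"
    for d h'
  have "\<exists>h'. ext k h'" using h by (intro exI[of _ h]) (auto simp: ext_def)
  moreover have "d \<le> D" if "\<exists>h'. ext d h'" for d using that bound unfolding ext_def by blast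
  ultimately have "\<exists>d. (\<exists>h'. ext d h') \<and> (\<forall>d'. (\<exists>h'. ext d' h') \<longrightarrow> d' \<le> d)"
    by (intro ex_has_greatest_nat[of "\<lambda>d. \<exists>h'. ext d h'" k "\<lambda>d. d" "Suc D"]) (auto simp: less_Suc_eq_le)
  then obtain d where d: "\<exists>h'. ext d h'" "\<And>d'. \<exists>h'. ext d' h' \<Longrightarrow> d' \<le> d" by blast
  then obtain h' where h': "k \<le> d" "\<And>i. i < k \<Longrightarrow> h' i = h i" "\<And>i. i < d \<Longrightarrow> h' i \<in> ?R" "alg_indep Y d h'"
    unfolding ext_def by blast
  have dD: "d \<le> D" using bound h' by blast
  define g where "g j = h'(d := b j)" for j
  have gR: "g j i \<in> ?R" if "j \<in> J" "i < Suc d" for i j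
    using that h'(3) by (auto simp: g_def less_Suc_eq intro: fun_alg_base)
  have "\<exists>\<phi>. \<phi> \<in> polys {..<Suc d} \<and> (\<forall>y\<in>Y. \<phi> (\<lambda>i. g j i y) = 0) \<and>
      (\<exists>y\<in>Y. pd d \<phi> (\<lambda>i. g j i y) \<noteq> 0)" if j: "j \<in> J" for j
  proof (rule ccontr)
    assume contra: "\<not> ?thesis"
    define N where "N = {\<phi> \<in> polys {..<Suc d}. \<forall>y\<in>Y. \<phi> (\<lambda>i. g j i y) = 0}"
    have pdN: "pd d \<phi> \<in> N" if "\<phi> \<in> N" for \<phi>
      using contra that unfolding N_def by (auto simp: pd_polys)
    have "alg_indep Y (Suc d) (g j)"
      unfolding alg_indep_def
    proof (intro ballI impI allI)
      fix \<phi> x assume "\<phi> \<in> polys {..<Suc d}" "\<forall>y\<in>Y. \<phi> (\<lambda>i. g j i y) = 0"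
      then have \<phi>: "\<phi> \<in> N" "\<phi> \<in> polys {..<Suc d}" by (auto simp: N_def)
      have vanish: "\<phi> ((\<lambda>i. h' i y)(d := x d)) = 0" if y: "y \<in> Y" for y
      proof -
        define \<gamma> where "\<gamma> t = (\<lambda>i. h' i y)(d := b j y + t)" for t
        have "\<phi> (\<gamma> (x d - b j y)) = 0"
        proof (rule taylor_vanishing[of N \<gamma>])
          fix F assume F: "F \<in> N"
          then have Fp: "F \<in> polys {..<Suc d}" by (auto simp: N_def)
          show "poly_along (\<lambda>t. F (\<gamma> t))"
          proof (rule poly_along_fun_alg[OF Fp[unfolded polys_def]])
            fix f :: "(nat \<Rightarrow> complex) \<Rightarrow> complex"
            assume "f \<in> (\<lambda>i x. x i) ` {..<Suc d}"
            then obtain i where "f = (\<lambda>x. x i)" by auto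
            then have "(\<lambda>t. f (\<gamma> t)) = poly (if i = d then [:b j y, 1:] else [:h' i y:])"
              by (auto simp: fun_eq_iff \<gamma>_def)
            then show "poly_along (\<lambda>t. f (\<gamma> t))" unfolding poly_along_def by blast
          qed
          have "((\<lambda>t. F (\<lambda>i. \<gamma> t i)) has_field_derivative
              (\<Sum>i<Suc d. pd i F (\<lambda>i. \<gamma> t i) * (if i = d then 1 else 0))) (at t)" for t
            by (rule pd_curve[OF Fp]) (auto simp: \<gamma>_def intro!: derivative_eq_intros)
          then have "((\<lambda>t. F (\<gamma> t)) has_field_derivative pd d F (\<gamma> t)) (at t)" for t
            by simp
          then show "\<exists>F'\<in>N. \<forall>t. ((\<lambda>t. F (\<gamma> t)) has_field_derivative F' (\<gamma> t)) (at t)"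
            using pdN[OF F] by blast
          have "\<gamma> 0 = (\<lambda>i. g j i y)" by (auto simp: \<gamma>_def g_def fun_eq_iff)
          then show "F (\<gamma> 0) = 0" using F y by (simp add: N_def)
        qed (rule \<phi>)
        then show ?thesis by (simp add: \<gamma>_def)
      qed
      define \<psi> where "\<psi> z = \<phi> (z(d := x d))" for z
      have "(\<lambda>z. \<phi> (\<lambda>i. (if i = d then (\<lambda>_. x d) else (\<lambda>z. z i)) z)) \<in> polys {..<d}"
        unfolding polys_def
        by (rule polys_subst[OF \<phi>(2)]) (auto intro: fun_alg_const fun_alg_base)
      also have "(\<lambda>z. \<phi> (\<lambda>i. (if i = d then (\<lambda>_. x d) else (\<lambda>z. z i)) z)) = \<psi>"
      proof -
        have "(\<lambda>i. (if i = d then (\<lambda>_. x d) else (\<lambda>z. z i)) z) = z(d := x d)" for z :: "nat \<Rightarrow> complex"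
          by (simp add: fun_eq_iff)
        then show ?thesis unfolding \<psi>_def by simp
      qed
      finally have \<psi>: "\<psi> \<in> polys {..<d}" .
      have "\<forall>y\<in>Y. \<psi> (\<lambda>i. h' i y) = 0" using vanish by (simp add: \<psi>_def)
      then have "\<psi> x = 0" using h'(4)[unfolded alg_indep_def, THEN bspec, OF \<psi>] by simp
      then show "\<phi> x = 0" by (simp add: \<psi>_def)
    qed
    then have "ext (Suc d) (g j)"
      unfolding ext_def using h' gR[OF j] by (auto simp: g_def)
    with d(2)[of "Suc d"] show False by auto
  qed
  then obtain \<phi> where \<phi>: "\<And>j. j \<in> J \<Longrightarrow> \<phi> j \<in> polys {..<Suc d}"
    "\<And>j y. j \<in> J \<Longrightarrow> y \<in> Y \<Longrightarrow> \<phi> j (\<lambda>i. g j i y) = 0"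
    "\<And>j. j \<in> J \<Longrightarrow> \<exists>y\<in>Y. pd d (\<phi> j) (\<lambda>i. g j i y) \<noteq> 0" by metis
  define Q where "Q y = (\<Prod>j\<in>J. pd d (\<phi> j) (\<lambda>i. g j i y))" for y
  have pdR: "(\<lambda>y. pd d (\<phi> j) (\<lambda>i. g j i y)) \<in> ?R" if "j \<in> J" for j
    using polys_subst[OF pd_polys[OF \<phi>(1)[OF that]]] gR[OF that] by auto
  show ?thesis
  proof (intro bexI[of _ Q] conjI ballI allI impI)
    show "Q \<in> ?R" unfolding Q_def[abs_def] using pdR by (intro fun_alg_prod) auto
    show "\<exists>y\<in>Y. Q y \<noteq> 0" unfolding Q_def using pdR \<phi>(3) by (intro prime_on_prod[OF prime J]) auto
  next
    fix z \<tau> c i0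
    assume z: "z \<in> Y" "Q z \<noteq> 0" and tan: "\<forall>t<D. tangent_vector ?R Y z (\<tau> t)"
      and lin: "\<forall>x. (\<forall>j\<in>J. (\<Sum>t<D. x t * \<tau> t (b j)) = 0) \<longrightarrow> (\<forall>t<D. x t = 0)"
      and c: "\<forall>t<D. (\<Sum>i<k. c i * \<tau> t (h i)) = 0" and i0: "i0 < k"
    show "c i0 = 0"
    proof (rule ccontr)
      assume ci0: "c i0 \<noteq> 0"
      \<comment> \<open>By counting, a nonzero tangent vector is killed by all \<open>dh'\<^sub>i\<close> except that of index \<open>i0\<close>. The
        relation \<open>c\<close> makes this last one kill it as well.\<close>
      have "card ({..<d} - {i0}) < card {..<D}"
        using i0 h'(1) dD by (simp add: card_Diff_singleton)
      then obtain x where x: "\<exists>t\<in>{..<D}. x t \<noteq> 0"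
        "\<And>i. i \<in> {..<d} - {i0} \<Longrightarrow> (\<Sum>t<D. \<tau> t (h' i) * x t) = 0"
        using underdetermined_system[of "{..<d} - {i0}" "{..<D}" "\<lambda>i t. \<tau> t (h' i)"] by auto
      have "0 = (\<Sum>t<D. (\<Sum>i<k. c i * \<tau> t (h i)) * x t)" using c by simp
      also have "\<dots> = (\<Sum>i<k. c i * (\<Sum>t<D. \<tau> t (h' i) * x t))"
        unfolding sum_distrib_right by (subst sum.swap) (simp add: sum_distrib_left mult_ac h'(2))
      also have "\<dots> = (\<Sum>i<k. if i = i0 then c i0 * (\<Sum>t<D. \<tau> t (h' i0) * x t) else 0)"
        using x(2) h'(1) by (intro sum.cong) auto
      also have "\<dots> = c i0 * (\<Sum>t<D. \<tau> t (h' i0) * x t)" using i0 by simp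
      finally have "(\<Sum>t<D. \<tau> t (h' i0) * x t) = 0" using ci0 by simp
      with x(2) have all: "(\<Sum>t<D. \<tau> t (h' i) * x t) = 0" if "i < d" for i
        using that by (cases "i = i0") auto
      have "(\<Sum>t<D. x t * \<tau> t (b j)) = 0" if j: "j \<in> J" for j
      proof -
        let ?p = "\<lambda>i. pd i (\<phi> j) (\<lambda>i. g j i z)"
        have "(\<Sum>i<Suc d. ?p i * \<tau> t (g j i)) = 0" if t: "t < D" for t
        proof -
          have "\<tau> t (\<lambda>y. \<phi> j (\<lambda>i. g j i y)) = (\<Sum>i<Suc d. ?p i * \<tau> t (g j i))"
            using tan t \<phi>(1)[OF j] gR[OF j]
            by (intro point_derivation_chain) (auto simp: tangent_vector_def)
          moreover have "\<tau> t (\<lambda>y. \<phi> j (\<lambda>i. g j i y)) = 0"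
            using tan t \<phi>(2)[OF j] polys_subst[OF \<phi>(1)[OF j], of "g j"] gR[OF j]
            unfolding tangent_vector_def by auto
          ultimately show ?thesis by simp
        qed
        then have "(\<Sum>i<d. ?p i * \<tau> t (h' i)) + ?p d * \<tau> t (b j) = 0" if "t < D" for t
          using that by (simp add: g_def)
        then have "0 = (\<Sum>t<D. ((\<Sum>i<d. ?p i * \<tau> t (h' i)) + ?p d * \<tau> t (b j)) * x t)" by simp
        also have "\<dots> = (\<Sum>i<d. ?p i * (\<Sum>t<D. \<tau> t (h' i) * x t)) + ?p d * (\<Sum>t<D. x t * \<tau> t (b j))"
          unfolding distrib_right sum.distrib sum_distrib_right
          by (subst sum.swap) (simp add: sum_distrib_left mult_ac)
        also have "\<dots> = ?p d * (\<Sum>t<D. x t * \<tau> t (b j))" using all by simp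
        finally show ?thesis using z(2) j J unfolding Q_def by auto
      qed
      with lin x(1) show False by blast
    qed
  qed
qed

section \<open>Polynomial functions on a coordinate space\<close>

definition pfun :: "((complex ^ 'm::finite) \<Rightarrow> complex) set" where
  "pfun = fun_alg (range (\<lambda>i y. vec_nth y i))"

lemma pfun_const: "(\<lambda>_. c) \<in> pfun"
  and pfun_coord: "(\<lambda>y. vec_nth y i) \<in> pfun"
  and pfun_add: "F \<in> pfun \<Longrightarrow> G \<in> pfun \<Longrightarrow> (\<lambda>y. F y + G y) \<in> pfun"
  and pfun_mult: "F \<in> pfun \<Longrightarrow> G \<in> pfun \<Longrightarrow> (\<lambda>y. F y * G y) \<in> pfun"
  and pfun_diff: "F \<in> pfun \<Longrightarrow> G \<in> pfun \<Longrightarrow> (\<lambda>y. F y - G y) \<in> pfun"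
  and pfun_uminus: "F \<in> pfun \<Longrightarrow> (\<lambda>y. - F y) \<in> pfun"
  and pfun_sum: "(\<And>j. j \<in> A \<Longrightarrow> f j \<in> pfun) \<Longrightarrow> (\<lambda>y. \<Sum>j\<in>A. f j y) \<in> pfun"
  and pfun_prod: "(\<And>j. j \<in> A \<Longrightarrow> f j \<in> pfun) \<Longrightarrow> (\<lambda>y. \<Prod>j\<in>A. f j y) \<in> pfun"
  unfolding pfun_def
  by (auto intro: fun_alg_intros fun_alg_base fun_alg_diff fun_alg_uminus fun_alg_sum fun_alg_prod)

lemma pfun_induct [consumes 1, case_names const coord add mult]:
  assumes "F \<in> pfun" "\<And>c. P (\<lambda>_. c)" "\<And>i. P (\<lambda>y. vec_nth y i)"
    "\<And>F G. F \<in> pfun \<Longrightarrow> P F \<Longrightarrow> G \<in> pfun \<Longrightarrow> P G \<Longrightarrow> P (\<lambda>y. F y + G y)"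
    "\<And>F G. F \<in> pfun \<Longrightarrow> P F \<Longrightarrow> G \<in> pfun \<Longrightarrow> P G \<Longrightarrow> P (\<lambda>y. F y * G y)"
  shows "P F"
  using assms(1) unfolding pfun_def
  by induction (use assms(2-) in \<open>auto simp: pfun_def\<close>)

lemma poly_fun_pfun: "poly_fun f \<in> pfun"
proof -
  have "poly_eval f \<in> polys UNIV" by (rule poly_eval_in_polys) (simp add: vars_in_def)
  then show ?thesis unfolding polys_def pfun_def
    by (rule fun_alg_subst) (auto intro: fun_alg_base)
qed

lemma pfun_imp_poly_fun:
  assumes "F \<in> pfun"
  shows "\<exists>f. F = poly_fun f"
proof -
  have "(\<lambda>x. F (vec_lambda x)) \<in> polys UNIV"
    using assms unfolding polys_def pfun_def
    by (rule fun_alg_subst) (auto intro: fun_alg_base)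
  from polys_imp_poly_eval[OF this] obtain P where "(\<lambda>x. F (vec_lambda x)) = poly_eval P" by auto
  then have "F y = poly_fun P y" for y
    using fun_cong[of "\<lambda>x. F (vec_lambda x)" "poly_eval P" "vec_nth y"] by simp
  then show ?thesis by auto
qed

section \<open>Partial derivatives\<close>

definition partial :: "'m \<Rightarrow> (complex ^ 'm::finite \<Rightarrow> complex) \<Rightarrow> complex ^ 'm \<Rightarrow> complex" where
  "partial i F y = frechet_derivative F (at y) (axis i 1)"

definition dif :: "(complex ^ 'm::finite \<Rightarrow> complex) \<Rightarrow> complex ^ 'm \<Rightarrow> complex ^ 'm \<Rightarrow> complex" where
  "dif F y w = (\<Sum>i\<in>UNIV. partial i F y * vec_nth w i)"

lemma partial_eqI:
  assumes "(F has_derivative (\<lambda>w. \<Sum>i\<in>UNIV. c i * vec_nth w i)) (at y)"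
  shows "partial i F y = c i"
proof -
  have "partial i F y = (\<Sum>j\<in>UNIV. c j * vec_nth (axis i 1) j)"
    unfolding partial_def frechet_derivative_at[OF assms, symmetric] ..
  also have "\<dots> = (\<Sum>j\<in>UNIV. if j = i then c j else 0)"
    by (rule sum.cong) (auto simp: axis_def)
  finally show ?thesis by simp
qed

lemma has_derivative_coord: "((\<lambda>y. vec_nth y i) has_derivative (\<lambda>w. vec_nth w i)) (at (y :: complex ^ 'm::finite))"
  by (rule bounded_linear_imp_has_derivative) (rule bounded_linear_vec_nth)

lemma pfun_has_derivative:
  assumes "F \<in> pfun"
  shows "(F has_derivative dif F y) (at y)"
proof -
  have "\<exists>c. (F has_derivative (\<lambda>w. \<Sum>i\<in>UNIV. c i * vec_nth w i)) (at y)"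
    using assms
  proof (induction rule: pfun_induct)
    case (const c)
    show ?case by (intro exI[of _ "\<lambda>_. 0"]) simp
  next
    case (coord i)
    have "(\<lambda>w :: complex ^ 'a. \<Sum>j\<in>UNIV. (if j = i then 1 else 0) * vec_nth w j) = (\<lambda>w. vec_nth w i)"
      by (simp add: if_distrib[of "\<lambda>x. x * _"] cong: if_cong)
    then show ?case using has_derivative_coord[of i y] by (intro exI[of _ "\<lambda>j. if j = i then 1 else 0"]) simp
  next
    case (add F G)
    then obtain c c' where "(F has_derivative (\<lambda>w. \<Sum>i\<in>UNIV. c i * vec_nth w i)) (at y)"
      "(G has_derivative (\<lambda>w. \<Sum>i\<in>UNIV. c' i * vec_nth w i)) (at y)" by auto
    from has_derivative_add[OF this] show ?case
      by (intro exI[of _ "\<lambda>i. c i + c' i"]) (simp add: distrib_right sum.distrib)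
  next
    case (mult F G)
    then obtain c c' where "(F has_derivative (\<lambda>w. \<Sum>i\<in>UNIV. c i * vec_nth w i)) (at y)"
      "(G has_derivative (\<lambda>w. \<Sum>i\<in>UNIV. c' i * vec_nth w i)) (at y)" by auto
    from has_derivative_mult[OF this] show ?case
      by (intro exI[of _ "\<lambda>i. F y * c' i + G y * c i"])
        (simp add: algebra_simps sum.distrib sum_distrib_left sum_distrib_right)
  qed
  then obtain c where c: "(F has_derivative (\<lambda>w. \<Sum>i\<in>UNIV. c i * vec_nth w i)) (at y)" by auto
  with partial_eqI[OF c] show ?thesis by (simp add: dif_def[abs_def])
qed

lemma frechet_pfun: "F \<in> pfun \<Longrightarrow> frechet_derivative F (at y) = dif F y"
  using frechet_derivative_at[OF pfun_has_derivative] by metis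

lemma partial_const [simp]: "partial i (\<lambda>_. c) y = 0"
  by (simp add: partial_def)

lemma partial_coord: "partial i (\<lambda>y. vec_nth y j) y = (if i = j then 1 else 0)"
proof (rule partial_eqI)
  show "((\<lambda>y. vec_nth y j) has_derivative (\<lambda>w. \<Sum>i\<in>UNIV. (if i = j then 1 else 0) * vec_nth w i)) (at y)"
    using has_derivative_coord[of j y] by (simp add: if_distrib[of "\<lambda>x. x * _"] cong: if_cong)
qed

lemma partial_add:
  assumes "F \<in> pfun" "G \<in> pfun"
  shows "partial i (\<lambda>y. F y + G y) y = partial i F y + partial i G y"
proof (rule partial_eqI)
  show "((\<lambda>y. F y + G y) has_derivative (\<lambda>w. \<Sum>i\<in>UNIV. (partial i F y + partial i G y) * vec_nth w i)) (at y)"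
    using has_derivative_add[OF pfun_has_derivative[OF assms(1)] pfun_has_derivative[OF assms(2)]]
    by (simp add: dif_def[abs_def] distrib_right sum.distrib)
qed

lemma partial_mult:
  assumes "F \<in> pfun" "G \<in> pfun"
  shows "partial i (\<lambda>y. F y * G y) y = F y * partial i G y + G y * partial i F y"
proof (rule partial_eqI)
  show "((\<lambda>y. F y * G y) has_derivative
      (\<lambda>w. \<Sum>i\<in>UNIV. (F y * partial i G y + G y * partial i F y) * vec_nth w i)) (at y)"
    using has_derivative_mult[OF pfun_has_derivative[OF assms(1)] pfun_has_derivative[OF assms(2)]]
    by (simp add: dif_def[abs_def] algebra_simps sum.distrib sum_distrib_left sum_distrib_right)
qed

lemma partial_add_fun: "F \<in> pfun \<Longrightarrow> G \<in> pfun \<Longrightarrow>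
    partial i (\<lambda>y. F y + G y) = (\<lambda>y. partial i F y + partial i G y)"
  by (simp add: fun_eq_iff partial_add)

lemma partial_mult_fun: "F \<in> pfun \<Longrightarrow> G \<in> pfun \<Longrightarrow>
    partial i (\<lambda>y. F y * G y) = (\<lambda>y. F y * partial i G y + G y * partial i F y)"
  by (simp add: fun_eq_iff partial_mult)

lemma pfun_partial: "F \<in> pfun \<Longrightarrow> partial i F \<in> pfun"
proof (induction rule: pfun_induct)
  case (const c)
  then show ?case by (simp add: partial_const[abs_def] pfun_const)
next
  case (coord j)
  then show ?case by (simp add: partial_coord[abs_def] pfun_const)
next
  case (add F G)
  then show ?case by (simp add: partial_add_fun pfun_add)
next
  case (mult F G)
  then show ?case by (simp add: partial_mult_fun pfun_add pfun_mult)
qed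

lemma partial_commute: "F \<in> pfun \<Longrightarrow> partial i (partial j F) y = partial j (partial i F) y"
proof (induction arbitrary: y rule: pfun_induct)
  case (const c)
  then show ?case by (simp add: partial_const[abs_def])
next
  case (coord k)
  then show ?case by (simp add: partial_coord[abs_def])
next
  case (add F G)
  then show ?case by (simp add: partial_add_fun pfun_partial)
next
  case (mult F G)
  then show ?case by (simp add: partial_mult_fun partial_add pfun_partial pfun_mult partial_mult)
qed

lemma dif_const [simp]: "dif (\<lambda>_. c) y w = 0"
  by (simp add: dif_def)

lemma dif_coord [simp]: "dif (\<lambda>y. vec_nth y j) y w = vec_nth w j"
  by (simp add: dif_def partial_coord if_distrib[of "\<lambda>x. x * _"] cong: if_cong)

lemma dif_add: "F \<in> pfun \<Longrightarrow> G \<in> pfun \<Longrightarrow> dif (\<lambda>y. F y + G y) y w = dif F y w + dif G y w"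
  by (simp add: dif_def partial_add distrib_right sum.distrib)

lemma dif_mult: "F \<in> pfun \<Longrightarrow> G \<in> pfun \<Longrightarrow>
    dif (\<lambda>y. F y * G y) y w = F y * dif G y w + G y * dif F y w"
  by (simp add: dif_def partial_mult algebra_simps sum.distrib sum_distrib_left)

lemma dif_sum: "(\<And>i. i \<in> A \<Longrightarrow> F i \<in> pfun) \<Longrightarrow>
    dif (\<lambda>y. \<Sum>i\<in>A. F i y) y w = (\<Sum>i\<in>A. dif (F i) y w)"
  by (induction A rule: infinite_finite_induct) (auto simp: dif_add pfun_sum)

lemma dif_plus_right: "dif F y (w + w') = dif F y w + dif F y w'"
  by (simp add: dif_def distrib_left sum.distrib)

lemma dif_scale_right: "dif F y (c *s w) = c * dif F y w"
  by (simp add: dif_def sum_distrib_left mult_ac)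

lemma dif_zero_right [simp]: "dif F y 0 = 0"
  by (simp add: dif_def)

lemma pfun_dif: "F \<in> pfun \<Longrightarrow> (\<And>i. (\<lambda>y. vec_nth (s y) i) \<in> pfun) \<Longrightarrow> (\<lambda>y. dif F y (s y)) \<in> pfun"
  unfolding dif_def by (intro pfun_sum pfun_mult pfun_partial)

lemma poly_along_line:
  assumes "F \<in> pfun"
  shows "poly_along (\<lambda>t. F (y + t *s w))"
proof (rule poly_along_fun_alg[OF assms[unfolded pfun_def]])
  fix b :: "complex ^ 'a \<Rightarrow> complex"
  assume "b \<in> range (\<lambda>i y. vec_nth y i)"
  then obtain i where "b = (\<lambda>y. vec_nth y i)" by auto
  then have "(\<lambda>t. b (y + t *s w)) = poly [:vec_nth y i, vec_nth w i:]" by (auto simp: fun_eq_iff)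
  then show "poly_along (\<lambda>t. b (y + t *s w))" unfolding poly_along_def by blast
qed

lemma dif_line:
  assumes "F \<in> pfun"
  shows "((\<lambda>t. F (y + t *s w)) has_field_derivative dif F (y + t *s w) w) (at t)"
  using assms
proof (induction rule: pfun_induct)
  case (add F G)
  then show ?case using DERIV_add[OF add.IH] by (simp add: dif_add)
next
  case (mult F G)
  then show ?case using DERIV_mult[OF mult.IH] by (simp add: dif_mult algebra_simps)
qed (auto intro!: derivative_eq_intros)

section \<open>Polynomial maps\<close>

definition pmap :: "(complex ^ 'm::finite \<Rightarrow> complex ^ 'm) \<Rightarrow> bool" where
  "pmap s \<longleftrightarrow> (\<forall>i. (\<lambda>y. vec_nth (s y) i) \<in> pfun)"

definition vdif :: "(complex ^ 'm::finite \<Rightarrow> complex ^ 'm) \<Rightarrow> complex ^ 'm \<Rightarrow> complex ^ 'm \<Rightarrow> complex ^ 'm" where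
  "vdif s y w = (\<chi> i. dif (\<lambda>y. vec_nth (s y) i) y w)"

lemma polynomial_map_iff: "polynomial_map s \<longleftrightarrow> pmap s"
proof
  assume "polynomial_map s"
  then obtain P where "\<And>y i. vec_nth (s y) i = poly_fun (P i) y" unfolding polynomial_map_def by blast
  then have "(\<lambda>y. vec_nth (s y) i) = poly_fun (P i)" for i by (simp add: fun_eq_iff)
  then show "pmap s" unfolding pmap_def using poly_fun_pfun by metis
next
  assume "pmap s"
  then have "\<forall>i. \<exists>f. (\<lambda>y. vec_nth (s y) i) = poly_fun f"
    unfolding pmap_def using pfun_imp_poly_fun by blast
  then obtain P where "\<forall>i. (\<lambda>y. vec_nth (s y) i) = poly_fun (P i)" by metis
  then show "polynomial_map s" unfolding polynomial_map_def by (metis (full_types))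
qed

lemma pmap_coord: "pmap s \<Longrightarrow> (\<lambda>y. vec_nth (s y) i) \<in> pfun"
  by (simp add: pmap_def)

lemma pmap_const: "pmap (\<lambda>_. w)"
  by (simp add: pmap_def pfun_const)

lemma pmap_id: "pmap (\<lambda>y. y)"
  by (simp add: pmap_def pfun_coord)

lemma pmap_scale: "F \<in> pfun \<Longrightarrow> pmap s \<Longrightarrow> pmap (\<lambda>y. F y *s s y)"
  by (simp add: pmap_def pfun_mult)

lemma pmap_vdif: "pmap s \<Longrightarrow> pmap u \<Longrightarrow> pmap (\<lambda>y. vdif s y (u y))"
  by (simp add: pmap_def vdif_def pfun_dif)

lemma frechet_pmap:
  assumes "pmap s"
  shows "frechet_derivative s (at y) = vdif s y"
proof -
  have "(s has_derivative vdif s y) (at y)"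
    unfolding has_derivative_componentwise_within[of s]
  proof
    fix b :: "complex ^ 'a" assume "b \<in> Basis"
    then obtain i u where b: "b = axis i u" unfolding Basis_vec_def by auto
    have "((\<lambda>x. vec_nth (s x) i \<bullet> u) has_derivative (\<lambda>x. dif (\<lambda>y. vec_nth (s y) i) y x \<bullet> u)) (at y)"
      by (intro has_derivative_inner_left pfun_has_derivative pmap_coord assms)
    then show "((\<lambda>x. s x \<bullet> b) has_derivative (\<lambda>x. vdif s y x \<bullet> b)) (at y)"
      by (simp add: b inner_axis vdif_def)
  qed
  then show ?thesis using frechet_derivative_at by metis
qed

lemma vdif_plus_right: "vdif s y (w + w') = vdif s y w + vdif s y w'"
  by (simp add: vdif_def Finite_Cartesian_Product.vec_eq_iff dif_plus_right)

lemma vdif_scale_right: "vdif s y (c *s w) = c *s vdif s y w"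
  by (simp add: vdif_def Finite_Cartesian_Product.vec_eq_iff dif_scale_right)

definition hess :: "(complex ^ 'm::finite \<Rightarrow> complex) \<Rightarrow> complex ^ 'm \<Rightarrow> complex ^ 'm \<Rightarrow> complex ^ 'm \<Rightarrow> complex" where
  "hess F y w u = (\<Sum>i\<in>UNIV. dif (partial i F) y w * vec_nth u i)"

lemma hess_commute: "F \<in> pfun \<Longrightarrow> hess F y w u = hess F y u w"
  unfolding hess_def dif_def sum_distrib_right
  by (subst sum.swap) (simp add: partial_commute[of F] mult_ac)

text \<open>Leibniz rule: the Hessian arises from differentiating the coefficients of \<open>dF\<close>.\<close>
lemma dif_dif:
  assumes "F \<in> pfun" "pmap s"
  shows "dif (\<lambda>y. dif F y (s y)) y w = hess F y w (s y) + dif F y (vdif s y w)"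
proof -
  have "dif (\<lambda>y. dif F y (s y)) y w
      = (\<Sum>i\<in>UNIV. partial i F y * dif (\<lambda>y. vec_nth (s y) i) y w + vec_nth (s y) i * dif (partial i F) y w)"
    unfolding dif_def[of F] using assms
    by (subst dif_sum) (auto intro!: sum.cong pfun_mult pfun_partial pmap_coord simp: dif_mult pfun_partial pmap_coord)
  then show ?thesis
    by (simp add: sum.distrib hess_def dif_def[of F] vdif_def mult_ac add_ac)
qed

section \<open>Projective sets and their cones\<close>

lemma line_of_point:
  assumes "v \<noteq> 0"
  shows "line_of (point v) = vec.span {v}"
  unfolding point_def by (rule Proj_inverse) (use assms in auto)

lemma point_cases: obtains v where "v \<noteq> 0" "q = point v"
proof -
  have "line_of q \<in> {L. \<exists>v. v \<noteq> 0 \<and> L = vec.span {v}}" by (rule line_of)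
  then obtain v where "v \<noteq> 0" "line_of q = vec.span {v}" by auto
  moreover from this have "q = point v" unfolding point_def by (metis line_of_inverse)
  ultimately show ?thesis using that by blast
qed

lemma span_singleton: "vec.span {v} = range (\<lambda>c :: 'a::field. c *s (v :: 'a ^ 'n::finite))"
  by (rule vec.span_singleton)

lemma in_line_of: "v \<noteq> 0 \<Longrightarrow> w \<in> line_of (point v) \<longleftrightarrow> (\<exists>c. w = c *s v)"
  by (auto simp: line_of_point span_singleton)

lemma line_of_mem_eq:
  assumes "w \<in> line_of q" "w \<noteq> 0"
  shows "q = point w"
proof -
  obtain v where v: "v \<noteq> 0" "q = point v" by (rule point_cases)
  obtain c where c: "w = c *s v" using assms v by (auto simp: in_line_of)
  then have "c \<noteq> 0" using assms by auto
  have "line_of (point w) = line_of (point v)"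
  proof (intro equalityI subsetI)
    fix x assume "x \<in> line_of (point w)"
    then show "x \<in> line_of (point v)" using c v assms(2) by (auto simp: in_line_of vec.scale_scale)
  next
    fix x assume "x \<in> line_of (point v)"
    then obtain d where "x = d *s v" using v by (auto simp: in_line_of)
    then have "x = (d / c) *s w" using c \<open>c \<noteq> 0\<close> by (simp add: vec.scale_scale)
    then show "x \<in> line_of (point w)" using assms(2) in_line_of by blast
  qed
  then show ?thesis using v(2) by (simp add: line_of_inject)
qed

lemma mem_line_point: "v \<noteq> 0 \<Longrightarrow> v \<in> line_of (point v)"
  by (auto simp: line_of_point vec.span_base)

lemma mem_cone: "v \<noteq> 0 \<Longrightarrow> v \<in> cone X \<longleftrightarrow> point v \<in> X"
  unfolding cone_def using line_of_mem_eq mem_line_point by blast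

lemma line_of_scale: "w \<in> line_of q \<Longrightarrow> c *s w \<in> line_of q"
  by (cases q rule: point_cases) (auto simp: in_line_of vec.scale_scale)

lemma zero_in_line_of: "0 \<in> line_of q"
  by (cases q rule: point_cases) (auto simp: in_line_of intro: exI[of _ 0])

lemma cone_scale: "v \<in> cone X \<Longrightarrow> c *s v \<in> cone X"
  unfolding cone_def using line_of_scale by blast

lemma zero_in_cone: "X \<noteq> {} \<Longrightarrow> 0 \<in> cone X"
  unfolding cone_def using zero_in_line_of by blast

section \<open>Homogeneous components\<close>

definition mdeg :: "('v \<Rightarrow>\<^sub>0 nat) \<Rightarrow> nat" where
  "mdeg m = (\<Sum>i\<in>Poly_Mapping.keys m. Poly_Mapping.lookup m i)"

definition hcomp :: "nat \<Rightarrow> 'v cpoly \<Rightarrow> 'v cpoly" where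
  "hcomp d f = (\<Sum>m\<in>{m\<in>Poly_Mapping.keys f. mdeg m = d}. Poly_Mapping.single m (Poly_Mapping.lookup f m))"

lemma monom_val_scale: "monom_val m (\<lambda>i. t * x i) = t ^ mdeg m * monom_val m x"
  by (simp add: monom_val_def mdeg_def power_mult_distrib prod.distrib power_sum)

lemma homogeneous_hcomp: "homogeneous (hcomp d f)"
proof -
  have "Poly_Mapping.keys (hcomp d f) \<subseteq> {m. mdeg m = d}"
    unfolding hcomp_def by (rule order_trans[OF Poly_Mapping.keys_sum]) auto
  then show ?thesis unfolding homogeneous_def mdeg_def by blast
qed

lemma poly_eval_hcomp: "poly_eval (hcomp d f) x =
    (\<Sum>m\<in>{m\<in>Poly_Mapping.keys f. mdeg m = d}. Poly_Mapping.lookup f m * monom_val m x)"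
  by (simp add: hcomp_def poly_eval_sum poly_eval_single)

lemma poly_eval_scale:
  "poly_eval f (\<lambda>i. t * x i) = (\<Sum>d\<in>mdeg ` Poly_Mapping.keys f. poly_eval (hcomp d f) x * t ^ d)"
proof -
  have "poly_eval f (\<lambda>i. t * x i) =
      (\<Sum>m\<in>Poly_Mapping.keys f. Poly_Mapping.lookup f m * monom_val m x * t ^ mdeg m)"
    by (simp add: poly_eval_superset[OF finite_keys order_refl] monom_val_scale mult_ac)
  also have "\<dots> = (\<Sum>d\<in>mdeg ` Poly_Mapping.keys f. \<Sum>m\<in>{m\<in>Poly_Mapping.keys f. mdeg m = d}.
      Poly_Mapping.lookup f m * monom_val m x * t ^ mdeg m)"
    by (rule sum.image_gen) simp
  also have "\<dots> = (\<Sum>d\<in>mdeg ` Poly_Mapping.keys f. poly_eval (hcomp d f) x * t ^ d)"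
    unfolding poly_eval_hcomp sum_distrib_right by (intro sum.cong) auto
  finally show ?thesis .
qed

text \<open>Along a ray a polynomial is a polynomial in the scalar, whose coefficients are the homogeneous components.\<close>
lemma poly_eval_ray_vanishing:
  "(\<forall>t. poly_eval f (\<lambda>i. t * x i) = 0) \<longleftrightarrow> (\<forall>d\<in>mdeg ` Poly_Mapping.keys f. poly_eval (hcomp d f) x = 0)"
proof
  assume L: "\<forall>t. poly_eval f (\<lambda>i. t * x i) = 0"
  let ?D = "mdeg ` Poly_Mapping.keys f"
  define p where "p = (\<Sum>d\<in>?D. monom (poly_eval (hcomp d f) x) d)"
  have "poly p t = 0" for t
    using L unfolding p_def poly_sum poly_monom poly_eval_scale by simp
  then have p: "p = 0" using poly_all_0_iff_0 by blast
  show "\<forall>d\<in>?D. poly_eval (hcomp d f) x = 0"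
  proof
    fix d assume d: "d \<in> ?D"
    have "coeff p d = (\<Sum>d'\<in>?D. if d' = d then poly_eval (hcomp d f) x else 0)"
      unfolding p_def coeff_sum coeff_monom by (intro sum.cong) auto
    with p d show "poly_eval (hcomp d f) x = 0" by simp
  qed
next
  assume "\<forall>d\<in>mdeg ` Poly_Mapping.keys f. poly_eval (hcomp d f) x = 0"
  then show "\<forall>t. poly_eval f (\<lambda>i. t * x i) = 0"
    unfolding poly_eval_scale by (intro allI sum.neutral) simp
qed

lemma vanishing_on_line:
  "(\<forall>w\<in>line_of q. poly_fun f w = 0) \<longleftrightarrow>
     (\<forall>d\<in>mdeg ` Poly_Mapping.keys f. \<forall>w\<in>line_of q. poly_fun (hcomp d f) w = 0)"
proof -
  have "(\<forall>w\<in>line_of q. poly_fun f w = 0) \<longleftrightarrow> (\<forall>w\<in>line_of q. \<forall>t. poly_fun f (t *s w) = 0)"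
    using line_of_scale by (metis vec.scale_one)
  also have "\<dots> \<longleftrightarrow> (\<forall>w\<in>line_of q. \<forall>d\<in>mdeg ` Poly_Mapping.keys f. poly_fun (hcomp d f) w = 0)"
  proof -
    have "vec_nth (t *s w) = (\<lambda>i. t * vec_nth w i)" for t and w :: "complex ^ 'a"
      by (simp add: fun_eq_iff)
    then show ?thesis unfolding poly_eval_ray_vanishing[symmetric] by simp
  qed
  finally show ?thesis by blast
qed

lemma zariski_closed_vanishing:
  assumes "F \<in> pfun"
  shows "zariski_closed {q. \<forall>w\<in>line_of q. F w = 0}"
proof -
  obtain f where f: "F = poly_fun f" using pfun_imp_poly_fun[OF assms] by auto
  show ?thesis
    unfolding zariski_closed_def f
    by (rule exI[of _ "(\<lambda>d. hcomp d f) ` mdeg ` Poly_Mapping.keys f"])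
      (use vanishing_on_line[of _ f] homogeneous_hcomp in auto)
qed

text \<open>
  The Zariski closure is cut out by homogeneous polynomials only. This suffices, since on a cone a
  polynomial vanishes together with its homogeneous components.
\<close>
lemma vanishing_on_closure:
  assumes "F \<in> pfun" "\<And>y. y \<in> cone S \<Longrightarrow> F y = 0" "y \<in> cone (zariski_closure S)"
  shows "F y = 0"
proof -
  have "S \<subseteq> {q. \<forall>w\<in>line_of q. F w = 0}" using assms(2) by (auto simp: cone_def)
  then have "zariski_closure S \<subseteq> {q. \<forall>w\<in>line_of q. F w = 0}"
    unfolding zariski_closure_def using zariski_closed_vanishing[OF assms(1)] by blast
  then show ?thesis using assms(3) by (auto simp: cone_def)
qed

lemma subset_zariski_closure: "S \<subseteq> zariski_closure S"
  unfolding zariski_closure_def by blast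

lemma poly_along_product_zero:
  assumes "poly_along f" "poly_along g" "\<And>t. f t * g t = 0"
  shows "(\<forall>t. f t = 0) \<or> (\<forall>t. g t = 0)"
proof -
  obtain p q where pq: "f = poly p" "g = poly q" using assms unfolding poly_along_def by auto
  then have "poly (p * q) t = 0" for t using assms(3)[of t] by simp
  then have "p * q = 0" using poly_all_0_iff_0 by blast
  then show ?thesis using pq by auto
qed

text \<open>
  Irreducibility concerns closed sets of projective points, but here \<open>F\<close> and \<open>G\<close> need not be homogeneous.
  If \<open>F G = 0\<close> on the cone, then on each line one of the two vanishes identically, as univariate
  polynomials form a domain; the lines on which \<open>F\<close> vanishes form a closed set.
\<close>
lemma prime_on_cone:
  assumes "irreducible_variety X"
  shows "prime_on pfun (cone X)"
proof -
  have X: "X \<noteq> {}" "\<And>Y Z. zariski_closed Y \<Longrightarrow> zariski_closed Z \<Longrightarrow> X \<subseteq> Y \<union> Z \<Longrightarrow> X \<subseteq> Y \<or> X \<subseteq> Z"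
    using assms unfolding irreducible_variety_def by auto
  have product: "(\<forall>y\<in>cone X. F y = 0) \<or> (\<forall>y\<in>cone X. G y = 0)"
    if FG: "F \<in> pfun" "G \<in> pfun" "\<And>y. y \<in> cone X \<Longrightarrow> F y * G y = 0" for F G
  proof -
    let ?V = "\<lambda>F. {q. \<forall>w\<in>line_of q. F w = 0}"
    have "X \<subseteq> ?V F \<union> ?V G"
    proof
      fix q assume q: "q \<in> X"
      obtain v where v: "v \<noteq> 0" "q = point v" by (rule point_cases)
      have "F (t *s v) * G (t *s v) = 0" for t
        using FG(3)[of "t *s v"] cone_scale[of v X t] mem_cone[OF v(1)] v(2) q by auto
      then have "(\<forall>t. F (t *s v) = 0) \<or> (\<forall>t. G (t *s v) = 0)"
        using poly_along_product_zero[OF poly_along_line[OF FG(1), of 0 v] poly_along_line[OF FG(2), of 0 v]]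
        by simp
      then show "q \<in> ?V F \<union> ?V G" using v by (auto simp: in_line_of)
    qed
    then have "X \<subseteq> ?V F \<or> X \<subseteq> ?V G" by (intro X(2) zariski_closed_vanishing FG)
    then show ?thesis by (auto simp: cone_def)
  qed
  show ?thesis
    unfolding prime_on_def
  proof (intro conjI ballI impI)
    show "cone X \<noteq> {}" using zero_in_cone[OF X(1)] by auto
    fix F G :: "complex ^ 'a \<Rightarrow> complex"
    assume FG: "F \<in> pfun" "G \<in> pfun" "\<exists>y\<in>cone X. F y \<noteq> 0" "\<exists>y\<in>cone X. G y \<noteq> 0"
    show "\<exists>y\<in>cone X. F y \<noteq> 0 \<and> G y \<noteq> 0"
    proof (rule ccontr)
      assume "\<not> ?thesis"
      then have "F y * G y = 0" if "y \<in> cone X" for y using that by auto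
      from product[OF FG(1,2) this] FG(3,4) show False by blast
    qed
  qed
qed

lemma prime_on_UNIV: "prime_on pfun (UNIV :: (complex ^ 'm::finite) set)"
proof -
  have "\<exists>y. F y \<noteq> 0 \<and> G y \<noteq> 0"
    if FG: "F \<in> pfun" "G \<in> pfun" "F a \<noteq> 0" "G b \<noteq> 0" for F G and a b :: "complex ^ 'm"
  proof (rule ccontr)
    assume "\<nexists>y. F y \<noteq> 0 \<and> G y \<noteq> 0"
    then have "(\<forall>t. F (a + t *s (b - a)) = 0) \<or> (\<forall>t. G (a + t *s (b - a)) = 0)"
      by (intro poly_along_product_zero poly_along_line FG) auto
    with FG(3,4) show False
      by (metis vec.scale_one vec.scale_zero_left add.right_neutral add_diff_cancel_left' diff_add_cancel add.commute)
  qed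
  then show ?thesis unfolding prime_on_def by blast
qed

lemma closed_separating_function:
  assumes "zariski_closed Z" "\<not> X \<subseteq> Z"
  obtains G where "G \<in> pfun" "\<And>y. y \<in> cone Z \<Longrightarrow> G y = 0" "\<exists>y\<in>cone X. G y \<noteq> 0"
proof -
  obtain Fs where Fs: "Z = {p. \<forall>f\<in>Fs. \<forall>v\<in>line_of p. poly_fun f v = 0}"
    using assms(1) unfolding zariski_closed_def by auto
  obtain p where p: "p \<in> X" "p \<notin> Z" using assms(2) by auto
  then obtain f v where f: "f \<in> Fs" "v \<in> line_of p" "poly_fun f v \<noteq> 0" unfolding Fs by auto
  show ?thesis
  proof (rule that[of "poly_fun f"])
    show "poly_fun f y = 0" if "y \<in> cone Z" for y using that f(1) unfolding cone_def Fs by auto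
    show "\<exists>y\<in>cone X. poly_fun f y \<noteq> 0" using f p unfolding cone_def by auto
  qed (rule poly_fun_pfun)
qed

section \<open>Transcendence degree\<close>

text \<open>This makes the supremum in the definition of the transcendence degree a maximum.\<close>
lemma alg_indep_card_bound:
  fixes C :: "(complex ^ 'm::finite) set"
  assumes "alg_independent_on C k f"
  shows "k \<le> CARD('m)"
proof -
  obtain \<sigma> :: "'m \<Rightarrow> nat" where \<sigma>: "bij_betw \<sigma> UNIV {..<CARD('m)}"
    using ex_bij_betw_finite_nat[of "UNIV :: 'm set"] by (auto simp: atLeast0LessThan)
  define \<rho> where "\<rho> = inv_into UNIV \<sigma>"
  have \<rho>\<sigma>: "\<rho> (\<sigma> j) = j" for j unfolding \<rho>_def using \<sigma> by (simp add: bij_betw_def)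
  have \<sigma>_less: "\<sigma> j < CARD('m)" for j using \<sigma> by (auto simp: bij_betw_def)
  interpret algebraic_generators UNIV UNIV "\<lambda>i y. vec_nth (y :: complex ^ 'm) i" "CARD('m)"
    "\<lambda>i y. vec_nth y (\<rho> i)" "\<lambda>_. 1" "\<lambda>j i x. if i = 0 then - x (\<sigma> j) else 1"
  proof
    show "prime_on (fun_alg (range (\<lambda>i y. vec_nth (y :: complex ^ 'm) i))) UNIV"
      using prime_on_UNIV unfolding pfun_def .
    show "(\<lambda>x. if i = 0 then - x (\<sigma> j) else 1) \<in> polys {..<CARD('m)}" for i :: nat and j
    proof (cases "i = 0")
      case True
      have "(\<lambda>x. - x (\<sigma> j)) \<in> polys {..<CARD('m)}"
        using polys_coord[of "\<sigma> j" "{..<CARD('m)}"] \<sigma>_less unfolding polys_def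
        by (auto intro: fun_alg_uminus)
      with True show ?thesis by simp
    next
      case False
      then show ?thesis by (simp add: polys_def fun_alg_const)
    qed
    show "(\<Sum>i\<le>1. (if i = 0 then - vec_nth y (\<rho> (\<sigma> j)) else 1) * vec_nth y j ^ i) = 0"
      for j and y :: "complex ^ 'm"
      by (simp add: \<rho>\<sigma>)
    show "(\<lambda>y. vec_nth (y :: complex ^ 'm) (\<rho> i)) \<in> fun_alg (range (\<lambda>i y. vec_nth y i))" for i
      by (intro fun_alg_base rangeI)
    show "finite (UNIV :: 'm set)" by (rule finite)
    show "\<exists>y\<in>(UNIV :: (complex ^ 'm) set). (if (1::nat) = 0 then - vec_nth y (\<rho> (\<sigma> j)) else 1) \<noteq> 0" for j
      by simp
  qed
  have "alg_indep C k (\<lambda>i. poly_fun (f i))" using assms by (simp add: alg_independent_on_iff)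
  then have "alg_indep UNIV k (\<lambda>i. poly_fun (f i))" unfolding alg_indep_def by blast
  then show ?thesis
    by (rule alg_indep_bound[rotated]) (use poly_fun_pfun in \<open>auto simp: pfun_def\<close>)
qed

lemma alg_indep_imp_alg_independent_on:
  assumes "\<And>i. i < k \<Longrightarrow> h i \<in> pfun" "alg_indep C k h"
  shows "\<exists>f. alg_independent_on C k f"
proof -
  have "\<forall>i\<in>{..<k}. \<exists>f. h i = poly_fun f" using assms(1) pfun_imp_poly_fun by blast
  from bchoice[OF this] obtain f where f: "\<forall>i\<in>{..<k}. h i = poly_fun (f i)" by blast
  have "alg_indep C k (\<lambda>i. poly_fun (f i))"
    by (rule alg_indep_mono[OF assms(2)]) (use f in auto)
  then show ?thesis by (auto simp: alg_independent_on_iff)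
qed

lemma transcendence_degree_ge:
  assumes "\<And>i. i < k \<Longrightarrow> h i \<in> pfun" "alg_indep C k h"
  shows "k \<le> transcendence_degree C"
  unfolding transcendence_degree_def
proof (rule cSup_upper)
  show "k \<in> {k. \<exists>f. alg_independent_on C k f}"
    using alg_indep_imp_alg_independent_on[OF assms] by auto
  show "bdd_above {k. \<exists>f. alg_independent_on C k f}"
    using alg_indep_card_bound by (intro bdd_aboveI[of _ "CARD('a)"]) blast
qed

lemma transcendence_degree_attained:
  fixes C :: "(complex ^ 'm::finite) set"
  assumes "0 < transcendence_degree C"
  obtains h where "\<And>i. h i \<in> pfun" "alg_indep C (transcendence_degree C) h"
proof -
  let ?K = "{k. \<exists>f. alg_independent_on C k f}"
  have "?K \<noteq> {}" using assms unfolding transcendence_degree_def by (auto simp: Sup_nat_def split: if_splits)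
  moreover have "finite ?K"
    by (rule finite_subset[of _ "{..CARD('m)}"]) (use alg_indep_card_bound in auto)
  ultimately have "transcendence_degree C \<in> ?K"
    unfolding transcendence_degree_def by (metis cSup_eq_Max Max_in)
  then obtain f where "alg_independent_on C (transcendence_degree C) f" by auto
  then show ?thesis
    using that[of "\<lambda>i. poly_fun (f i)"] poly_fun_pfun by (auto simp: alg_independent_on_iff)
qed

section \<open>Linear algebra for the bilinear dot product\<close>

text \<open>The bilinear, not Hermitian, pairing of a hyperplane with a point.\<close>
definition bd :: "complex ^ 'm::finite \<Rightarrow> complex ^ 'm \<Rightarrow> complex" where
  "bd u v = (\<Sum>i\<in>UNIV. vec_nth u i * vec_nth v i)"

lemma bd_commute: "bd u v = bd v u"
  by (simp add: bd_def mult.commute)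

lemma bd_add_right: "bd u (v + w) = bd u v + bd u w"
  and bd_scale_right: "bd u (c *s v) = c * bd u v"
  and bd_zero_right [simp]: "bd u 0 = 0"
  by (simp_all add: bd_def algebra_simps sum.distrib sum_distrib_left)

lemma bd_add_left: "bd (u + v) w = bd u w + bd v w"
  and bd_scale_left: "bd (c *s u) w = c * bd u w"
  and bd_zero_left [simp]: "bd 0 w = 0"
  by (simp_all add: bd_commute[of _ w] bd_add_right bd_scale_right)

lemma bd_sum_right: "bd u (\<Sum>i\<in>A. f i) = (\<Sum>i\<in>A. bd u (f i))"
  by (induction A rule: infinite_finite_induct) (auto simp: bd_add_right)

lemma bd_sum_left: "bd (\<Sum>i\<in>A. f i) u = (\<Sum>i\<in>A. bd (f i) u)"
  by (simp add: bd_commute[of _ u] bd_sum_right)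

lemma subspace_annihilator: "vec.subspace {w. \<forall>e\<in>E. bd e w = 0}"
  by (rule vec.subspaceI) (auto simp: bd_add_right bd_scale_right)

lemma bd_span_zero: "(\<And>e. e \<in> E \<Longrightarrow> bd e w = 0) \<Longrightarrow> x \<in> vec.span E \<Longrightarrow> bd x w = 0"
  using vec.span_minimal[of E "{e. \<forall>w'\<in>{w}. bd w' e = 0}"] subspace_annihilator[of "{w}"]
  by (auto simp: bd_commute[of w])

lemma annihilator_span: "{w. \<forall>e\<in>vec.span E. bd e w = 0} = {w. \<forall>e\<in>E. bd e w = 0}"
  using bd_span_zero vec.span_base by blast

definition dual_bases :: "('m \<Rightarrow> complex ^ 'm::finite) \<Rightarrow> ('m \<Rightarrow> complex ^ 'm) \<Rightarrow> bool" where
  "dual_bases b a \<longleftrightarrow> (\<forall>i j. bd (b i) (a j) = (if i = j then 1 else 0)) \<and>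
     (\<forall>x. x = (\<Sum>i\<in>UNIV. bd x (a i) *s b i)) \<and> (\<forall>x. x = (\<Sum>i\<in>UNIV. bd (b i) x *s a i))"

definition rows_mat :: "('m \<Rightarrow> complex ^ 'm::finite) \<Rightarrow> complex ^ 'm ^ 'm" where
  "rows_mat b = (\<chi> i. b i)"

lemma rows_mat_mult_vec: "vec_nth (rows_mat b *v x) i = bd (b i) x"
  by (simp add: rows_mat_def matrix_vector_mult_def bd_def)

lemma dual_bases_of_det:
  assumes "Determinants.det (rows_mat b) \<noteq> 0"
  obtains a where "dual_bases b a"
proof -
  from assms have "invertible (rows_mat b)" by (simp add: invertible_det_nz)
  then obtain A where A: "rows_mat b ** A = Finite_Cartesian_Product.mat 1" "A ** rows_mat b = Finite_Cartesian_Product.mat 1"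
    unfolding invertible_def by blast
  define a where "a j = Finite_Cartesian_Product.column j A" for j
  have 1: "bd (b i) (a j) = (if i = j then 1 else 0)" for i j
  proof -
    have "bd (b i) (a j) = vec_nth (vec_nth (rows_mat b ** A) i) j"
      by (simp add: bd_def a_def Finite_Cartesian_Product.column_def matrix_matrix_mult_def rows_mat_def)
    then show ?thesis unfolding A by (simp add: Finite_Cartesian_Product.mat_def)
  qed
  have 2: "x = (\<Sum>i\<in>UNIV. bd x (a i) *s b i)" for x
  proof -
    have "x = x v* (A ** rows_mat b)" unfolding A by (simp add: vector_matrix_mul_rid)
    also have "\<dots> = (x v* A) v* rows_mat b" by (simp add: vector_matrix_mul_assoc)
    finally have "x = (x v* A) v* rows_mat b" .
    moreover have "vec_nth (x v* A) i = bd x (a i)" for i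
      by (simp add: vector_matrix_mult_def bd_def a_def Finite_Cartesian_Product.column_def mult.commute)
    moreover have "vec_nth (z v* rows_mat b) j = (\<Sum>i\<in>UNIV. vec_nth z i * vec_nth (b i) j)" for z j
      by (simp add: vector_matrix_mult_def rows_mat_def mult.commute)
    ultimately have "vec_nth x j = (\<Sum>i\<in>UNIV. bd x (a i) * vec_nth (b i) j)" for j
      by (smt (verit) sum.cong)
    then show ?thesis by (simp add: Finite_Cartesian_Product.vec_eq_iff)
  qed
  have 3: "x = (\<Sum>i\<in>UNIV. bd (b i) x *s a i)" for x
  proof -
    have "x = A *v (rows_mat b *v x)" using A by (simp add: matrix_vector_mul_assoc)
    also have "\<dots> = (\<Sum>i\<in>UNIV. vec_nth (rows_mat b *v x) i *s Finite_Cartesian_Product.column i A)"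
      by (simp add: matrix_mult_sum)
    finally show ?thesis by (simp add: rows_mat_mult_vec a_def)
  qed
  show ?thesis by (rule that[of a]) (use 1 2 3 in \<open>auto simp: dual_bases_def\<close>)
qed

lemma det_rows_mat_nz_iff:
  "Determinants.det (rows_mat b) \<noteq> 0 \<longleftrightarrow> (\<forall>c. (\<Sum>i\<in>UNIV. c i *s b i) = 0 \<longrightarrow> (\<forall>i. c i = 0))"
proof -
  have "Determinants.det (rows_mat b) \<noteq> 0 \<longleftrightarrow> (\<exists>B. rows_mat b ** B = Finite_Cartesian_Product.mat 1)"
    by (simp add: invertible_det_nz[symmetric] invertible_right_inverse)
  also have "\<dots> \<longleftrightarrow> (\<forall>c. (\<Sum>i\<in>UNIV. c i *s Finite_Cartesian_Product.row i (rows_mat b)) = 0 \<longrightarrow> (\<forall>i. c i = 0))"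
    by (rule matrix_right_invertible_independent_rows)
  finally show ?thesis by (simp add: Finite_Cartesian_Product.row_def rows_mat_def)
qed

lemma det_rows_mat_nz_imp_zero:
  assumes "Determinants.det (rows_mat b) \<noteq> 0" "\<And>i. bd (b i) x = 0"
  shows "x = 0"
proof -
  obtain a where "dual_bases b a" using dual_bases_of_det[OF assms(1)] .
  then have "x = (\<Sum>i\<in>UNIV. bd (b i) x *s a i)" unfolding dual_bases_def by blast
  then show ?thesis using assms(2) by simp
qed

lemma inj_rows:
  assumes "Determinants.det (rows_mat b) \<noteq> 0"
  shows "inj_on b S"
proof -
  obtain a where "dual_bases b a" using dual_bases_of_det[OF assms] .
  then show ?thesis unfolding dual_bases_def inj_on_def by (metis zero_neq_one)
qed

lemma independent_rows:
  assumes "Determinants.det (rows_mat b) \<noteq> 0"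
  shows "vec.independent (b ` S)"
proof (rule vec.independent_if_scalars_zero)
  fix c x assume c: "(\<Sum>x\<in>b ` S. c x *s x) = 0" and x: "x \<in> b ` S"
  then obtain i where i: "i \<in> S" "x = b i" by auto
  obtain a where a: "dual_bases b a" using dual_bases_of_det[OF assms] .
  have "0 = bd (\<Sum>j\<in>S. c (b j) *s b j) (a i)"
    using c unfolding sum.reindex[OF inj_rows[OF assms]] by simp
  also have "\<dots> = (\<Sum>j\<in>S. if j = i then c (b i) else 0)"
    unfolding bd_sum_left bd_scale_left using a by (intro sum.cong) (auto simp: dual_bases_def)
  also have "\<dots> = c (b i)" using i by simp
  finally show "c x = 0" using i by simp
qed simp

lemma extend_to_basis:
  fixes B :: "(complex ^ 'm::finite) set"
  assumes "vec.independent B"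
  obtains b S where "b ` S = B" "inj b" "card S = card B" "Determinants.det (rows_mat b) \<noteq> 0"
proof -
  define E where "E = vec.extend_basis B"
  have E: "B \<subseteq> E" "vec.independent E" "vec.span E = UNIV"
    unfolding E_def using assms
    by (auto simp: vec.extend_basis_superset vec.independent_extend_basis vec.span_extend_basis)
  have finE: "finite E" using E(2) by (rule vec.finiteI_independent)
  have "card E = vec.dim (UNIV :: (complex ^ 'm) set)"
    using vec.dim_unique[of E UNIV "card E"] E by auto
  then have "card E = CARD('m)" by (simp add: vec.dim_UNIV card_cart_basis)
  then obtain b where b: "bij_betw b (UNIV :: 'm set) E"
    using finite_same_card_bij[of "UNIV :: 'm set" E] finE by auto
  define S where "S = b -` B"
  have inj: "inj b" and ran: "range b = E" using b by (auto simp: bij_betw_def)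
  have "b ` S = B" unfolding S_def using ran E(1) by auto
  moreover from this inj have "card S = card B" by (metis card_image inj_on_subset subset_UNIV)
  moreover have "Determinants.det (rows_mat b) \<noteq> 0"
    unfolding det_rows_mat_nz_iff
  proof (intro allI impI)
    fix c i assume "(\<Sum>i\<in>UNIV. c i *s b i) = 0"
    then have "(\<Sum>x\<in>E. c (inv_into UNIV b x) *s x) = 0"
      unfolding ran[symmetric] sum.reindex[OF inj] using inj by simp
    then have "c (inv_into UNIV b (b i)) = 0"
      using vec.independentD[OF E(2) finE order_refl, of "\<lambda>x. c (inv_into UNIV b x)" "b i"] ran by auto
    then show "c i = 0" using inj by simp
  qed
  ultimately show ?thesis using that[of b S] inj by simp
qed

lemma dim_annihilator:
  fixes E :: "(complex ^ 'm::finite) set"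
  shows "vec.dim {w. \<forall>e\<in>E. bd e w = 0} + vec.dim E = CARD('m)"
proof -
  obtain B where B: "B \<subseteq> E" "vec.independent B" "E \<subseteq> vec.span B" "card B = vec.dim E"
    by (rule vec.basis_exists[of E])
  obtain b S where b: "b ` S = B" "inj b" "card S = card B" "Determinants.det (rows_mat b) \<noteq> 0"
    using extend_to_basis[OF B(2)] .
  obtain a where a: "dual_bases b a" using dual_bases_of_det[OF b(4)] .
  have spanEB: "vec.span E = vec.span B"
    by (rule equalityI[OF vec.span_minimal[OF B(3) vec.subspace_span] vec.span_mono[OF B(1)]])
  have ann: "{w. \<forall>e\<in>E. bd e w = 0} = {w. \<forall>i\<in>S. bd (b i) w = 0}"
    using annihilator_span[of E] annihilator_span[of B] spanEB b(1) by auto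
  also have "\<dots> = vec.span (a ` (- S))"
  proof (intro equalityI subsetI)
    fix w assume w: "w \<in> {w. \<forall>i\<in>S. bd (b i) w = 0}"
    have "w = (\<Sum>i\<in>UNIV. bd (b i) w *s a i)" using a unfolding dual_bases_def by blast
    also have "\<dots> = (\<Sum>i\<in>-S. bd (b i) w *s a i)"
      using w by (intro sum.mono_neutral_right) auto
    also have "\<dots> \<in> vec.span (a ` (- S))"
      by (intro vec.span_sum vec.span_scale vec.span_base) auto
    finally show "w \<in> vec.span (a ` (- S))" .
  next
    fix w assume "w \<in> vec.span (a ` (- S))"
    moreover have "bd e (b i) = 0" if "e \<in> a ` (- S)" "i \<in> S" for e i
      using that a unfolding dual_bases_def by (auto simp: bd_commute[of _ "b i"])
    ultimately have "bd w (b i) = 0" if "i \<in> S" for i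
      using bd_span_zero[of "a ` (- S)" "b i" w] that by blast
    then show "w \<in> {w. \<forall>i\<in>S. bd (b i) w = 0}"
      by (simp add: bd_commute[of _ w])
  qed
  finally have ann_eq: "{w. \<forall>e\<in>E. bd e w = 0} = vec.span (a ` (- S))" .
  have inj_a: "inj a"
  proof (rule injI)
    fix i j assume "a i = a j"
    then have "bd (b i) (a j) = 1" using a unfolding dual_bases_def by metis
    then show "i = j" using a unfolding dual_bases_def by (metis zero_neq_one)
  qed
  have "vec.independent (a ` (- S))"
  proof (rule vec.independent_if_scalars_zero)
    fix c x assume c: "(\<Sum>x\<in>a ` (- S). c x *s x) = 0" and x: "x \<in> a ` (- S)"
    then obtain i where i: "i \<in> - S" "x = a i" by auto
    have "0 = bd (b i) (\<Sum>j\<in>- S. c (a j) *s a j)"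
      using c unfolding sum.reindex[OF inj_on_subset[OF inj_a subset_UNIV]] by simp
    also have "\<dots> = (\<Sum>j\<in>- S. if i = j then c (a i) else 0)"
      unfolding bd_sum_right bd_scale_right using a by (intro sum.cong) (auto simp: dual_bases_def)
    also have "\<dots> = c (a i)" using i by simp
    finally show "c x = 0" using i by simp
  qed simp
  then have "vec.dim (vec.span (a ` (- S))) = card (- S)"
    by (simp add: vec.dim_eq_card_independent card_image[OF inj_on_subset[OF inj_a subset_UNIV]])
  moreover have "card (- S) + card S = CARD('m)"
    using card_Un_disjoint[of "- S" S] by (simp add: Compl_partition2)
  ultimately show ?thesis unfolding ann_eq using b(3) B(4) by simp
qed

lemma double_annihilator:
  assumes "\<And>w. (\<And>e. e \<in> E \<Longrightarrow> bd e w = 0) \<Longrightarrow> bd \<eta> w = 0"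
  shows "\<eta> \<in> vec.span (E :: (complex ^ 'm::finite) set)"
proof (rule ccontr)
  assume "\<eta> \<notin> vec.span E"
  moreover have "{w. \<forall>e\<in>insert \<eta> E. bd e w = 0} = {w. \<forall>e\<in>E. bd e w = 0}" using assms by auto
  ultimately show False
    using dim_annihilator[of "insert \<eta> E"] dim_annihilator[of E] by (simp add: vec.dim_insert)
qed

section \<open>Frames and matrices\<close>

lemma det_mat_nonzero_iff:
  "Determinant.det (Matrix.mat k k (\<lambda>(i, j). M i j)) \<noteq> (0 :: complex) \<longleftrightarrow>
     (\<forall>c. (\<forall>i<k. (\<Sum>j<k. M i j * c j) = 0) \<longrightarrow> (\<forall>j<k. c j = 0))"
proof -
  let ?A = "Matrix.mat k k (\<lambda>(i, j). M i j)"
  have A: "?A \<in> carrier_mat k k" by simp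
  have mult: "?A *\<^sub>v Matrix.vec k c = 0\<^sub>v k \<longleftrightarrow> (\<forall>i<k. (\<Sum>j<k. M i j * c j) = 0)" for c
    by (auto simp: Matrix.vec_eq_iff scalar_prod_def atLeast0LessThan)
  have zero: "Matrix.vec k c = 0\<^sub>v k \<longleftrightarrow> (\<forall>j<k. c j = 0)" for c :: "nat \<Rightarrow> complex"
    by (auto simp: Matrix.vec_eq_iff)
  have "Determinant.det ?A = 0 \<longleftrightarrow> (\<exists>v. v \<in> carrier_vec k \<and> v \<noteq> 0\<^sub>v k \<and> ?A *\<^sub>v v = 0\<^sub>v k)"
    using det_0_iff_vec_prod_zero_field[OF A] by simp
  also have "\<dots> \<longleftrightarrow> (\<exists>c. Matrix.vec k c \<noteq> 0\<^sub>v k \<and> ?A *\<^sub>v Matrix.vec k c = 0\<^sub>v k)"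
  proof
    assume "\<exists>v. v \<in> carrier_vec k \<and> v \<noteq> 0\<^sub>v k \<and> ?A *\<^sub>v v = 0\<^sub>v k"
    then obtain v where v: "v \<in> carrier_vec k" "v \<noteq> 0\<^sub>v k" "?A *\<^sub>v v = 0\<^sub>v k" by blast
    have "Matrix.vec k (vec_index v) = v" using v(1) by (intro eq_vecI) auto
    then show "\<exists>c. Matrix.vec k c \<noteq> 0\<^sub>v k \<and> ?A *\<^sub>v Matrix.vec k c = 0\<^sub>v k"
      using v by (intro exI[of _ "vec_index v"]) simp
  next
    assume "\<exists>c. Matrix.vec k c \<noteq> 0\<^sub>v k \<and> ?A *\<^sub>v Matrix.vec k c = 0\<^sub>v k"
    then obtain c where "Matrix.vec k c \<noteq> 0\<^sub>v k" "?A *\<^sub>v Matrix.vec k c = 0\<^sub>v k" by blast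
    then show "\<exists>v. v \<in> carrier_vec k \<and> v \<noteq> 0\<^sub>v k \<and> ?A *\<^sub>v v = 0\<^sub>v k"
      by (intro exI[of _ "Matrix.vec k c"]) simp
  qed
  finally show ?thesis unfolding mult zero by blast
qed

lemma frame_dual:
  fixes a :: "nat \<Rightarrow> complex ^ 'm::finite"
  assumes "vec.span (a ` {..<CARD('m)}) = UNIV"
  obtains d where "\<And>i j. i < CARD('m) \<Longrightarrow> j < CARD('m) \<Longrightarrow> bd (a i) (d j) = (if i = j then 1 else 0)"
    "\<And>x. x = (\<Sum>k<CARD('m). bd x (d k) *s a k)"
proof -
  let ?m = "CARD('m)"
  obtain \<nu> where \<nu>: "bij_betw \<nu> (UNIV :: 'm set) {..<?m}"
    using ex_bij_betw_finite_nat[of "UNIV :: 'm set"] by (auto simp: atLeast0LessThan)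
  have inj: "inj \<nu>" and ran: "range \<nu> = {..<?m}" using \<nu> by (auto simp: bij_betw_def)
  define b where "b i = a (\<nu> i)" for i
  have rb: "range b = a ` {..<?m}" unfolding b_def ran[symmetric] by auto
  have dim: "vec.dim (UNIV :: (complex ^ 'm) set) = ?m"
    by (simp add: vec.dim_UNIV card_cart_basis)
  have card_le: "card (range b) \<le> ?m" by (rule card_image_le) simp
  have ind: "vec.independent (range b)"
    using vec.card_le_dim_spanning[of "range b" UNIV] assms dim card_le by (simp add: rb)
  then have "card (range b) = ?m"
    using vec.dim_unique[of "range b" UNIV "card (range b)"] assms dim by (simp add: rb)
  then have injb: "inj b" by (intro eq_card_imp_inj_on) simp_all
  have "Determinants.det (rows_mat b) \<noteq> 0"
    unfolding det_rows_mat_nz_iff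
  proof (intro allI impI)
    fix c i assume "(\<Sum>i\<in>UNIV. c i *s b i) = 0"
    then have "(\<Sum>x\<in>range b. c (inv_into UNIV b x) *s x) = 0"
      unfolding sum.reindex[OF injb] using injb by simp
    then have "c (inv_into UNIV b (b i)) = 0"
      using vec.independentD[OF ind _ order_refl, of "\<lambda>x. c (inv_into UNIV b x)" "b i"] by simp
    then show "c i = 0" using injb by simp
  qed
  then obtain d0 where d0: "dual_bases b d0" by (rule dual_bases_of_det)
  define d where "d k = d0 (inv_into UNIV \<nu> k)" for k
  have inv: "\<nu> (inv_into UNIV \<nu> k) = k" if "k < ?m" for k
    using that by (intro f_inv_into_f) (simp add: ran)
  show ?thesis
  proof (rule that[of d])
    fix i j assume ij: "i < ?m" "j < ?m"
    have "bd (b (inv_into UNIV \<nu> i)) (d0 (inv_into UNIV \<nu> j))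
        = (if inv_into UNIV \<nu> i = inv_into UNIV \<nu> j then 1 else 0)"
      using d0 unfolding dual_bases_def by blast
    moreover have "inv_into UNIV \<nu> i = inv_into UNIV \<nu> j \<longleftrightarrow> i = j" using inv ij by metis
    ultimately show "bd (a i) (d j) = (if i = j then 1 else 0)"
      by (simp add: b_def d_def inv ij)
  next
    fix x
    have "x = (\<Sum>i\<in>UNIV. bd x (d0 i) *s b i)" using d0 unfolding dual_bases_def by blast
    also have "\<dots> = (\<Sum>k<?m. bd x (d k) *s a k)"
      unfolding ran[symmetric] sum.reindex[OF inj] by (simp add: b_def d_def inv_into_f_f[OF inj])
    finally show "x = (\<Sum>k<?m. bd x (d k) *s a k)" .
  qed
qed

lemma extend_enumeration:
  fixes a :: "nat \<Rightarrow> 'a"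
  assumes a: "bij_betw a {..<p} B" and B: "B \<subseteq> B'" "finite B'" "card B' = q"
  obtains a' where "bij_betw a' {..<q} B'" "\<And>i. i < p \<Longrightarrow> a' i = a i"
proof -
  have "finite B" using B(1,2) by (rule finite_subset)
  have cB: "card B = p" using bij_betw_same_card[OF a] by simp
  then have pq: "p \<le> q" using card_mono[OF B(2,1)] B(3) by simp
  have "card (B' - B) = card {p..<q}" using card_Diff_subset[OF \<open>finite B\<close> B(1)] cB B(3) by simp
  then obtain h where h: "bij_betw h {p..<q} (B' - B)"
    using finite_same_card_bij[of "{p..<q}" "B' - B"] B(2) by auto
  define a' where "a' i = (if i < p then a i else h i)" for i
  have "bij_betw a' {..<p} B" using a by (rule bij_betw_cong[THEN iffD1, rotated]) (simp add: a'_def)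
  moreover have "bij_betw a' {p..<q} (B' - B)"
    using h by (rule bij_betw_cong[THEN iffD1, rotated]) (simp add: a'_def)
  ultimately have "bij_betw a' ({..<p} \<union> {p..<q}) (B \<union> (B' - B))" by (rule bij_betw_combine) auto
  moreover have "{..<p} \<union> {p..<q} = {..<q}" "B \<union> (B' - B) = B'" using pq B(1) by auto
  ultimately show ?thesis using that[of a'] by (simp add: a'_def)
qed

lemma extend_basis_in_subspace:
  fixes B :: "(complex ^ 'm::finite) set"
  assumes "vec.independent B" "B \<subseteq> V" "vec.subspace V"
  obtains B' where "B \<subseteq> B'" "B' \<subseteq> V" "vec.independent B'" "vec.span B' = V" "finite B'" "card B' = vec.dim V"
proof -
  obtain B' where B': "B \<subseteq> B'" "B' \<subseteq> V" "vec.independent B'" "V \<subseteq> vec.span B'"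
    by (rule vec.maximal_independent_subset_extend[OF assms(2,1)])
  have "vec.span B' = V"
    by (rule equalityI[OF vec.span_minimal[OF B'(2) assms(3)] B'(4)])
  moreover have "card B' = vec.dim V" using vec.dim_unique[OF B'(2,4,3) refl] by simp
  ultimately show ?thesis using that[of B'] B' vec.finiteI_independent[OF B'(3)] by simp
qed

lemma span_image_sum:
  fixes a :: "'i \<Rightarrow> complex ^ 'm::finite"
  assumes "x \<in> vec.span (a ` A)" "finite A"
  obtains c where "x = (\<Sum>i\<in>A. c i *s a i)"
proof -
  have "vec.span (a ` A) \<subseteq> range (\<lambda>c. \<Sum>i\<in>A. c i *s a i)"
  proof (rule vec.span_minimal)
    show "a ` A \<subseteq> range (\<lambda>c. \<Sum>i\<in>A. c i *s a i)"
    proof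
      fix x assume "x \<in> a ` A"
      then obtain j where j: "j \<in> A" "x = a j" by auto
      have "(\<Sum>i\<in>A. (if i = j then 1 else 0) *s a i) = (\<Sum>i\<in>A. if i = j then a j else 0)"
        by (rule sum.cong) auto
      then have "x = (\<Sum>i\<in>A. (if i = j then 1 else 0) *s a i)" using j assms(2) by simp
      then show "x \<in> range (\<lambda>c. \<Sum>i\<in>A. c i *s a i)"
        by (rule range_eqI[of _ _ "\<lambda>i. if i = j then 1 else 0"])
    qed
    show "vec.subspace (range (\<lambda>c. \<Sum>i\<in>A. c i *s a i))"
    proof (rule vec.subspaceI)
      show "0 \<in> range (\<lambda>c. \<Sum>i\<in>A. c i *s a i)" by (rule range_eqI[of _ _ "\<lambda>_. 0"]) simp
    next
      fix x y assume "x \<in> range (\<lambda>c. \<Sum>i\<in>A. c i *s a i)" "y \<in> range (\<lambda>c. \<Sum>i\<in>A. c i *s a i)"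
      then obtain c c' where "x = (\<Sum>i\<in>A. c i *s a i)" "y = (\<Sum>i\<in>A. c' i *s a i)" by auto
      then show "x + y \<in> range (\<lambda>c. \<Sum>i\<in>A. c i *s a i)"
        by (intro range_eqI[of _ _ "\<lambda>i. c i + c' i"]) (simp add: vec.scale_left_distrib sum.distrib)
    next
      fix s x assume "x \<in> range (\<lambda>c. \<Sum>i\<in>A. c i *s a i)"
      then obtain c where "x = (\<Sum>i\<in>A. c i *s a i)" by auto
      then show "s *s x \<in> range (\<lambda>c. \<Sum>i\<in>A. c i *s a i)"
        by (intro range_eqI[of _ _ "\<lambda>i. s * c i"]) (simp add: vec.scale_sum_right vec.scale_scale)
    qed
  qed
  with assms(1) that show ?thesis by blast
qed

section \<open>Polynomial solutions of linear systems\<close>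

lemma pfun_det:
  assumes "\<And>i j. (\<lambda>y. vec_nth (vec_nth (A y) i) j) \<in> fun_alg B"
  shows "(\<lambda>y. Determinants.det (A y :: complex ^ 'n ^ 'n)) \<in> fun_alg B"
  unfolding Determinants.det_def by (intro fun_alg_sum fun_alg_mult fun_alg_const fun_alg_prod assms)

lemma fun_alg_bd:
  assumes "\<And>i. (\<lambda>y. vec_nth (f y) i) \<in> fun_alg B" "\<And>i. (\<lambda>y. vec_nth (g y) i) \<in> fun_alg B"
  shows "(\<lambda>y. bd (f y) (g y)) \<in> fun_alg B"
  unfolding bd_def by (intro fun_alg_sum fun_alg_mult assms)

lemma pfun_bd: "pmap f \<Longrightarrow> pmap g \<Longrightarrow> (\<lambda>y. bd (f y) (g y)) \<in> pfun"
  unfolding pmap_def pfun_def by (intro fun_alg_bd) auto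

text \<open>
  A vector in the common kernel of covector fields extends to a polynomial vector field in the common
  kernels, provided that the rank at \<open>v\<close> is the generic one. Among the covectors at \<open>v\<close> a basis of their
  span is chosen and completed by constant covectors to an invertible matrix. Cramer's rule solves the
  linear system with the right-hand side prescribed at \<open>v\<close>, up to the determinant. Generically
  the chosen covectors still span the others, so the solution is in the kernel of all.
\<close>
lemma cramer_section:
  fixes \<M> :: "(complex ^ 'm::finite \<Rightarrow> complex ^ 'm) set"
  assumes prime: "prime_on pfun C" and \<M>: "\<And>M. M \<in> \<M> \<Longrightarrow> pmap M"
    and dense: "\<And>F. F \<in> pfun \<Longrightarrow> (\<And>y. y \<in> U \<Longrightarrow> F y = 0) \<Longrightarrow> (\<And>y. y \<in> C \<Longrightarrow> F y = 0)"
    and generic: "\<And>y. y \<in> U \<Longrightarrow> k \<le> vec.dim {w. \<forall>M\<in>\<M>. bd (M y) w = 0}"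
    and v: "v \<in> C" "vec.dim {w. \<forall>M\<in>\<M>. bd (M v) w = 0} = k"
    and w: "\<And>M. M \<in> \<M> \<Longrightarrow> bd (M v) w = 0"
  obtains u where "pmap u" "u v = w" "\<And>M y. M \<in> \<M> \<Longrightarrow> y \<in> C \<Longrightarrow> bd (M y) (u y) = 0"
proof -
  let ?E = "(\<lambda>M. M v) ` \<M>"
  have dimE: "k + vec.dim ?E = CARD('m)" using dim_annihilator[of ?E] v(2) by simp
  obtain B0 where B0: "B0 \<subseteq> ?E" "vec.independent B0" "?E \<subseteq> vec.span B0" "card B0 = vec.dim ?E"
    by (rule vec.basis_exists[of ?E])
  obtain b S where b: "b ` S = B0" "inj b" "card S = card B0" "Determinants.det (rows_mat b) \<noteq> 0"
    using extend_to_basis[OF B0(2)] .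
  have "\<exists>M. M \<in> \<M> \<and> M v = b i" if "i \<in> S" for i
  proof -
    have "b i \<in> ?E" using that b(1) B0(1) by auto
    then show ?thesis by auto
  qed
  then obtain M0 where M0: "\<And>i. i \<in> S \<Longrightarrow> M0 i \<in> \<M>" "\<And>i. i \<in> S \<Longrightarrow> M0 i v = b i"
    by metis
  define row where "row y i = (if i \<in> S then M0 i y else b i)" for y i
  define \<delta> where "\<delta> y = Determinants.det (rows_mat (row y))" for y
  have row_v: "row v = b" using M0(2) by (auto simp: row_def fun_eq_iff)
  have pmap_row: "(\<lambda>y. vec_nth (row y i) j) \<in> pfun" for i j
    using \<M>[OF M0(1), of i] by (cases "i \<in> S") (auto simp: row_def pmap_def pfun_const)
  have \<delta>: "\<delta> \<in> pfun" unfolding \<delta>_def[abs_def] pfun_def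
    by (rule pfun_det) (use pmap_row in \<open>simp add: rows_mat_def pfun_def\<close>)
  define z where "z = rows_mat b *v w"
  have zS: "vec_nth z i = 0" if "i \<in> S" for i
    using w[OF M0(1)[OF that]] M0(2)[OF that] by (simp add: z_def rows_mat_mult_vec)
  define u where "u y = (\<chi> k. Determinants.det (\<chi> i j. if j = k then vec_nth z i else vec_nth (row y i) j))" for y
  have u: "pmap u" unfolding pmap_def u_def
  proof
    fix k
    show "(\<lambda>y. vec_nth (\<chi> k. Determinants.det (\<chi> i j. if j = k then vec_nth z i else vec_nth (row y i) j)) k) \<in> pfun"
      unfolding vec_lambda_beta pfun_def
    proof (rule pfun_det)
      fix i j
      show "(\<lambda>y. vec_nth (vec_nth (\<chi> i j. if j = k then vec_nth z i else vec_nth (row y i) j) i) j)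
          \<in> fun_alg (range (\<lambda>i y. vec_nth y i))"
        using pmap_row[of i j] by (cases "j = k") (auto simp: pfun_def fun_alg_const)
    qed
  qed
  have u_eq: "u y = \<delta> y *s x" if "rows_mat (row y) *v x = z" for x y
  proof -
    have "vec_nth (u y) k = vec_nth x k * \<delta> y" for k
      using cramer_lemma[of k "rows_mat (row y)" x] unfolding that
      by (simp add: u_def \<delta>_def rows_mat_def cong: if_cong)
    then show ?thesis by (simp add: Finite_Cartesian_Product.vec_eq_iff mult.commute)
  qed
  have uv: "u v = \<delta> v *s w" by (rule u_eq) (simp add: row_v z_def)
  have \<delta>v: "\<delta> v \<noteq> 0" using b(4) by (simp add: \<delta>_def row_v)
  have vanish: "\<delta> y * bd (M y) (u y) = 0" if "y \<in> U" "M \<in> \<M>" for M y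
  proof (cases "\<delta> y = 0")
    case False
    let ?K = "{w. \<forall>M\<in>\<M>. bd (M y) w = 0}" and ?K' = "{w. \<forall>e\<in>row y ` S. bd e w = 0}"
    have "invertible (rows_mat (row y))" using False by (simp add: invertible_det_nz \<delta>_def)
    then obtain A where A: "rows_mat (row y) ** A = Finite_Cartesian_Product.mat 1" unfolding invertible_def by blast
    then have "rows_mat (row y) *v (A *v z) = z" by (simp add: matrix_vector_mul_assoc)
    from u_eq[OF this] have "rows_mat (row y) *v u y = \<delta> y *s z"
      using A by (simp add: vec.scale matrix_vector_mul_assoc)
    then have "bd (row y i) (u y) = \<delta> y * vec_nth z i" for i
      by (metis rows_mat_mult_vec vector_smult_component)
    then have uK': "u y \<in> ?K'" using zS by auto
    have sub: "?K \<subseteq> ?K'" using M0(1) by (auto simp: row_def)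
    note ind = independent_rows[OF False[unfolded \<delta>_def], of S] and inj = inj_rows[OF False[unfolded \<delta>_def], of S]
    have "vec.dim ?K' + card S = CARD('m)"
      using dim_annihilator[of "row y ` S"] ind by (simp add: vec.dim_eq_card_independent card_image[OF inj])
    then have "vec.dim ?K' \<le> vec.dim ?K"
      using dimE B0(4) b(3) generic[OF that(1)] by simp
    then have "?K = ?K'"
      using vec.subspace_dim_equal[OF _ _ sub] subspace_annihilator[of "(\<lambda>M. M y) ` \<M>"]
        subspace_annihilator[of "row y ` S"] by simp
    then show ?thesis using uK' that(2) by auto
  qed simp
  have "bd (M y) (u y) = 0" if M: "M \<in> \<M>" and y: "y \<in> C" for M y
  proof (rule prime_on_vanishing[OF prime \<delta> _ _ _ y])
    show "(\<lambda>y. bd (M y) (u y)) \<in> pfun" by (rule pfun_bd[OF \<M>[OF M] u])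
    show "\<exists>y\<in>C. \<delta> y \<noteq> 0" using v(1) \<delta>v by auto
    show "bd (M y) (u y) = 0" if "y \<in> C" "\<delta> y \<noteq> 0" for y
    proof -
      have "(\<lambda>y. \<delta> y * bd (M y) (u y)) \<in> pfun" by (intro pfun_mult \<delta> pfun_bd \<M> M u)
      from dense[OF this vanish[OF _ M] that(1)] that(2) show ?thesis by simp
    qed
  qed
  then show ?thesis
  proof (intro that[of "\<lambda>y. inverse (\<delta> v) *s u y"])
    show "pmap (\<lambda>y. inverse (\<delta> v) *s u y)" by (intro pmap_scale pfun_const u)
    show "inverse (\<delta> v) *s u v = w" using \<delta>v by (simp add: uv vec.scale_scale)
  qed (auto simp: bd_scale_right)
qed

section \<open>Iterated derivatives along vector fields\<close>

text \<open>
  The iterated derivative of \<open>F\<close> as a multilinear form, evaluated on the values of the vector fields: the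
  fields themselves are not differentiated.
\<close>
fun iter_dif :: "(complex ^ 'm::finite \<Rightarrow> complex) \<Rightarrow> (complex ^ 'm \<Rightarrow> complex ^ 'm) list \<Rightarrow> complex ^ 'm \<Rightarrow> complex" where
  "iter_dif F [] = F"
| "iter_dif F (u # us) = (\<lambda>y. \<Sum>i\<in>UNIV. vec_nth (u y) i * iter_dif (partial i F) us y)"

lemma pfun_iter_dif: "F \<in> pfun \<Longrightarrow> (\<And>u. u \<in> set us \<Longrightarrow> pmap u) \<Longrightarrow> iter_dif F us \<in> pfun"
  by (induction us arbitrary: F) (auto intro!: pfun_sum pfun_mult pfun_partial pmap_coord)

lemma iter_dif_swap:
  assumes "F \<in> pfun"
  shows "iter_dif F (a # b # us) y = iter_dif F (b # a # us) y"
proof -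
  have "partial i (partial j F) = partial j (partial i F)" for i j
    using partial_commute[OF assms] by (simp add: fun_eq_iff)
  then have "iter_dif F (a # b # us) y
      = (\<Sum>i\<in>UNIV. \<Sum>j\<in>UNIV. vec_nth (a y) i * (vec_nth (b y) j * iter_dif (partial i (partial j F)) us y))"
    by (simp add: sum_distrib_left)
  also have "\<dots> = iter_dif F (b # a # us) y"
    by (subst sum.swap) (simp add: sum_distrib_left mult_ac)
  finally show ?thesis .
qed

lemma iter_dif_single: "iter_dif F [u] y = dif F y (u y)"
  by (simp add: dif_def mult.commute)

lemma iter_dif_cong: "length us = length us' \<Longrightarrow> (\<And>j. j < length us \<Longrightarrow> (us ! j) y = (us' ! j) y) \<Longrightarrow>
    iter_dif F us y = iter_dif F us' y"
proof (induction us us' arbitrary: F rule: list_induct2')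
  case (4 u us u' us')
  have "u y = u' y" using 4(3)[of 0] by simp
  moreover have "iter_dif F us y = iter_dif F us' y" for F
  proof (rule 4(1))
    fix j assume "j < length us"
    then show "(us ! j) y = (us' ! j) y" using 4(3)[of "Suc j"] by simp
  qed (use 4(2) in simp)
  ultimately show ?case by simp
qed auto

text \<open>
  Product rule: differentiating the form gives the form of the next order, and the corrections come from
  differentiating one of the fields.
\<close>
lemma dif_iter_dif:
  assumes "F \<in> pfun" "\<And>x. x \<in> set us \<Longrightarrow> pmap x"
  shows "dif (iter_dif F us) y (u y) =
    iter_dif F (u # us) y + (\<Sum>j<length us. iter_dif F (us[j := \<lambda>y. vdif (us ! j) y (u y)]) y)"
  using assms
proof (induction us arbitrary: F)
  case Nil
  then show ?case by (simp add: dif_def mult.commute)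
next
  case (Cons a us)
  have a: "(\<lambda>y. vec_nth (a y) i) \<in> pfun" for i using Cons.prems(2)[of a] by (simp add: pmap_coord)
  have M: "iter_dif (partial i F) us \<in> pfun" for i using Cons.prems by (intro pfun_iter_dif pfun_partial) auto
  let ?D = "\<lambda>j. us[j := \<lambda>y. vdif (us ! j) y (u y)]"
  have IH: "dif (iter_dif (partial i F) us) y (u y) = iter_dif (partial i F) (u # us) y + (\<Sum>j<length us. iter_dif (partial i F) (?D j) y)" for i
    using Cons.prems by (intro Cons.IH pfun_partial) auto
  have "dif (iter_dif F (a # us)) y (u y)
      = (\<Sum>i\<in>UNIV. vec_nth (a y) i * dif (iter_dif (partial i F) us) y (u y)
          + iter_dif (partial i F) us y * dif (\<lambda>y. vec_nth (a y) i) y (u y))"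
    using a M by (simp add: dif_sum dif_mult pfun_mult)
  also have "\<dots> = iter_dif F (a # u # us) y + (\<Sum>j<length us. iter_dif F (a # ?D j) y)
      + iter_dif F ((\<lambda>y. vdif a y (u y)) # us) y"
  proof -
    have "(\<Sum>i\<in>UNIV. vec_nth (a y) i * dif (iter_dif (partial i F) us) y (u y))
        = iter_dif F (a # u # us) y + (\<Sum>j<length us. iter_dif F (a # ?D j) y)"
      unfolding IH iter_dif.simps(2)[of F a] distrib_left sum.distrib sum_distrib_left
      by (subst sum.swap) simp
    moreover have "(\<Sum>i\<in>UNIV. iter_dif (partial i F) us y * dif (\<lambda>y. vec_nth (a y) i) y (u y))
        = iter_dif F ((\<lambda>y. vdif a y (u y)) # us) y"
      by (simp add: vdif_def mult.commute)
    ultimately show ?thesis by (simp add: sum.distrib)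
  qed
  also have "\<dots> = iter_dif F (u # a # us) y
      + (\<Sum>j<length (a # us). iter_dif F ((a # us)[j := \<lambda>y. vdif ((a # us) ! j) y (u y)]) y)"
  proof -
    have "(\<Sum>j<length (a # us). H j) = H 0 + (\<Sum>j<length us. H (Suc j))" for H :: "nat \<Rightarrow> complex"
      by (simp only: length_Cons sum.lessThan_Suc_shift)
    then show ?thesis
      unfolding iter_dif_swap[OF Cons.prems(1), of a u] by (simp del: iter_dif.simps sum.lessThan_Suc)
  qed
  finally show ?case .
qed

lemma iter_dif_zero: "F \<in> pfun \<Longrightarrow> j < length us \<Longrightarrow> us ! j = (\<lambda>_. 0) \<Longrightarrow> iter_dif F us y = 0"
proof (induction us arbitrary: F j)
  case (Cons a us)
  show ?case
  proof (cases j)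
    case 0
    with Cons.prems show ?thesis by simp
  next
    case (Suc k)
    with Cons show ?thesis by (simp add: pfun_partial)
  qed
qed simp

lemma vdif_const: "vdif (\<lambda>_. w) y x = 0"
  by (simp add: vdif_def Finite_Cartesian_Product.vec_eq_iff)

text \<open>
  Along a line with constant direction \<open>w\<close> there are no corrections, so the list with one more \<open>w\<close> is the
  derivative.
\<close>
lemma taylor_line:
  assumes F: "F \<in> pfun" and p: "set p \<subseteq> range (\<lambda>w _. w)"
    and zero: "\<And>k. iter_dif F (replicate k (\<lambda>_. w) @ p) v = 0"
  shows "iter_dif F p (v + t *s w) = 0"
proof (rule taylor_vanishing[of "range (\<lambda>k. iter_dif F (replicate k (\<lambda>_. w) @ p))" "\<lambda>t. v + t *s w"])
  have pm: "pmap u" if "u \<in> set (replicate k (\<lambda>_. w) @ p)" for k u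
    using that p by (auto simp: pmap_const)
  then have pf: "iter_dif F (replicate k (\<lambda>_. w) @ p) \<in> pfun" for k by (intro pfun_iter_dif F)
  fix G assume "G \<in> range (\<lambda>k. iter_dif F (replicate k (\<lambda>_. w) @ p))"
  then obtain k where G: "G = iter_dif F (replicate k (\<lambda>_. w) @ p)" by auto
  show "poly_along (\<lambda>t. G (v + t *s w))" unfolding G by (rule poly_along_line[OF pf])
  let ?L = "replicate k (\<lambda>_. w) @ p"
  have "dif G y w = iter_dif F (replicate (Suc k) (\<lambda>_. w) @ p) y" for y
  proof -
    have "iter_dif F (?L[j := \<lambda>y. vdif (?L ! j) y w]) y = 0" if "j < length ?L" for j
    proof (rule iter_dif_zero[OF F])
      have "?L ! j \<in> set ?L" using that nth_mem by blast
      then have "?L ! j \<in> range (\<lambda>w _. w)" using p by auto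
      then show "?L[j := \<lambda>y. vdif (?L ! j) y w] ! j = (\<lambda>_. 0)"
        using that by (auto simp: vdif_const)
    qed (use that in simp)
    moreover have "dif (iter_dif F ?L) y ((\<lambda>_. w) y) = iter_dif F ((\<lambda>_. w) # ?L) y
        + (\<Sum>j<length ?L. iter_dif F (?L[j := \<lambda>y. vdif (?L ! j) y ((\<lambda>_. w) y)]) y)"
      by (rule dif_iter_dif[OF F pm])
    ultimately show ?thesis unfolding G by (simp del: iter_dif.simps)
  qed
  then have "((\<lambda>t. G (v + t *s w)) has_field_derivative iter_dif F (replicate (Suc k) (\<lambda>_. w) @ p) (v + t *s w)) (at t)" for t
    using dif_line[OF pf, of k v w t] unfolding G[symmetric] by metis
  then show "\<exists>F'\<in>range (\<lambda>k. iter_dif F (replicate k (\<lambda>_. w) @ p)).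
      \<forall>t. ((\<lambda>t. G (v + t *s w)) has_field_derivative F' (v + t *s w)) (at t)"
    by (intro bexI[of _ "iter_dif F (replicate (Suc k) (\<lambda>_. w) @ p)"] allI rangeI)
  show "G (v + 0 *s w) = 0" using zero[of k] by (simp add: G)
next
  show "iter_dif F p \<in> range (\<lambda>k. iter_dif F (replicate k (\<lambda>_. w) @ p))"
    by (rule image_eqI[of _ _ 0]) simp_all
qed

section \<open>Tangent spaces and tangent sections\<close>

definition grad :: "(complex ^ 'm::finite \<Rightarrow> complex) \<Rightarrow> complex ^ 'm \<Rightarrow> complex ^ 'm" where
  "grad F y = (\<chi> i. partial i F y)"

lemma bd_grad: "bd (grad F y) w = dif F y w"
  by (simp add: bd_def grad_def dif_def)

lemma pmap_grad: "F \<in> pfun \<Longrightarrow> pmap (grad F)"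
  by (simp add: pmap_def grad_def pfun_partial)

text \<open>
  \<open>C\<close> is the affine cone, \<open>I\<close> its ideal, and \<open>T y\<close> the affine tangent space. Density of the smooth points
  replaces the dimension theory that would relate the dimension of \<open>X\<close> to generic ranks.
\<close>
locale dense_smooth_variety =
  fixes X :: "'m::finite proj set" and n :: nat
  assumes irreducible: "irreducible_variety X"
    and dim_X: "proj_dim X = int n"
    and dense_X: "X \<subseteq> zariski_closure (smooth_points X)"
begin

abbreviation C where "C \<equiv> cone X"

definition I :: "(complex ^ 'm \<Rightarrow> complex) set" where
  "I = {F \<in> pfun. \<forall>y\<in>C. F y = 0}"

definition T :: "complex ^ 'm \<Rightarrow> (complex ^ 'm) set" where
  "T y = {w. \<forall>F\<in>I. dif F y w = 0}"

definition smooth_cone :: "(complex ^ 'm) set" where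
  "smooth_cone = {y. y \<noteq> 0 \<and> point y \<in> smooth_points X}"

text \<open>
  Tangency is required on the whole cone. By density this follows from tangency at the smooth points, and
  it makes differentiation along such a field preserve \<open>I\<close>.
\<close>
definition tfields :: "(complex ^ 'm \<Rightarrow> complex ^ 'm) set" where
  "tfields = {s. pmap s \<and> (\<forall>F\<in>I. \<forall>y\<in>C. dif F y (s y) = 0)}"

lemma prime_C: "prime_on pfun C"
  by (rule prime_on_cone[OF irreducible])

lemma IE: "F \<in> I \<Longrightarrow> F \<in> pfun" "F \<in> I \<Longrightarrow> y \<in> C \<Longrightarrow> F y = 0"
  by (auto simp: I_def)

lemma T_alt: "T y = {w. \<forall>M\<in>grad ` I. bd (M y) w = 0}"
  by (auto simp: T_def bd_grad)

lemma subspace_T: "vec.subspace (T y)"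
  using subspace_annihilator[of "(\<lambda>M. M y) ` grad ` I"] by (simp add: T_alt)

text \<open>The function \<open>F(c y)\<close> belongs to the ideal together with \<open>F\<close>.\<close>
lemma T_scale:
  assumes "w \<in> T y" "c \<noteq> 0"
  shows "w \<in> T (c *s y)"
proof -
  have "dif F (c *s y) w = 0" if F: "F \<in> I" for F
  proof -
    define G where "G y = F (c *s y)" for y
    have G: "G \<in> pfun"
      unfolding G_def[abs_def] using IE(1)[OF F] unfolding pfun_def
      by (rule fun_alg_subst)
        (auto intro!: fun_alg_mult[OF fun_alg_const fun_alg_base, of "\<lambda>y. vec_nth y _"])
    have "G y = 0" if "y \<in> C" for y using IE(2)[OF F cone_scale[OF that]] by (simp add: G_def)
    with G have "G \<in> I" by (simp add: I_def)
    then have "dif G y w = 0" using assms(1) by (simp add: T_def)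
    have "((\<lambda>t. F (c *s y + t *s (c *s w))) has_field_derivative dif F (c *s y) (c *s w)) (at 0)"
      using dif_line[OF IE(1)[OF F], of "c *s y" "c *s w" 0] by simp
    moreover have "(\<lambda>t. F (c *s y + t *s (c *s w))) = (\<lambda>t. G (y + t *s w))"
      by (simp add: G_def fun_eq_iff vec.scale_right_distrib vec.scale_scale mult.commute)
    ultimately have "dif F (c *s y) (c *s w) = dif G y w"
      using dif_line[OF G, of y w 0] by (auto intro: DERIV_unique)
    with \<open>dif G y w = 0\<close> assms(2) show ?thesis by (simp add: dif_scale_right)
  qed
  then show ?thesis by (simp add: T_def)
qed

lemma affine_tangent_point:
  assumes "y \<noteq> 0"
  shows "affine_tangent X (point y) = T y"
proof -
  have vanish: "(\<forall>y\<in>C. poly_fun f y = 0) \<longleftrightarrow> poly_fun f \<in> I" for f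
    by (simp add: I_def poly_fun_pfun)
  have all: "(\<forall>f. poly_fun f \<in> I \<longrightarrow> P (poly_fun f)) \<longleftrightarrow> (\<forall>F\<in>I. P F)" for P
  proof (intro iffI ballI allI impI)
    fix F assume *: "\<forall>f. poly_fun f \<in> I \<longrightarrow> P (poly_fun f)" and F: "F \<in> I"
    obtain f where "F = poly_fun f" using pfun_imp_poly_fun[OF IE(1)[OF F]] by auto
    with * F show "P F" by simp
  qed simp
  have "affine_tangent X (point y)
      = {w. \<forall>f. poly_fun f \<in> I \<longrightarrow> (\<forall>v\<in>line_of (point y) - {0}. dif (poly_fun f) v w = 0)}"
    unfolding affine_tangent_def vanish by (simp add: frechet_pfun[OF poly_fun_pfun])
  also have "\<dots> = {w. \<forall>F\<in>I. \<forall>v\<in>line_of (point y) - {0}. dif F v w = 0}"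
    by (intro Collect_cong all)
  also have "\<dots> = T y"
  proof (intro equalityI subsetI)
    fix w assume "w \<in> {w. \<forall>F\<in>I. \<forall>v\<in>line_of (point y) - {0}. dif F v w = 0}"
    then show "w \<in> T y" using mem_line_point[OF assms] assms by (auto simp: T_def)
  next
    fix w assume w: "w \<in> T y"
    have "dif F v w = 0" if F: "F \<in> I" and v: "v \<in> line_of (point y) - {0}" for F v
    proof -
      obtain c where "v = c *s y" "c \<noteq> 0" using v assms by (auto simp: in_line_of)
      then show ?thesis using T_scale[OF w, of c] F by (simp add: T_def)
    qed
    then show "w \<in> {w. \<forall>F\<in>I. \<forall>v\<in>line_of (point y) - {0}. dif F v w = 0}" by simp
  qed
  finally show ?thesis .
qed

lemma smooth_cone_nonzero: "y \<in> smooth_cone \<Longrightarrow> y \<noteq> 0"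
  by (simp add: smooth_cone_def)

lemma smooth_cone_C: "y \<in> smooth_cone \<Longrightarrow> y \<in> C"
  by (auto simp: smooth_cone_def smooth_points_def mem_cone)

lemma dim_T: "y \<in> smooth_cone \<Longrightarrow> vec.dim (T y) = n + 1"
  unfolding smooth_cone_def smooth_points_def using affine_tangent_point[of y] dim_X by auto

lemma smooth_cone_scale: "y \<in> smooth_cone \<Longrightarrow> c \<noteq> 0 \<Longrightarrow> c *s y \<in> smooth_cone"
proof -
  assume *: "y \<in> smooth_cone" "c \<noteq> 0"
  then have "point (c *s y) = point y"
    using line_of_mem_eq[of "c *s y" "point y"] smooth_cone_nonzero by (auto simp: in_line_of)
  with * show ?thesis by (auto simp: smooth_cone_def)
qed

text \<open>
  The closure is compared on whole lines, so \<open>F\<close> must vanish at the origin too. It does, as it vanishes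
  on a punctured line.
\<close>
lemma density:
  assumes "F \<in> pfun" "\<And>y. y \<in> smooth_cone \<Longrightarrow> F y = 0"
  shows "F \<in> I"
proof -
  have nz: "F y = 0" if "y \<in> cone (smooth_points X)" "y \<noteq> 0" for y
    using assms(2)[of y] that by (simp add: smooth_cone_def mem_cone)
  have zero: "F 0 = 0" if ne: "smooth_points X \<noteq> {}"
  proof -
    obtain q where q: "q \<in> smooth_points X" using ne by auto
    obtain v where v: "v \<noteq> 0" "q = point v" by (rule point_cases)
    obtain p where p: "(\<lambda>t. F (0 + t *s v)) = poly p"
      using poly_along_line[OF assms(1), of 0 v] unfolding poly_along_def by auto
    have "poly p t = 0" if "t \<noteq> 0" for t
      using assms(2)[OF smooth_cone_scale[OF _ that]] q v fun_cong[OF p, of t] by (auto simp: smooth_cone_def)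
    then have "UNIV - {0} \<subseteq> {t. poly p t = 0}" by auto
    moreover have "infinite (UNIV - {0 :: complex})" by (simp add: infinite_UNIV_char_0)
    ultimately have "p = 0" using poly_roots_finite finite_subset by blast
    then show ?thesis using fun_cong[OF p, of 0] by simp
  qed
  have "F y = 0" if "y \<in> C" for y
  proof (rule vanishing_on_closure[OF assms(1)])
    show "y \<in> cone (zariski_closure (smooth_points X))" using that dense_X by (auto simp: cone_def)
    show "F y = 0" if "y \<in> cone (smooth_points X)" for y
      using nz[OF that] zero that by (cases "y = 0") (auto simp: cone_def)
  qed
  then show ?thesis using assms(1) by (simp add: I_def)
qed

lemma smooth_cone_ex:
  assumes "F \<in> pfun" "F \<notin> I"
  shows "\<exists>y\<in>smooth_cone. F y \<noteq> 0"
  using density[OF assms(1)] assms(2) by blast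

lemma mult_not_I: "F \<in> pfun \<Longrightarrow> G \<in> pfun \<Longrightarrow> F \<notin> I \<Longrightarrow> G \<notin> I \<Longrightarrow> (\<lambda>y. F y * G y) \<notin> I"
proof
  assume *: "F \<in> pfun" "G \<in> pfun" "F \<notin> I" "G \<notin> I" "(\<lambda>y. F y * G y) \<in> I"
  then have "\<exists>y\<in>C. F y \<noteq> 0 \<and> G y \<noteq> 0"
    by (intro prime_onD[OF prime_C]) (auto simp: I_def)
  then show False using IE(2)[OF *(5)] by auto
qed

lemma tfields_pmap: "s \<in> tfields \<Longrightarrow> pmap s"
  by (simp add: tfields_def)

lemma tfields_dif: "s \<in> tfields \<Longrightarrow> F \<in> I \<Longrightarrow> y \<in> C \<Longrightarrow> dif F y (s y) = 0"
  by (simp add: tfields_def)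

lemma tfields_T: "s \<in> tfields \<Longrightarrow> y \<in> C \<Longrightarrow> s y \<in> T y"
  by (simp add: tfields_def T_def)

lemma dif_in_I: "s \<in> tfields \<Longrightarrow> F \<in> I \<Longrightarrow> (\<lambda>y. dif F y (s y)) \<in> I"
proof -
  assume s: "s \<in> tfields" and F: "F \<in> I"
  have "(\<lambda>y. dif F y (s y)) \<in> pfun" by (rule pfun_dif[OF IE(1)[OF F] pmap_coord[OF tfields_pmap[OF s]]])
  then show ?thesis using tfields_dif[OF s F] by (simp add: I_def)
qed

lemma tfields_smooth_cone:
  assumes "pmap s" "\<And>y. y \<in> smooth_cone \<Longrightarrow> s y \<in> T y"
  shows "s \<in> tfields"
proof -
  have "(\<lambda>y. dif F y (s y)) \<in> I" if "F \<in> I" for F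
    using assms that IE(1) by (intro density pfun_dif) (auto simp: pmap_def T_def)
  then show ?thesis using assms(1) by (auto simp: tfields_def I_def)
qed

lemma tangent_section_iff: "tangent_section X s \<longleftrightarrow> s \<in> tfields"
proof
  assume "tangent_section X s"
  then show "s \<in> tfields"
    by (intro tfields_smooth_cone) (auto simp: tangent_section_def polynomial_map_iff smooth_cone_def affine_tangent_point)
next
  assume "s \<in> tfields"
  then show "tangent_section X s"
    using tfields_T smooth_cone_C
    by (auto simp: tangent_section_def polynomial_map_iff tfields_pmap smooth_cone_def affine_tangent_point)
qed

lemma tfields_add: "s \<in> tfields \<Longrightarrow> u \<in> tfields \<Longrightarrow> (\<lambda>y. s y + u y) \<in> tfields"
  by (auto simp: tfields_def pmap_def pfun_add dif_plus_right)

lemma tfields_scale: "s \<in> tfields \<Longrightarrow> (\<lambda>y. c *s s y) \<in> tfields"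
  by (auto simp: tfields_def pmap_def pfun_mult pfun_const dif_scale_right)

lemma tfields_diff: "s \<in> tfields \<Longrightarrow> u \<in> tfields \<Longrightarrow> (\<lambda>y. s y - u y) \<in> tfields"
proof -
  have "s y - u y = s y + (-1) *s u y" for y
    by (simp add: Finite_Cartesian_Product.vec_eq_iff)
  then show "s \<in> tfields \<Longrightarrow> u \<in> tfields \<Longrightarrow> ?thesis" using tfields_add[OF _ tfields_scale[of u "-1"], of s] by simp
qed

lemma I_deriv: "F \<in> I \<Longrightarrow> y \<in> C \<Longrightarrow> w \<in> T y \<Longrightarrow> dif F y w = 0"
  by (simp add: T_def)

text \<open>Euler's relation, for functions that need not be homogeneous: the cone contains the line through each of its points.\<close>
lemma identity_tfields: "(\<lambda>y. y) \<in> tfields"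
proof -
  have "dif F y y = 0" if F: "F \<in> I" and y: "y \<in> C" for F y
  proof -
    have "F (y + t *s y) = 0" for t
    proof -
      have eq: "y + t *s y = (1 + t) *s y" by (simp add: vec.scale_left_distrib)
      show ?thesis unfolding eq by (rule IE(2)[OF F cone_scale[OF y]])
    qed
    then have "((\<lambda>t. 0) has_field_derivative dif F y y) (at 0)"
      using dif_line[OF IE(1)[OF F], of y y 0] by simp
    then show ?thesis using DERIV_unique[OF _ DERIV_const] by blast
  qed
  then show ?thesis by (simp add: tfields_def pmap_id)
qed

lemma tangent_section_through:
  assumes "v \<in> smooth_cone" "w \<in> T v"
  obtains s where "s \<in> tfields" "s v = w"
proof -
  obtain u where u: "pmap u" "u v = w" "\<And>M y. M \<in> grad ` I \<Longrightarrow> y \<in> C \<Longrightarrow> bd (M y) (u y) = 0"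
  proof (rule cramer_section[OF prime_C, of "grad ` I" smooth_cone "n + 1" v w])
    show "F y = 0" if "F \<in> pfun" "\<And>y. y \<in> smooth_cone \<Longrightarrow> F y = 0" "y \<in> C" for F y
      using density[OF that(1,2)] that(3) by (simp add: I_def)
    show "n + 1 \<le> vec.dim {w. \<forall>M\<in>grad ` I. bd (M y) w = 0}" if "y \<in> smooth_cone" for y
      using dim_T[OF that] unfolding T_alt by simp
    show "v \<in> C" using assms(1) by (rule smooth_cone_C)
    show "vec.dim {w. \<forall>M\<in>grad ` I. bd (M v) w = 0} = n + 1"
      using dim_T[OF assms(1)] unfolding T_alt .
    show "bd (M v) w = 0" if "M \<in> grad ` I" for M using assms(2) that unfolding T_alt by blast
  qed (use pmap_grad IE(1) in blast)+
  have "dif F y (u y) = 0" if "F \<in> I" "y \<in> C" for F y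
    using u(3)[OF imageI[OF that(1)] that(2)] by (simp add: bd_grad)
  then have "u \<in> tfields" using u(1) by (simp add: tfields_def)
  with u(2) that show ?thesis by blast
qed

text \<open>
  Both sides are minus the Hessian of \<open>F\<close>, which is symmetric. In other words tangent fields are closed under
  the Lie bracket, and the second fundamental form is symmetric.
\<close>
lemma bracket:
  assumes "s \<in> tfields" "x \<in> tfields" "F \<in> I" "y \<in> C"
  shows "dif F y (vdif s y (x y)) = dif F y (vdif x y (s y))"
proof -
  have F: "F \<in> pfun" using IE(1)[OF assms(3)] .
  have "hess F y (x y) (s y) + dif F y (vdif s y (x y)) = 0"
    using tfields_dif[OF assms(2) dif_in_I[OF assms(1,3)] assms(4)]
    by (simp add: dif_dif[OF F tfields_pmap[OF assms(1)]])
  moreover have "hess F y (s y) (x y) + dif F y (vdif x y (s y)) = 0"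
    using tfields_dif[OF assms(1) dif_in_I[OF assms(2,3)] assms(4)]
    by (simp add: dif_dif[OF F tfields_pmap[OF assms(2)]])
  ultimately show ?thesis using hess_commute[OF F, of y "x y" "s y"] by (metis add_left_cancel)
qed

lemma hess_section:
  assumes "s \<in> tfields" "F \<in> I" "y \<in> C" "w \<in> T y"
  shows "hess F y w (s y) = - dif F y (vdif s y w)"
  using I_deriv[OF dif_in_I[OF assms(1,2)] assms(3,4)] dif_dif[OF IE(1)[OF assms(2)] tfields_pmap[OF assms(1)], of y w]
  by (simp add: eq_neg_iff_add_eq_0)

lemma tfields_symmetric:
  assumes "s \<in> tfields" "x \<in> tfields" "(\<lambda>y. vdif s y (x y)) \<in> tfields"
  shows "(\<lambda>y. vdif x y (s y)) \<in> tfields"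
  using assms bracket by (auto simp: tfields_def pmap_vdif)

section \<open>The kernel of the Gauss map and its sections\<close>

text \<open>Fields with values in the kernel of the differential of the Gauss map.\<close>
definition kfields :: "(complex ^ 'm \<Rightarrow> complex ^ 'm) set" where
  "kfields = {u \<in> tfields. \<forall>s\<in>tfields. (\<lambda>y. vdif s y (u y)) \<in> tfields}"

lemma kfields_D: "u \<in> kfields \<Longrightarrow> s \<in> tfields \<Longrightarrow> (\<lambda>y. vdif s y (u y)) \<in> tfields"
  by (simp add: kfields_def)

lemma vdif_vdif:
  assumes "pmap u" "pmap s"
  shows "vdif (\<lambda>y. vdif u y (s y)) y x = (\<chi> i. hess (\<lambda>y. vec_nth (u y) i) y x (s y)) + vdif u y (vdif s y x)"
proof -
  have "dif (\<lambda>y. dif (\<lambda>y. vec_nth (u y) i) y (s y)) y x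
      = hess (\<lambda>y. vec_nth (u y) i) y x (s y) + dif (\<lambda>y. vec_nth (u y) i) y (vdif s y x)" for i
    by (rule dif_dif[OF pmap_coord[OF assms(1)] assms(2)])
  then show ?thesis by (simp add: vdif_def Finite_Cartesian_Product.vec_eq_iff)
qed

text \<open>
  The kernels of the Gauss map form a totally geodesic distribution. Write \<open>D\<^sub>x u\<close> for the derivative
  of \<open>u\<close> along \<open>x\<close>. Symmetry of second derivatives gives
  \<open>D\<^sub>x(D\<^sub>s u) = D\<^sub>s(D\<^sub>x u) - D u(D\<^sub>s x) + D u(D\<^sub>x s)\<close>. As \<open>u\<close> and \<open>s\<close> lie in the kernel, every term on
  the right is tangent for every tangent \<open>x\<close>, and by symmetry the derivative of \<open>x\<close> along \<open>D\<^sub>s u\<close> is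
  tangent as well.
\<close>
lemma kfields_vdif:
  assumes u: "u \<in> kfields" and s: "s \<in> kfields"
  shows "(\<lambda>y. vdif u y (s y)) \<in> kfields"
proof -
  have uT: "u \<in> tfields" and sT: "s \<in> tfields" using u s by (auto simp: kfields_def)
  have Du: "(\<lambda>y. vdif u y (s y)) \<in> tfields" using s uT by (simp add: kfields_def)
  have "(\<lambda>y. vdif x y (vdif u y (s y))) \<in> tfields" if x: "x \<in> tfields" for x
  proof (rule tfields_symmetric[OF Du x])
    have a: "(\<lambda>y. vdif u y (x y)) \<in> tfields" "(\<lambda>y. vdif s y (x y)) \<in> tfields"
      by (rule tfields_symmetric[OF x uT kfields_D[OF u x]], rule tfields_symmetric[OF x sT kfields_D[OF s x]])
    have b: "(\<lambda>y. vdif x y (s y)) \<in> tfields" by (rule kfields_D[OF s x])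
    have c: "(\<lambda>y. vdif (\<lambda>y. vdif u y (x y)) y (s y)) \<in> tfields" by (rule kfields_D[OF s a(1)])
    have d: "(\<lambda>y. vdif u y (vdif x y (s y))) \<in> tfields" "(\<lambda>y. vdif u y (vdif s y (x y))) \<in> tfields"
      by (rule tfields_symmetric[OF b uT kfields_D[OF u b]], rule tfields_symmetric[OF a(2) uT kfields_D[OF u a(2)]])
    have "vdif (\<lambda>y. vdif u y (s y)) y (x y) =
        vdif (\<lambda>y. vdif u y (x y)) y (s y) - vdif u y (vdif x y (s y)) + vdif u y (vdif s y (x y))" for y
      using hess_commute[OF pmap_coord[OF tfields_pmap[OF uT]]]
      by (simp add: vdif_vdif tfields_pmap uT sT x)
    then show "(\<lambda>y. vdif (\<lambda>y. vdif u y (s y)) y (x y)) \<in> tfields"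
      using tfields_add[OF tfields_diff[OF c d(1)] d(2)] by simp
  qed
  with Du show ?thesis by (simp add: kfields_def)
qed

text \<open>
  Induction on the order: the derivative along a kernel field of a function of \<open>I\<close> is in \<open>I\<close>. In the
  product rule all corrections have the lower order, since kernel fields are closed under
  differentiation along each other, and a tangent field stays tangent when differentiated along a kernel
  field.
\<close>
lemma iter_dif_in_I:
  assumes "F \<in> I" "set us \<subseteq> kfields" "x \<in> tfields"
  shows "iter_dif F (us @ [x]) \<in> I"
  using assms(2,3)
proof (induction "length us" arbitrary: us x)
  case 0
  then show ?case using dif_in_I[OF _ assms(1), of x] iter_dif_single[of F x] by (simp add: fun_eq_iff cong: sum.cong)
next
  case (Suc k)
  then obtain u vs where us: "us = u # vs" by (cases us) auto
  have F: "F \<in> pfun" using IE(1)[OF assms(1)] .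
  have u: "u \<in> kfields" "u \<in> tfields" and vs: "set vs \<subseteq> kfields" "length vs = k"
    using Suc.prems Suc.hyps(2) us by (auto simp: kfields_def)
  let ?L = "vs @ [x]"
  have pm: "pmap z" if "z \<in> set ?L" for z using that vs Suc.prems by (auto simp: kfields_def tfields_def)
  have "iter_dif F (?L[j := \<lambda>y. vdif (?L ! j) y (u y)]) \<in> I" if j: "j < length ?L" for j
  proof (cases "j < length vs")
    case True
    have "(\<lambda>y. vdif (vs ! j) y (u y)) \<in> kfields"
      using True vs u kfields_vdif nth_mem by blast
    then have "set (vs[j := \<lambda>y. vdif (vs ! j) y (u y)]) \<subseteq> kfields"
      using vs(1) set_update_subset_insert by fastforce
    then show ?thesis
      using Suc.hyps(1)[of "vs[j := \<lambda>y. vdif (vs ! j) y (u y)]" x] vs Suc.prems True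
      by (simp add: nth_append list_update_append)
  next
    case False
    then have j: "j = length vs" using j by simp
    have "(\<lambda>y. vdif x y (u y)) \<in> tfields" using u Suc.prems by (simp add: kfields_def)
    then have "iter_dif F (vs @ [\<lambda>y. vdif x y (u y)]) \<in> I" using Suc.hyps(1)[of vs] vs by simp
    moreover have "?L[j := \<lambda>y. vdif (?L ! j) y (u y)] = vs @ [\<lambda>y. vdif x y (u y)]"
      unfolding j by simp
    ultimately show ?thesis by simp
  qed
  then have "iter_dif F (?L[j := \<lambda>y. vdif (?L ! j) y (u y)]) y = 0" if "j < length ?L" "y \<in> C" for j y
    using IE(2) that by blast
  moreover have "dif (iter_dif F ?L) y (u y) = 0" if "y \<in> C" for y
    using Suc.hyps(1)[of vs x] vs Suc.prems tfields_dif[OF u(2) _ that] by simp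
  moreover have "dif (iter_dif F ?L) y (u y) =
      iter_dif F (u # ?L) y + (\<Sum>j<length ?L. iter_dif F (?L[j := \<lambda>y. vdif (?L ! j) y (u y)]) y)" for y
    by (rule dif_iter_dif[OF F pm])
  ultimately have "iter_dif F (u # ?L) y = 0" if "y \<in> C" for y
    using that by (simp del: iter_dif.simps)
  moreover have "iter_dif F (u # ?L) \<in> pfun" using pm u by (intro pfun_iter_dif F) (auto simp: tfields_def)
  ultimately show ?case unfolding us I_def by simp
qed

text \<open>
  All derivatives of \<open>F\<close> and of \<open>dF(w')\<close> at \<open>v\<close> in the direction \<open>u v\<close> vanish, because they depend on the
  values of the fields at \<open>v\<close> only. So the line in this direction stays in the cone, and the tangent space
  at \<open>v\<close> stays in the tangent spaces along it.
\<close>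
lemma leaf_linear:
  assumes v: "v \<in> smooth_cone" and u: "u \<in> kfields" and F: "F \<in> I"
  shows "F (v + t *s u v) = 0" and "w' \<in> T v \<Longrightarrow> dif F (v + t *s u v) w' = 0"
proof -
  have vC: "v \<in> C" by (rule smooth_cone_C[OF v])
  have uT: "u \<in> tfields" using u by (simp add: kfields_def)
  have zero: "iter_dif F (replicate k (\<lambda>_. u v) @ [\<lambda>_. w]) v = 0" if w: "w \<in> T v" for k w
  proof -
    obtain x where x: "x \<in> tfields" "x v = w" by (rule tangent_section_through[OF v w])
    have "iter_dif F (replicate k u @ [x]) v = 0"
      using IE(2)[OF iter_dif_in_I[OF F _ x(1)] vC, of "replicate k u"] u by (auto simp: set_replicate_conv_if)
    moreover have "iter_dif F (replicate k u @ [x]) v = iter_dif F (replicate k (\<lambda>_. u v) @ [\<lambda>_. w]) v"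
      by (rule iter_dif_cong) (auto simp: nth_append x(2))
    ultimately show ?thesis by simp
  qed
  show "dif F (v + t *s u v) w' = 0" if "w' \<in> T v"
    using taylor_line[OF IE(1)[OF F], of "[\<lambda>_. w']" "u v" v t] zero[OF that] iter_dif_single[of F "\<lambda>_. w'"]
    by (auto simp del: iter_dif.simps)
  have "iter_dif F [] (v + t *s u v) = 0"
  proof (rule taylor_line[OF IE(1)[OF F]])
    show "iter_dif F (replicate k (\<lambda>_. u v) @ []) v = 0" for k
    proof (cases k)
      case 0
      then show ?thesis using IE(2)[OF F vC] by simp
    next
      case (Suc k')
      have eq: "replicate k (\<lambda>_. u v) = replicate k' (\<lambda>_. u v) @ [\<lambda>_. u v]"
        unfolding Suc by (simp only: replicate_Suc replicate_append_same)
      show ?thesis unfolding append_Nil2 eq by (rule zero[OF tfields_T[OF uT vC]])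
    qed
  qed simp
  then show "F (v + t *s u v) = 0" by simp
qed

lemma gauss_kernel_eq:
  assumes "v \<noteq> 0"
  shows "gauss_kernel X v = {w \<in> T v. \<forall>s\<in>tfields. vdif s v w \<in> T v}"
  unfolding gauss_kernel_def affine_tangent_point[OF assms] tangent_section_iff
  by (auto simp: frechet_pmap tfields_pmap)

text \<open>
  The condition that \<open>ds(w)\<close> be tangent is linear in \<open>w\<close>; \<open>cov F s\<close> is the covector field that
  expresses its part coming from \<open>F\<close>. So kernels of the Gauss map are again kernels of polynomial
  covector fields.
\<close>
definition cov :: "(complex ^ 'm \<Rightarrow> complex) \<Rightarrow> (complex ^ 'm \<Rightarrow> complex ^ 'm) \<Rightarrow> complex ^ 'm \<Rightarrow> complex ^ 'm" where
  "cov F s y = (\<chi> j. \<Sum>i\<in>UNIV. partial i F y * partial j (\<lambda>y. vec_nth (s y) i) y)"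

lemma bd_cov: "bd (cov F s y) w = dif F y (vdif s y w)"
  unfolding bd_def cov_def vdif_def dif_def vec_lambda_beta sum_distrib_left sum_distrib_right
  by (subst sum.swap) (simp add: mult_ac)

lemma pmap_cov: "F \<in> pfun \<Longrightarrow> pmap s \<Longrightarrow> pmap (cov F s)"
  unfolding pmap_def cov_def vec_lambda_beta by (intro allI pfun_sum pfun_mult pfun_partial) auto

lemma gauss_kernel_alt:
  assumes "v \<noteq> 0"
  shows "gauss_kernel X v = {w. \<forall>M\<in>grad ` I \<union> {cov F s |F s. F \<in> I \<and> s \<in> tfields}. bd (M v) w = 0}"
proof -
  let ?M = "grad ` I \<union> {cov F s |F s. F \<in> I \<and> s \<in> tfields}"
  have "(\<forall>M\<in>?M. bd (M v) w = 0) \<longleftrightarrow>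
      (\<forall>F\<in>I. dif F v w = 0) \<and> (\<forall>s\<in>tfields. \<forall>F\<in>I. dif F v (vdif s v w) = 0)" for w
  proof (intro iffI conjI ballI)
    fix F s assume h: "\<forall>M\<in>?M. bd (M v) w = 0" and F: "F \<in> I"
    show "dif F v w = 0" using bspec[OF h, of "grad F"] F by (simp add: bd_grad)
    assume s: "s \<in> tfields"
    have "cov F s \<in> ?M" using F s by blast
    from bspec[OF h this] show "dif F v (vdif s v w) = 0" by (simp add: bd_cov)
  next
    fix M assume "(\<forall>F\<in>I. dif F v w = 0) \<and> (\<forall>s\<in>tfields. \<forall>F\<in>I. dif F v (vdif s v w) = 0)" "M \<in> ?M"
    then show "bd (M v) w = 0" by (auto simp: bd_grad bd_cov)
  qed
  then show ?thesis unfolding gauss_kernel_eq[OF assms] T_def by simp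
qed

lemma gauss_section_through:
  assumes G: "G \<in> pfun" and k: "\<And>y. y \<in> smooth_cone \<Longrightarrow> G y \<noteq> 0 \<Longrightarrow> vec.dim (gauss_kernel X y) = k"
    and v: "v \<in> smooth_cone" "G v \<noteq> 0" and w: "w \<in> gauss_kernel X v"
  obtains u where "u \<in> kfields" "u v = w"
proof -
  let ?M = "grad ` I \<union> {cov F s |F s. F \<in> I \<and> s \<in> tfields}"
  obtain u where u: "pmap u" "u v = w" "\<And>M y. M \<in> ?M \<Longrightarrow> y \<in> C \<Longrightarrow> bd (M y) (u y) = 0"
  proof (rule cramer_section[OF prime_C, of ?M "{y\<in>smooth_cone. G y \<noteq> 0}" k v w])
    show "pmap M" if "M \<in> ?M" for M using that pmap_grad pmap_cov IE(1) tfields_pmap by blast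
    show "F y = 0" if F: "F \<in> pfun" "\<And>y. y \<in> {y\<in>smooth_cone. G y \<noteq> 0} \<Longrightarrow> F y = 0" and y: "y \<in> C" for F y
    proof -
      have "(\<lambda>y. G y * F y) \<in> I" using F by (intro density pfun_mult G) auto
      then have "F \<in> I"
        using mult_not_I[OF G F(1)] v smooth_cone_C[OF v(1)] IE(2)[of G v] by blast
      with y show ?thesis by (simp add: I_def)
    qed
    show "k \<le> vec.dim {w. \<forall>M\<in>?M. bd (M y) w = 0}" if "y \<in> {y\<in>smooth_cone. G y \<noteq> 0}" for y
      using k[of y] that unfolding gauss_kernel_alt[OF smooth_cone_nonzero, symmetric] 
      by (simp add: gauss_kernel_alt smooth_cone_nonzero)
    show "v \<in> C" by (rule smooth_cone_C[OF v(1)])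
    show "vec.dim {w. \<forall>M\<in>?M. bd (M v) w = 0} = k"
      using k[OF v] by (simp add: gauss_kernel_alt[OF smooth_cone_nonzero[OF v(1)]])
    show "bd (M v) w = 0" if "M \<in> ?M" for M
      using w that unfolding gauss_kernel_alt[OF smooth_cone_nonzero[OF v(1)]] by blast
  qed blast
  have uT: "u \<in> tfields" using u(1,3) by (auto simp: tfields_def bd_grad[symmetric])
  moreover have "(\<lambda>y. vdif s y (u y)) \<in> tfields" if s: "s \<in> tfields" for s
  proof -
    have "dif F y (vdif s y (u y)) = 0" if "F \<in> I" "y \<in> C" for F y
      using u(3)[of "cov F s" y] that s by (auto simp: bd_cov)
    then show ?thesis using u(1) s by (simp add: tfields_def pmap_vdif)
  qed
  ultimately have "u \<in> kfields" by (simp add: kfields_def)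
  then show ?thesis using u(2) by (rule that)
qed

lemma subspace_gauss_kernel: "v \<noteq> 0 \<Longrightarrow> vec.subspace (gauss_kernel X v)"
  using subspace_annihilator[of "(\<lambda>M. M v) ` (grad ` I \<union> {cov F s |F s. F \<in> I \<and> s \<in> tfields})"]
  by (simp add: gauss_kernel_alt)

text \<open>By symmetry, the derivative of \<open>s\<close> along the identity field may be replaced by \<open>s\<close> itself.\<close>
lemma self_gauss_kernel:
  assumes "v \<in> smooth_cone"
  shows "v \<in> gauss_kernel X v"
proof -
  have vC: "v \<in> C" by (rule smooth_cone_C[OF assms])
  have "vdif (\<lambda>y. y) y w = w" for y w :: "complex ^ 'm"
    by (simp add: vdif_def Finite_Cartesian_Product.vec_eq_iff)
  then have "dif F v (vdif s v v) = 0" if "s \<in> tfields" "F \<in> I" for s F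
    using bracket[OF that(1) identity_tfields that(2) vC] tfields_dif[OF that vC] by simp
  then show ?thesis
    using tfields_T[OF identity_tfields vC] unfolding gauss_kernel_eq[OF smooth_cone_nonzero[OF assms]] by (auto simp: T_def)
qed

text \<open>Since \<open>v\<close> lies in its own kernel, the kernel is the union of the lines through \<open>v\<close> in its directions.\<close>
lemma leaf_through_generic:
  assumes G: "G \<in> pfun" and k: "\<And>y. y \<in> smooth_cone \<Longrightarrow> G y \<noteq> 0 \<Longrightarrow> vec.dim (gauss_kernel X y) = l + 1"
    and v: "v \<in> smooth_cone" "G v \<noteq> 0"
  shows "leaf_through X l (point v) (gauss_kernel X v)"
proof -
  let ?W = "gauss_kernel X v"
  have v0: "v \<noteq> 0" by (rule smooth_cone_nonzero[OF v(1)])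
  have sub: "vec.subspace ?W" by (rule subspace_gauss_kernel[OF v0])
  have leaf: "F q = 0" "w' \<in> T v \<Longrightarrow> dif F q w' = 0" if q: "q \<in> ?W" and F: "F \<in> I" for q F w'
  proof -
    have qv: "q - v \<in> ?W" by (rule vec.subspace_diff[OF sub q self_gauss_kernel[OF v(1)]])
    obtain u where u: "u \<in> kfields" "u v = q - v"
      by (rule gauss_section_through[OF G k v qv])
    show "F q = 0" using leaf_linear(1)[OF v(1) u(1) F, of 1] by (simp add: u(2))
    show "dif F q w' = 0" if "w' \<in> T v"
      using leaf_linear(2)[OF v(1) u(1) F that, of 1] by (simp add: u(2))
  qed
  have in_X: "p \<in> X" if p: "p \<in> proj_subspace ?W" for p
  proof -
    obtain q where q: "q \<noteq> 0" "p = point q" by (rule point_cases)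
    have line: "line_of p \<subseteq> ?W" using p by (simp add: proj_subspace_def)
    obtain Fs where Fs: "X = {p. \<forall>f\<in>Fs. \<forall>v\<in>line_of p. poly_fun f v = 0}"
      using irreducible unfolding irreducible_variety_def zariski_closed_def by auto
    have mem_X: "p \<in> X \<longleftrightarrow> (\<forall>f\<in>Fs. \<forall>v\<in>line_of p. poly_fun f v = 0)" for p
      by (subst Fs) (rule mem_Collect_eq)
    have "poly_fun f \<in> I" if "f \<in> Fs" for f
      using that mem_X by (auto simp: I_def cone_def poly_fun_pfun)
    then show ?thesis using leaf(1) line unfolding mem_X by blast
  qed
  have tangent: "tangent_subspace X p = tangent_subspace X (point v)"
    if p: "p \<in> proj_subspace ?W" "p \<in> smooth_points X" for p
  proof -
    obtain q where q: "q \<noteq> 0" "p = point q" by (rule point_cases)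
    have qS: "q \<in> smooth_cone" using p(2) q by (simp add: smooth_cone_def)
    have "q \<in> ?W" using p(1) q mem_line_point[OF q(1)] by (auto simp: proj_subspace_def)
    then have "T v \<subseteq> T q" using leaf(2) unfolding T_def[of q] by blast
    then have "T v = T q"
      using vec.subspace_dim_equal[OF subspace_T subspace_T] dim_T[OF qS] dim_T[OF v(1)] by simp
    then show ?thesis
      unfolding tangent_subspace_def q(2) affine_tangent_point[OF q(1)] affine_tangent_point[OF v0] by simp
  qed
  have "point v \<in> proj_subspace ?W"
    using self_gauss_kernel[OF v(1)] sub v0
    by (auto simp: proj_subspace_def in_line_of vec.subspace_scale)
  with sub k[OF v] in_X tangent show ?thesis unfolding leaf_through_def by blast
qed

end

section \<open>The conormal variety\<close>

text \<open>
  The gradients of the \<open>f\<^sub>i\<close> with \<open>i \<in> S\<close> form a basis of the conormal space at some smooth point, and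
  thus at a generic one. The constant covectors \<open>e\<^sub>i\<close> complete them to a basis, so that a single
  determinant \<open>\<delta>\<close> describes the generic points.
\<close>
locale conormal = dense_smooth_variety X n for X :: "'m::finite proj set" and n :: nat +
  fixes S :: "'m set" and f :: "'m \<Rightarrow> complex ^ 'm \<Rightarrow> complex" and e :: "'m \<Rightarrow> complex ^ 'm"
  assumes f: "\<And>i. i \<in> S \<Longrightarrow> f i \<in> I"
    and card_S: "card S + (n + 1) = CARD('m)"
    and nondegenerate: "\<exists>v\<in>smooth_cone. Determinants.det (rows_mat (\<lambda>i. if i \<in> S then grad (f i) v else e i)) \<noteq> 0"

lemma (in dense_smooth_variety) conormal_ex:
  assumes v: "v \<in> smooth_cone"
  obtains S f e where "conormal X n S f e"
    "Determinants.det (rows_mat (\<lambda>i. if i \<in> S then grad (f i) v else e i)) \<noteq> 0"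
proof -
  let ?E = "(\<lambda>F. grad F v) ` I"
  have "vec.dim (T v) + vec.dim ?E = CARD('m)"
    using dim_annihilator[of ?E] by (simp add: T_def bd_grad)
  then have dimE: "vec.dim ?E + (n + 1) = CARD('m)" using dim_T[OF v] by simp
  obtain B where B: "B \<subseteq> ?E" "vec.independent B" "?E \<subseteq> vec.span B" "card B = vec.dim ?E"
    by (rule vec.basis_exists[of ?E])
  obtain b S where b: "b ` S = B" "inj b" "card S = card B" "Determinants.det (rows_mat b) \<noteq> 0"
    using extend_to_basis[OF B(2)] .
  have "\<exists>F. F \<in> I \<and> grad F v = b i" if "i \<in> S" for i
  proof -
    have "b i \<in> ?E" using that b(1) B(1) by auto
    then show ?thesis by auto
  qed
  then obtain f where f: "\<And>i. i \<in> S \<Longrightarrow> f i \<in> I" "\<And>i. i \<in> S \<Longrightarrow> grad (f i) v = b i" by metis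
  have eq: "(\<lambda>i. if i \<in> S then grad (f i) v else b i) = b" using f(2) by auto
  have det: "Determinants.det (rows_mat (\<lambda>i. if i \<in> S then grad (f i) v else b i)) \<noteq> 0"
    unfolding eq by (rule b(4))
  have "conormal X n S f b"
    by unfold_locales (use f(1) dimE B(4) b(3) det v in auto)
  with det show ?thesis by (rule that[rotated])
qed

context conormal
begin

definition row :: "complex ^ 'm \<Rightarrow> 'm \<Rightarrow> complex ^ 'm" where
  "row y i = (if i \<in> S then grad (f i) y else e i)"

definition \<delta> :: "complex ^ 'm \<Rightarrow> complex" where
  "\<delta> y = Determinants.det (rows_mat (row y))"

lemma f_pfun: "i \<in> S \<Longrightarrow> f i \<in> pfun"
  using f IE(1) by blast

lemma \<delta>_pfun: "\<delta> \<in> pfun"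
proof -
  have "(\<lambda>y. vec_nth (row y i) j) \<in> pfun" for i j
    by (cases "i \<in> S") (auto simp: row_def grad_def pfun_partial f_pfun pfun_const)
  then show ?thesis
    unfolding \<delta>_def[abs_def] pfun_def by (intro pfun_det) (simp add: rows_mat_def pfun_def)
qed

lemma \<delta>_not_I: "\<delta> \<notin> I"
proof -
  obtain v where v: "v \<in> smooth_cone" "\<delta> v \<noteq> 0"
    using nondegenerate unfolding \<delta>_def row_def[abs_def] by blast
  then show ?thesis using IE(2)[of \<delta> v] smooth_cone_C[OF v(1)] by blast
qed

lemma T_eq_rows:
  assumes y: "y \<in> smooth_cone" "\<delta> y \<noteq> 0"
  shows "T y = {w. \<forall>x\<in>row y ` S. bd x w = 0}"
proof (rule vec.subspace_dim_equal[OF subspace_T subspace_annihilator])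
  have nz: "Determinants.det (rows_mat (row y)) \<noteq> 0" using y(2) by (simp add: \<delta>_def)
  let ?E = "row y ` S"
  have "vec.dim ?E = card S"
    using independent_rows[OF nz, of S] by (simp add: vec.dim_eq_card_independent card_image[OF inj_rows[OF nz]])
  then have "vec.dim {w. \<forall>x\<in>?E. bd x w = 0} = n + 1"
    using dim_annihilator[of ?E] card_S by simp
  then show "vec.dim {w. \<forall>x\<in>?E. bd x w = 0} \<le> vec.dim (T y)" unfolding dim_T[OF y(1)] by simp
  show "T y \<subseteq> {w. \<forall>x\<in>?E. bd x w = 0}" using f by (auto simp: T_def bd_grad row_def)
qed

lemma T_eq:
  assumes "y \<in> smooth_cone" "\<delta> y \<noteq> 0"
  shows "T y = {w. \<forall>i\<in>S. dif (f i) y w = 0}"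
  unfolding T_eq_rows[OF assms] by (simp add: row_def bd_grad)

lemma normal_span:
  assumes y: "y \<in> smooth_cone" "\<delta> y \<noteq> 0" and \<eta>: "\<And>w. w \<in> T y \<Longrightarrow> bd \<eta> w = 0"
  obtains \<mu> where "\<eta> = (\<Sum>i\<in>S. \<mu> i *s grad (f i) y)"
proof -
  have nz: "Determinants.det (rows_mat (row y)) \<noteq> 0" using y(2) by (simp add: \<delta>_def)
  let ?E = "row y ` S"
  have "T y = {w. \<forall>x\<in>?E. bd x w = 0}" by (rule T_eq_rows[OF y])
  then have "\<eta> \<in> vec.span ?E" by (intro double_annihilator \<eta>) auto
  then obtain c where "\<eta> = (\<Sum>x\<in>?E. c x *s x)" by (auto simp: vec.span_finite)
  then have "\<eta> = (\<Sum>i\<in>S. c (row y i) *s row y i)" by (simp add: sum.reindex[OF inj_rows[OF nz]])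
  also have "\<dots> = (\<Sum>i\<in>S. c (row y i) *s grad (f i) y)" by (rule sum.cong) (auto simp: row_def)
  finally show ?thesis by (rule that)
qed

text \<open>
  The conormal variety in the coordinates given by the basis of gradients: pairs of a point of the cone and
  coefficients, of which those with index in \<open>S\<close> matter.
\<close>
definition Y :: "((complex ^ 'm) \<times> ('m \<Rightarrow> complex)) set" where
  "Y = {z. fst z \<in> C}"

definition gen :: "'m + 'm \<Rightarrow> (complex ^ 'm) \<times> ('m \<Rightarrow> complex) \<Rightarrow> complex" where
  "gen j z = (case j of Inl i \<Rightarrow> vec_nth (fst z) i | Inr i \<Rightarrow> snd z i)"

definition J :: "('m + 'm) set" where
  "J = range Inl \<union> Inr ` S"

abbreviation R :: "((complex ^ 'm) \<times> ('m \<Rightarrow> complex) \<Rightarrow> complex) set" where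
  "R \<equiv> fun_alg (gen ` J)"

lemma finite_J: "finite J"
  by (simp add: J_def)

lemma gen_J_cases:
  assumes "b \<in> gen ` J"
  obtains (point) i where "b = (\<lambda>z. vec_nth (fst z) i)" | (coefficient) i where "i \<in> S" "b = (\<lambda>z. snd z i)"
  using assms unfolding J_def gen_def by auto

lemma R_fst: "F \<in> pfun \<Longrightarrow> (\<lambda>z. F (fst z)) \<in> R"
  unfolding pfun_def
proof (erule fun_alg_subst)
  fix b :: "complex ^ 'm \<Rightarrow> complex" assume "b \<in> range (\<lambda>i y. vec_nth y i)"
  then obtain i where "b = (\<lambda>y. vec_nth y i)" by auto
  then have "(\<lambda>z. b (fst z)) = gen (Inl i)" by (simp add: gen_def fun_eq_iff)
  then show "(\<lambda>z. b (fst z)) \<in> R" by (simp add: J_def fun_alg_base)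
qed

lemma R_snd: "i \<in> S \<Longrightarrow> (\<lambda>z. snd z i) \<in> R"
proof -
  assume "i \<in> S"
  moreover have "(\<lambda>z. snd z i) = gen (Inr i)" by (simp add: gen_def fun_eq_iff)
  ultimately show ?thesis by (simp add: J_def fun_alg_base)
qed

lemma R_at: "F \<in> R \<Longrightarrow> (\<lambda>y. F (y, \<mu>)) \<in> pfun"
  unfolding pfun_def
  by (erule fun_alg_subst, erule gen_J_cases) (auto intro: fun_alg_base fun_alg_const)

lemma R_fibre: "F \<in> R \<Longrightarrow> (\<lambda>\<mu>. F (y, \<mu>)) \<in> polys S"
  unfolding polys_def
  by (erule fun_alg_subst, erule gen_J_cases) (auto intro: fun_alg_base fun_alg_const)

lemma R_not_vanishing:
  assumes "F \<in> R" "\<exists>z\<in>Y. F z \<noteq> 0"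
  obtains \<mu> where "(\<lambda>y. F (y, \<mu>)) \<in> pfun" "(\<lambda>y. F (y, \<mu>)) \<notin> I"
  using assms R_at[OF assms(1)] unfolding Y_def I_def by fastforce

text \<open>
  The coefficients are first fixed, which leaves two functions outside \<open>I\<close> and a point where both are
  nonzero. Over this point, the fibre is a vector space, and on the line joining the two choices of
  coefficients a product of nonzero polynomials is nonzero.
\<close>
lemma prime_Y: "prime_on R Y"
  unfolding prime_on_def
proof (intro conjI ballI impI)
  show "Y \<noteq> {}" using prime_C unfolding prime_on_def Y_def by auto
  fix F G assume F: "F \<in> R" "\<exists>z\<in>Y. F z \<noteq> 0" and G: "G \<in> R" "\<exists>z\<in>Y. G z \<noteq> 0"
  obtain \<mu> where \<mu>: "(\<lambda>y. F (y, \<mu>)) \<in> pfun" "(\<lambda>y. F (y, \<mu>)) \<notin> I" by (rule R_not_vanishing[OF F])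
  obtain \<nu> where \<nu>: "(\<lambda>y. G (y, \<nu>)) \<in> pfun" "(\<lambda>y. G (y, \<nu>)) \<notin> I" by (rule R_not_vanishing[OF G])
  obtain y where y: "y \<in> smooth_cone" "F (y, \<mu>) * G (y, \<nu>) \<noteq> 0"
    using smooth_cone_ex[OF pfun_mult[OF \<mu>(1) \<nu>(1)] mult_not_I[OF \<mu>(1) \<nu>(1) \<mu>(2) \<nu>(2)]] by auto
  let ?\<gamma> = "\<lambda>t i. \<mu> i + t * (\<nu> i - \<mu> i)"
  have along: "poly_along (\<lambda>t. H (y, ?\<gamma> t))" if "H \<in> R" for H
  proof (rule poly_along_fun_alg[OF R_fibre[OF that, of y, unfolded polys_def]])
    fix b :: "('m \<Rightarrow> complex) \<Rightarrow> complex" assume "b \<in> (\<lambda>i x. x i) ` S"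
    then obtain i where "b = (\<lambda>x. x i)" by auto
    then have "(\<lambda>t. b (?\<gamma> t)) = poly [:\<mu> i, \<nu> i - \<mu> i:]" by (auto simp: fun_eq_iff)
    then show "poly_along (\<lambda>t. b (?\<gamma> t))" unfolding poly_along_def by blast
  qed
  have "\<exists>t. F (y, ?\<gamma> t) \<noteq> 0 \<and> G (y, ?\<gamma> t) \<noteq> 0"
  proof (rule ccontr)
    assume "\<not> ?thesis"
    then have "(\<forall>t. F (y, ?\<gamma> t) = 0) \<or> (\<forall>t. G (y, ?\<gamma> t) = 0)"
      by (intro poly_along_product_zero along F G) auto
    then have "F (y, ?\<gamma> 0) = 0 \<or> G (y, ?\<gamma> 1) = 0" by blast
    then show False using y(2) by simp
  qed
  then obtain t where "F (y, ?\<gamma> t) \<noteq> 0" "G (y, ?\<gamma> t) \<noteq> 0" by auto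
  moreover have "(y, ?\<gamma> t) \<in> Y" using smooth_cone_C[OF y(1)] by (simp add: Y_def)
  ultimately show "\<exists>z\<in>Y. F z \<noteq> 0 \<and> G z \<noteq> 0" by blast
qed

lemma tangent_vector_point:
  assumes "y \<in> C" "w \<in> T y"
  shows "tangent_vector R Y (y, \<mu>) (\<lambda>F. dif (\<lambda>y. F (y, \<mu>)) y w)"
proof -
  have "dif (\<lambda>y. F (y, \<mu>)) y w = 0" if "F \<in> R" "\<forall>z\<in>Y. F z = 0" for F
    by (rule I_deriv[OF _ assms]) (use that R_at[OF that(1)] in \<open>auto simp: I_def Y_def\<close>)
  then show ?thesis
    unfolding tangent_vector_def point_derivation_def by (auto simp: dif_add dif_mult R_at)
qed

lemma tangent_vector_coefficient:
  assumes "y \<in> C"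
  shows "tangent_vector R Y (y, \<mu>) (\<lambda>F. pd i (\<lambda>\<mu>. F (y, \<mu>)) \<mu>)"
proof -
  have "pd i (\<lambda>\<mu>. F (y, \<mu>)) \<mu> = 0" if "\<forall>z\<in>Y. F z = 0" for F
  proof -
    have "(\<lambda>\<mu>. F (y, \<mu>)) = (\<lambda>_. 0)" using that assms by (auto simp: Y_def)
    then show ?thesis by simp
  qed
  then show ?thesis
    unfolding tangent_vector_def point_derivation_def by (auto simp: pd_add[OF R_fibre R_fibre] pd_mult[OF R_fibre R_fibre])
qed

lemma trdeg_C: "transcendence_degree C = n + 1"
  using dim_X unfolding proj_dim_def by simp

text \<open>A transcendence basis of the cone together with the coefficients bounds the transcendence degree.\<close>
lemma transcendence_bound_Y:
  assumes h: "\<And>i. i < d \<Longrightarrow> h i \<in> R" and ind: "alg_indep Y d h"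
  shows "d \<le> n + 1 + card S"
proof -
  obtain u where u: "\<And>i. u i \<in> pfun" "alg_indep C (n + 1) u"
    using transcendence_degree_attained[of C] trdeg_C by auto
  have "\<not> alg_indep C (Suc (n + 1)) (u(n + 1 := (\<lambda>y. vec_nth y j)))" for j
  proof
    assume *: "alg_indep C (Suc (n + 1)) (u(n + 1 := (\<lambda>y. vec_nth y j)))"
    have "Suc (n + 1) \<le> transcendence_degree C"
      by (rule transcendence_degree_ge[OF _ *]) (use u(1) in \<open>auto simp: pfun_coord\<close>)
    then show False using trdeg_C by simp
  qed
  from algebraic_relation[OF u(2) this]
  have "\<forall>j. \<exists>e a. (\<forall>i\<le>e. a i \<in> polys {..<n + 1}) \<and> (\<exists>y\<in>C. a e (\<lambda>i. u i y) \<noteq> 0) \<and>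
    (\<forall>y\<in>C. (\<Sum>i\<le>e. a i (\<lambda>i. u i y) * vec_nth y j ^ i) = 0)" ..
  from choice[OF this] obtain e where
    "\<forall>j. \<exists>a. (\<forall>i\<le>e j. a i \<in> polys {..<n + 1}) \<and> (\<exists>y\<in>C. a (e j) (\<lambda>i. u i y) \<noteq> 0) \<and>
    (\<forall>y\<in>C. (\<Sum>i\<le>e j. a i (\<lambda>i. u i y) * vec_nth y j ^ i) = 0)" ..
  from choice[OF this] obtain a where a:
    "\<forall>j. (\<forall>i\<le>e j. a j i \<in> polys {..<n + 1}) \<and> (\<exists>y\<in>C. a j (e j) (\<lambda>i. u i y) \<noteq> 0) \<and>
    (\<forall>y\<in>C. (\<Sum>i\<le>e j. a j i (\<lambda>i. u i y) * vec_nth y j ^ i) = 0)" ..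
  have rel: "i \<le> e j \<Longrightarrow> a j i \<in> polys {..<n + 1}" "\<exists>y\<in>C. a j (e j) (\<lambda>i. u i y) \<noteq> 0"
    "y \<in> C \<Longrightarrow> (\<Sum>i\<le>e j. a j i (\<lambda>i. u i y) * vec_nth y j ^ i) = 0" for i j y
    using spec[OF a, of j] by simp_all
  obtain \<sigma> where \<sigma>: "bij_betw \<sigma> S {..<card S}"
    using ex_bij_betw_finite_nat[of S] by (auto simp: atLeast0LessThan)
  define \<rho> where "\<rho> = inv_into S \<sigma>"
  have \<rho>\<sigma>: "\<rho> (\<sigma> i) = i" "\<sigma> i < card S" if "i \<in> S" for i
    using \<sigma> that unfolding \<rho>_def by (auto simp: bij_betw_def)
  have \<rho>S: "\<rho> k \<in> S" if "k < card S" for k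
    using \<sigma> that unfolding \<rho>_def by (auto simp: bij_betw_def intro: inv_into_into)
  define u' where "u' i z = (if i < n + 1 then u i (fst z) else snd z (\<rho> (i - (n + 1))))"
    for i and z :: "(complex ^ 'm) \<times> ('m \<Rightarrow> complex)"
  define e' where "e' j = (case j of Inl i \<Rightarrow> e i | Inr _ \<Rightarrow> 1)" for j :: "'m + 'm"
  define a' where "a' j k = (case j of Inl i \<Rightarrow> a i k
      | Inr i \<Rightarrow> (if k = 0 then (\<lambda>x. - x (n + 1 + \<sigma> i)) else (\<lambda>_. 1)))" for j :: "'m + 'm" and k
  have a_u': "a j i (\<lambda>i. u' i z) = a j i (\<lambda>i. u i (fst z))" if "i \<le> e j" for j i z
    by (rule polys_cong[OF rel(1)[OF that]]) (simp add: u'_def)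
  interpret algebraic_generators Y J gen "n + 1 + card S" u' e' a'
  proof
    show "prime_on R Y" by (rule prime_Y)
    show "finite J" by (rule finite_J)
    show "u' i \<in> R" if "i < n + 1 + card S" for i
    proof (cases "i < n + 1")
      case True
      then show ?thesis using R_fst[OF u(1)[of i]] by (simp add: u'_def[abs_def])
    next
      case False
      then show ?thesis using R_snd[OF \<rho>S[of "i - (n + 1)"]] that by (simp add: u'_def[abs_def])
    qed
    show "a' j i \<in> polys {..<n + 1 + card S}" if j: "j \<in> J" and i: "i \<le> e' j" for j i
    proof (cases j)
      case (Inl k)
      then show ?thesis using polys_mono[OF rel(1)[of i k], of "{..<n + 1 + card S}"] i
        by (auto simp: a'_def e'_def)
    next
      case (Inr k)
      then have k: "\<sigma> k < card S" using j \<rho>\<sigma>(2) by (auto simp: J_def)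
      have "(\<lambda>x. - x (n + 1 + \<sigma> k)) \<in> polys {..<n + 1 + card S}"
        using polys_coord[of "n + 1 + \<sigma> k" "{..<n + 1 + card S}"] k unfolding polys_def
        by (auto intro: fun_alg_uminus)
      then show ?thesis by (simp add: a'_def Inr polys_def fun_alg_const)
    qed
    show "\<exists>y\<in>Y. a' j (e' j) (\<lambda>i. u' i y) \<noteq> 0" if j: "j \<in> J" for j
    proof (cases j)
      case (Inl k)
      obtain y where "y \<in> C" "a k (e k) (\<lambda>i. u i y) \<noteq> 0" using rel(2) by blast
      then show ?thesis
        using a_u'[of "e k" k "(y, \<lambda>_. 0)"]
        by (intro bexI[of _ "(y, \<lambda>_. 0)"]) (auto simp: a'_def e'_def Inl Y_def)
    next
      case (Inr k)
      obtain z where "z \<in> Y" using prime_Y unfolding prime_on_def by blast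
      then show ?thesis by (intro bexI[of _ z]) (auto simp: a'_def e'_def Inr)
    qed
    show "(\<Sum>i\<le>e' j. a' j i (\<lambda>i. u' i y) * gen j y ^ i) = 0" if j: "j \<in> J" and y: "y \<in> Y" for j y
    proof (cases j)
      case (Inl k)
      have "(\<Sum>i\<le>e k. a k i (\<lambda>i. u' i y) * vec_nth (fst y) k ^ i)
          = (\<Sum>i\<le>e k. a k i (\<lambda>i. u i (fst y)) * vec_nth (fst y) k ^ i)"
        by (rule sum.cong) (auto simp: a_u')
      then show ?thesis using rel(3)[of "fst y" k] y by (simp add: a'_def e'_def Inl gen_def Y_def)
    next
      case (Inr k)
      then have "k \<in> S" using j by (auto simp: J_def)
      then show ?thesis by (simp add: a'_def e'_def Inr gen_def u'_def \<rho>\<sigma>)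
    qed
  qed
  show ?thesis by (rule alg_indep_bound[OF h ind])
qed

end

section \<open>The dual variety\<close>

definition tangent_hyperplanes :: "'m::finite proj set \<Rightarrow> 'm proj set" where
  "tangent_hyperplanes X = {\<xi>. \<exists>p\<in>smooth_points X. tangent_subspace X p \<subseteq> hyperplane \<xi>}"

lemma dual_variety_eq: "dual_variety X = zariski_closure (tangent_hyperplanes X)"
  by (simp add: dual_variety_def tangent_hyperplanes_def)

context dense_smooth_variety
begin

lemma tangent_subspace_hyperplane_iff:
  assumes "y \<noteq> 0" "\<eta> \<noteq> 0"
  shows "tangent_subspace X (point y) \<subseteq> hyperplane (point \<eta>) \<longleftrightarrow> (\<forall>w\<in>T y. bd \<eta> w = 0)"
proof
  assume L: "tangent_subspace X (point y) \<subseteq> hyperplane (point \<eta>)"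
  show "\<forall>w\<in>T y. bd \<eta> w = 0"
  proof
    fix w assume w: "w \<in> T y"
    show "bd \<eta> w = 0"
    proof (cases "w = 0")
      case False
      have "line_of (point w) \<subseteq> T y"
        using w False subspace_T[of y] by (auto simp: in_line_of vec.subspace_scale)
      then have "point w \<in> hyperplane (point \<eta>)"
        using L by (auto simp: tangent_subspace_def affine_tangent_point[OF assms(1)] proj_subspace_def)
      then show ?thesis
        using mem_line_point[OF assms(2)] mem_line_point[OF False] by (simp add: hyperplane_def bd_def)
    qed simp
  qed
next
  assume R: "\<forall>w\<in>T y. bd \<eta> w = 0"
  show "tangent_subspace X (point y) \<subseteq> hyperplane (point \<eta>)"
  proof
    fix q assume "q \<in> tangent_subspace X (point y)"
    then have q: "line_of q \<subseteq> T y"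
      by (simp add: tangent_subspace_def affine_tangent_point[OF assms(1)] proj_subspace_def)
    have "bd u v = 0" if u: "u \<in> line_of (point \<eta>)" and v: "v \<in> line_of q" for u v
    proof -
      obtain c where "u = c *s \<eta>" using u assms(2) by (auto simp: in_line_of)
      then show ?thesis using R q v by (auto simp: bd_scale_left)
    qed
    then show "q \<in> hyperplane (point \<eta>)" by (simp add: hyperplane_def bd_def)
  qed
qed

lemma cone_tangent_hyperplanes:
  assumes "\<eta> \<in> cone (tangent_hyperplanes X)"
  shows "\<exists>y\<in>smooth_cone. \<forall>w\<in>T y. bd \<eta> w = 0"
proof -
  obtain \<xi> where \<xi>: "\<xi> \<in> tangent_hyperplanes X" "\<eta> \<in> line_of \<xi>" using assms by (auto simp: cone_def)
  obtain \<theta> where \<theta>: "\<theta> \<noteq> 0" "\<xi> = point \<theta>" by (rule point_cases)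
  obtain p where p: "p \<in> smooth_points X" "tangent_subspace X p \<subseteq> hyperplane \<xi>"
    using \<xi>(1) by (auto simp: tangent_hyperplanes_def)
  obtain y where y: "y \<noteq> 0" "p = point y" by (rule point_cases)
  have "\<forall>w\<in>T y. bd \<theta> w = 0" using p(2) tangent_subspace_hyperplane_iff[OF y(1) \<theta>(1)] y(2) \<theta>(2) by simp
  moreover obtain c where "\<eta> = c *s \<theta>" using \<xi>(2) \<theta> by (auto simp: in_line_of)
  moreover have "y \<in> smooth_cone" using y p(1) by (simp add: smooth_cone_def)
  ultimately show ?thesis by (auto simp: bd_scale_left)
qed

lemma tangent_covector_in_dual:
  assumes "y \<in> smooth_cone" "\<And>w. w \<in> T y \<Longrightarrow> bd \<eta> w = 0" "\<eta> \<noteq> 0"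
  shows "\<eta> \<in> cone (dual_variety X)"
proof -
  have "tangent_subspace X (point y) \<subseteq> hyperplane (point \<eta>)"
    using tangent_subspace_hyperplane_iff[OF smooth_cone_nonzero[OF assms(1)] assms(3)] assms(2) by blast
  then have "point \<eta> \<in> tangent_hyperplanes X"
    using assms(1) by (auto simp: tangent_hyperplanes_def smooth_cone_def)
  then show ?thesis
    unfolding mem_cone[OF assms(3)] dual_variety_eq using subset_zariski_closure by blast
qed

end

section \<open>The rank of the conormal map\<close>

lemma sum_lessThan_add: "(\<Sum>t<a + b. F t) = (\<Sum>t<a. F t) + (\<Sum>t<b. F (a + t :: nat) :: complex)"
  by (induction b) (auto simp: add.assoc)

context conormal
begin

definition conormal_map :: "(complex ^ 'm) \<times> ('m \<Rightarrow> complex) \<Rightarrow> complex ^ 'm" where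
  "conormal_map z = (\<Sum>i\<in>S. snd z i *s grad (f i) (fst z))"

definition hess_covector :: "('m \<Rightarrow> complex) \<Rightarrow> complex ^ 'm \<Rightarrow> complex ^ 'm \<Rightarrow> complex ^ 'm" where
  "hess_covector \<mu> y w = (\<chi> j. \<Sum>i\<in>S. \<mu> i * dif (partial j (f i)) y w)"

definition hess_form :: "('m \<Rightarrow> complex) \<Rightarrow> complex ^ 'm \<Rightarrow> complex ^ 'm \<Rightarrow> complex ^ 'm \<Rightarrow> complex" where
  "hess_form \<mu> y w u = (\<Sum>i\<in>S. \<mu> i * hess (f i) y w u)"

text \<open>
  Where \<open>\<delta>\<close> is nonzero, this is the orthogonal complement of the image of the differential of the
  conormal map: orthogonality to the
  gradients means tangency, and derivatives with respect to the point give the Hessian form.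
\<close>
definition radical :: "('m \<Rightarrow> complex) \<Rightarrow> complex ^ 'm \<Rightarrow> (complex ^ 'm) set" where
  "radical \<mu> y = {u \<in> T y. \<forall>w\<in>T y. hess_form \<mu> y w u = 0}"

lemma conormal_map_nth: "vec_nth (conormal_map z) j = (\<Sum>i\<in>S. snd z i * partial j (f i) (fst z))"
  by (simp add: conormal_map_def grad_def)

lemma conormal_map_R: "(\<lambda>z. vec_nth (conormal_map z) j) \<in> R"
  unfolding conormal_map_nth by (intro fun_alg_sum fun_alg_mult R_snd R_fst pfun_partial f_pfun)

lemma bd_hess_covector: "bd (hess_covector \<mu> y w) u = hess_form \<mu> y w u"
  unfolding bd_def hess_covector_def hess_form_def hess_def vec_lambda_beta sum_distrib_left sum_distrib_right
  by (subst sum.swap) (simp add: mult_ac)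

lemma conormal_map_deriv_point: "dif (\<lambda>y. vec_nth (conormal_map (y, \<mu>)) j) y w = vec_nth (hess_covector \<mu> y w) j"
  unfolding conormal_map_nth hess_covector_def
  by (simp add: dif_sum dif_mult pfun_mult pfun_const pfun_partial f_pfun)

lemma conormal_map_deriv_coefficient:
  assumes "k \<in> S"
  shows "pd k (\<lambda>\<mu>. vec_nth (conormal_map (y, \<mu>)) j) \<mu> = vec_nth (grad (f k) y) j"
proof -
  have "((\<lambda>t. \<Sum>i\<in>S. (\<mu>(k := t)) i * partial j (f i) y) has_field_derivative
      (\<Sum>i\<in>S. if i = k then partial j (f k) y else 0)) (at (\<mu> k))"
  proof (rule DERIV_sum)
    fix i
    show "((\<lambda>t. (\<mu>(k := t)) i * partial j (f i) y) has_field_derivative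
        (if i = k then partial j (f k) y else 0)) (at (\<mu> k))"
      by (cases "i = k") (auto intro!: derivative_eq_intros)
  qed
  then show ?thesis
    unfolding pd_def conormal_map_nth using assms by (simp add: DERIV_imp_deriv grad_def)
qed

lemma conormal_map_normal: "w \<in> T y \<Longrightarrow> bd (conormal_map (y, \<mu>)) w = 0"
  using f by (simp add: conormal_map_def bd_sum_left bd_scale_left bd_grad T_def)

lemma dual_nonempty:
  assumes v: "v \<in> smooth_cone" "\<delta> v \<noteq> 0" and S: "S \<noteq> {}"
  shows "dual_variety X \<noteq> {}"
proof -
  obtain i where i: "i \<in> S" using S by auto
  have nz: "Determinants.det (rows_mat (row v)) \<noteq> 0" using v(2) by (simp add: \<delta>_def)
  obtain a where "dual_bases (row v) a" using dual_bases_of_det[OF nz] .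
  then have "bd (row v i) (a i) = 1" unfolding dual_bases_def by simp
  then have "grad (f i) v \<noteq> 0" using i by (auto simp: row_def)
  moreover have "bd (grad (f i) v) w = 0" if "w \<in> T v" for w
    using f[OF i] that by (simp add: bd_grad T_def)
  ultimately have "grad (f i) v \<in> cone (dual_variety X)" by (intro tangent_covector_in_dual[OF v(1)])
  then show ?thesis by (auto simp: cone_def)
qed

text \<open>
  The derivatives of the conormal map along tangent fields and along the coefficients are polynomial, so \<open>k\<close>
  of them that are independent at \<open>(v, \<mu>)\<close> stay independent generically. The coordinates dual to
  these \<open>k\<close> vectors are functions on the dual variety with independent pullbacks.
\<close>
theorem dual_transcendence_lower_bound:
  assumes v: "v \<in> smooth_cone" "\<delta> v \<noteq> 0" and k: "vec.dim (radical \<mu> v) + k \<le> CARD('m)" "0 < k"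
  shows "k \<le> transcendence_degree (cone (dual_variety X))"
proof -
  let ?z = "(v, \<mu>)"
  have vC: "v \<in> C" by (rule smooth_cone_C[OF v(1)])
  \<comment> \<open>Polynomial fields of vectors in the image of the differential of the conormal map.\<close>
  define \<E> where "\<E> = {E. (\<forall>j. (\<lambda>z. vec_nth (E z) j) \<in> R) \<and>
    (\<forall>z\<in>Y. \<exists>\<tau>. tangent_vector R Y z \<tau> \<and> (\<forall>j. \<tau> (\<lambda>z. vec_nth (conormal_map z) j) = vec_nth (E z) j))}"
  have grad_\<E>: "(\<lambda>z. grad (f i) (fst z)) \<in> \<E>" if i: "i \<in> S" for i
  proof -
    have "\<exists>\<tau>. tangent_vector R Y z \<tau> \<and> (\<forall>j. \<tau> (\<lambda>z. vec_nth (conormal_map z) j) = vec_nth (grad (f i) (fst z)) j)"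
      if "z \<in> Y" for z
    proof -
      obtain y \<nu> where z: "z = (y, \<nu>)" by (cases z)
      have "y \<in> C" using that z by (simp add: Y_def)
      from tangent_vector_coefficient[OF this, of \<nu> i] show ?thesis
        using conormal_map_deriv_coefficient[OF i] unfolding z by auto
    qed
    moreover have "(\<lambda>z. vec_nth (grad (f i) (fst z)) j) \<in> R" for j
      unfolding grad_def vec_lambda_beta by (intro R_fst pfun_partial f_pfun i)
    ultimately show ?thesis unfolding \<E>_def by blast
  qed
  have hess_covector_\<E>: "(\<lambda>z. hess_covector (snd z) (fst z) (s (fst z))) \<in> \<E>" if s: "s \<in> tfields" for s
  proof -
    have "\<exists>\<tau>. tangent_vector R Y z \<tau> \<and>
        (\<forall>j. \<tau> (\<lambda>z. vec_nth (conormal_map z) j) = vec_nth (hess_covector (snd z) (fst z) (s (fst z))) j)" if "z \<in> Y" for z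
    proof -
      obtain y \<nu> where z: "z = (y, \<nu>)" by (cases z)
      have "y \<in> C" using that z by (simp add: Y_def)
      from tangent_vector_point[OF this tfields_T[OF s this], of \<nu>] show ?thesis
        using conormal_map_deriv_point unfolding z by auto
    qed
    moreover have "(\<lambda>z. vec_nth (hess_covector (snd z) (fst z) (s (fst z))) j) \<in> R" for j
      unfolding hess_covector_def vec_lambda_beta
      by (intro fun_alg_sum fun_alg_mult R_snd R_fst[where F = "\<lambda>y. dif (partial j (f _)) y (s y)"]
          pfun_dif pfun_partial f_pfun pmap_coord tfields_pmap s)
    ultimately show ?thesis unfolding \<E>_def by blast
  qed
  let ?E0 = "(\<lambda>E. E ?z) ` \<E>"
  have "{u. \<forall>x\<in>?E0. bd x u = 0} \<subseteq> radical \<mu> v"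
  proof
    fix u assume u: "u \<in> {u. \<forall>x\<in>?E0. bd x u = 0}"
    have "dif (f i) v u = 0" if "i \<in> S" for i
      using u grad_\<E>[OF that] by (force simp: bd_grad)
    then have "u \<in> T v" unfolding T_eq[OF v] by simp
    moreover have "hess_form \<mu> v w u = 0" if w: "w \<in> T v" for w
    proof -
      obtain s where s: "s \<in> tfields" "s v = w" by (rule tangent_section_through[OF v(1) w])
      show ?thesis using u hess_covector_\<E>[OF s(1)] s(2) by (force simp: bd_hess_covector)
    qed
    ultimately show "u \<in> radical \<mu> v" by (simp add: radical_def)
  qed
  then have "vec.dim {u. \<forall>x\<in>?E0. bd x u = 0} \<le> vec.dim (radical \<mu> v)" by (rule vec.dim_subset)
  then have dimE: "k \<le> vec.dim ?E0" using dim_annihilator[of ?E0] k(1) by simp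
  obtain B0 where B0: "B0 \<subseteq> ?E0" "vec.independent B0" "?E0 \<subseteq> vec.span B0" "card B0 = vec.dim ?E0"
    by (rule vec.basis_exists[of ?E0])
  obtain B1 where B1: "B1 \<subseteq> B0" "card B1 = k"
    using obtain_subset_with_card_n[of k B0] dimE B0(4) by auto
  obtain b S1 where b: "b ` S1 = B1" "inj b" "card S1 = card B1" "Determinants.det (rows_mat b) \<noteq> 0"
    using extend_to_basis[OF vec.independent_mono[OF B0(2) B1(1)]] .
  obtain a where a: "dual_bases b a" using dual_bases_of_det[OF b(4)] .
  have "\<exists>E. E \<in> \<E> \<and> E ?z = b i" if "i \<in> S1" for i
  proof -
    have "b i \<in> ?E0" using that b(1) B1(1) B0(1) by auto
    then show ?thesis by auto
  qed
  then obtain E where E: "\<And>i. i \<in> S1 \<Longrightarrow> E i \<in> \<E>" "\<And>i. i \<in> S1 \<Longrightarrow> E i ?z = b i" by metis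
  define rw where "rw z i = (if i \<in> S1 then E i z else b i)" for z i
  define Q where "Q z = Determinants.det (rows_mat (rw z))" for z
  have "(\<lambda>z. vec_nth (rw z i) j) \<in> R" for i j
    using E(1)[of i] by (cases "i \<in> S1") (auto simp: rw_def \<E>_def fun_alg_const)
  then have Q: "Q \<in> R"
    unfolding Q_def[abs_def] by (intro pfun_det) (simp add: rows_mat_def)
  have rw_z: "rw ?z = b" using E(2) by (auto simp: rw_def fun_eq_iff)
  have Qz: "Q ?z \<noteq> 0" unfolding Q_def rw_z by (rule b(4))
  obtain \<sigma> where \<sigma>: "bij_betw \<sigma> {..<k} S1"
    using ex_bij_betw_nat_finite[of S1] b(3) B1(2) by (auto simp: atLeast0LessThan)
  define g where "g i \<eta> = bd (a (\<sigma> i)) \<eta>" for i :: nat and \<eta>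
  have g: "g i \<in> pfun" for i
    unfolding g_def[abs_def] bd_def by (intro pfun_sum pfun_mult pfun_const pfun_coord)
  define h where "h i z = g i (conormal_map z)" for i :: nat and z
  have h: "h i \<in> R" for i
    unfolding h_def[abs_def] g_def bd_def by (intro fun_alg_sum fun_alg_mult fun_alg_const conormal_map_R)
  have "alg_indep Y k h"
  proof (rule alg_indep_of_differentials[OF prime_Y h Q _ Qz])
    show "?z \<in> Y" using vC by (simp add: Y_def)
    fix z c
    assume z: "z \<in> Y" "Q z \<noteq> 0" and c: "\<And>\<tau>. tangent_vector R Y z \<tau> \<Longrightarrow> (\<Sum>i<k. c i * \<tau> (h i)) = 0"
    define x where "x = (\<Sum>i<k. c i *s a (\<sigma> i))"
    have bx: "bd y x = (\<Sum>i<k. c i * bd y (a (\<sigma> i)))" for y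
      by (simp add: x_def bd_sum_right bd_scale_right)
    have "bd (rw z j) x = 0" for j
    proof (cases "j \<in> S1")
      case True
      then obtain \<tau> where \<tau>: "tangent_vector R Y z \<tau>"
        "\<And>l. \<tau> (\<lambda>z. vec_nth (conormal_map z) l) = vec_nth (E j z) l"
        using E(1)[OF True] z(1) unfolding \<E>_def by blast
      have "\<tau> (h i) = bd (E j z) (a (\<sigma> i))" for i
      proof -
        have "\<tau> (h i) = (\<Sum>l\<in>UNIV. vec_nth (a (\<sigma> i)) l * \<tau> (\<lambda>z. vec_nth (conormal_map z) l))"
          unfolding h_def[abs_def] g_def bd_def
          using \<tau>(1) conormal_map_R
          by (intro point_derivation_linear[of "gen ` J" z \<tau> UNIV "\<lambda>l z. vec_nth (conormal_map z) l"])
            (auto simp: tangent_vector_def)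
        then show ?thesis by (simp add: \<tau>(2) bd_def mult.commute)
      qed
      then show ?thesis using c[OF \<tau>(1)] True by (simp add: bx rw_def)
    next
      case False
      have "bd (b j) (a (\<sigma> i)) = 0" if "i < k" for i
        using a False \<sigma> that unfolding dual_bases_def by (auto simp: bij_betw_def)
      then show ?thesis using False by (simp add: bx rw_def)
    qed
    then have x: "x = 0" using det_rows_mat_nz_imp_zero[of "rw z" x] z(2) by (simp add: Q_def)
    show "\<forall>i<k. c i = 0"
    proof (intro allI impI)
      fix i assume i: "i < k"
      have "bd (b (\<sigma> i)) x = (\<Sum>l<k. if l = i then c i else 0)"
        unfolding bx
      proof (rule sum.cong)
        fix l assume "l \<in> {..<k}"
        then have "\<sigma> i = \<sigma> l \<longleftrightarrow> l = i" using \<sigma> i by (auto simp: bij_betw_def inj_on_def)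
        then show "c l * bd (b (\<sigma> i)) (a (\<sigma> l)) = (if l = i then c i else 0)"
          using a unfolding dual_bases_def by simp
      qed simp
      then show "c i = 0" using x i by simp
    qed
  qed
  moreover have "S \<noteq> {}"
  proof
    assume S: "S = {}"
    have "hess_form \<mu> v w u = 0" for w u unfolding hess_form_def using S by simp
    then have "radical \<mu> v = T v" by (simp add: radical_def)
    moreover have "n + 1 = CARD('m)" using card_S S by simp
    ultimately show False using k dim_T[OF v(1)] by simp
  qed
  note nonempty = dual_nonempty[OF v this]
  have "alg_indep (cone (dual_variety X)) k g"
    unfolding alg_indep_def
  proof (intro ballI impI)
    fix \<phi> :: "(nat \<Rightarrow> complex) \<Rightarrow> complex"
    assume \<phi>: "\<phi> \<in> polys {..<k}" "\<forall>\<eta>\<in>cone (dual_variety X). \<phi> (\<lambda>i. g i \<eta>) = 0"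
    have "\<phi> (\<lambda>i. h i z) = 0" if "z \<in> Y" for z
    proof -
      obtain y \<nu> where z: "z = (y, \<nu>)" by (cases z)
      have "(\<lambda>z. \<phi> (\<lambda>i. h i z)) \<in> R" by (rule polys_subst[OF \<phi>(1) h])
      from R_at[OF this, of \<nu>] have "(\<lambda>y. \<phi> (\<lambda>i. h i (y, \<nu>))) \<in> I"
      proof (rule density)
        fix y assume y: "y \<in> smooth_cone"
        have "conormal_map (y, \<nu>) \<in> cone (dual_variety X)"
          using tangent_covector_in_dual[OF y conormal_map_normal[where \<mu> = \<nu>]] zero_in_cone[OF nonempty]
          by (cases "conormal_map (y, \<nu>) = 0") auto
        then show "\<phi> (\<lambda>i. h i (y, \<nu>)) = 0" using \<phi>(2) by (simp add: h_def)
      qed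
      then show ?thesis using IE(2)[of "\<lambda>y. \<phi> (\<lambda>i. h i (y, \<nu>))" y] that z by (simp add: Y_def)
    qed
    then show "\<forall>x. \<phi> x = 0" using \<open>alg_indep Y k h\<close> \<phi>(1) unfolding alg_indep_def by blast
  qed
  then show ?thesis by (rule transcendence_degree_ge[OF g])
qed

text \<open>
  The conormal map reaches the hyperplanes tangent at points with \<open>\<delta> \<noteq> 0\<close> only. Any other tangent hyperplane
  is the value of a polynomial field of conormal vectors, which takes values in the image generically.
\<close>
lemma vanishing_on_dual:
  assumes F: "F \<in> pfun" and zero: "\<And>z. z \<in> Y \<Longrightarrow> F (conormal_map z) = 0" and \<eta>: "\<eta> \<in> cone (dual_variety X)"
  shows "F \<eta> = 0"
proof (rule vanishing_on_closure[OF F])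
  show "\<eta> \<in> cone (zariski_closure (tangent_hyperplanes X))" using \<eta> by (simp add: dual_variety_eq)
next
  fix \<eta> assume "\<eta> \<in> cone (tangent_hyperplanes X)"
  then obtain y where y: "y \<in> smooth_cone" "\<forall>w\<in>T y. bd \<eta> w = 0" using cone_tangent_hyperplanes by blast
  \<comment> \<open>The values at \<open>y\<close> of polynomial conormal fields form a subspace that contains the gradients.\<close>
  define N where "N = {M. pmap M \<and> (\<forall>y\<in>C. \<forall>w\<in>T y. bd (M y) w = 0)}"
  have "vec.span ((\<lambda>F. grad F y) ` I) \<subseteq> (\<lambda>M. M y) ` N"
  proof (rule vec.span_minimal)
    show "(\<lambda>F. grad F y) ` I \<subseteq> (\<lambda>M. M y) ` N"
      using pmap_grad IE(1) by (fastforce simp: N_def bd_grad T_def)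
    show "vec.subspace ((\<lambda>M. M y) ` N)"
    proof (rule vec.subspaceI)
      show "0 \<in> (\<lambda>M. M y) ` N" by (rule image_eqI[of _ _ "\<lambda>_. 0"]) (auto simp: N_def pmap_const)
    next
      fix p q assume "p \<in> (\<lambda>M. M y) ` N" "q \<in> (\<lambda>M. M y) ` N"
      then obtain M M' where "M \<in> N" "M' \<in> N" "p = M y" "q = M' y" by auto
      then show "p + q \<in> (\<lambda>M. M y) ` N"
        by (intro image_eqI[of _ _ "\<lambda>y. M y + M' y"]) (auto simp: N_def pmap_def pfun_add bd_add_left)
    next
      fix c p assume "p \<in> (\<lambda>M. M y) ` N"
      then obtain M where "M \<in> N" "p = M y" by auto
      then show "c *s p \<in> (\<lambda>M. M y) ` N"
        by (intro image_eqI[of _ _ "\<lambda>y. c *s M y"]) (auto simp: N_def pmap_def pfun_mult pfun_const bd_scale_left)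
    qed
  qed
  moreover have "\<eta> \<in> vec.span ((\<lambda>F. grad F y) ` I)"
  proof (rule double_annihilator)
    fix w assume "\<And>x. x \<in> (\<lambda>F. grad F y) ` I \<Longrightarrow> bd x w = 0"
    from this[OF imageI] have "w \<in> T y" by (simp add: T_def bd_grad)
    then show "bd \<eta> w = 0" using y(2) by simp
  qed
  ultimately obtain M where M: "M \<in> N" "M y = \<eta>" by auto
  have Mp: "pmap M" using M by (simp add: N_def)
  have FM: "(\<lambda>y. F (M y)) \<in> pfun"
    using F Mp unfolding pfun_def pmap_def by (auto elim: fun_alg_subst)
  have "F (M y) = 0" if y: "y \<in> smooth_cone" "\<delta> y \<noteq> 0" for y
  proof -
    have "bd (M y) w = 0" if "w \<in> T y" for w using M(1) smooth_cone_C[OF y(1)] that by (simp add: N_def)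
    then obtain \<mu> where "M y = (\<Sum>i\<in>S. \<mu> i *s grad (f i) y)" by (rule normal_span[OF y])
    then have "M y = conormal_map (y, \<mu>)" by (simp add: conormal_map_def)
    then show ?thesis using zero[of "(y, \<mu>)"] smooth_cone_C[OF y(1)] by (simp add: Y_def)
  qed
  then have "(\<lambda>y. \<delta> y * F (M y)) \<in> I" by (intro density pfun_mult \<delta>_pfun FM) auto
  then have "(\<lambda>y. F (M y)) \<in> I" using mult_not_I[OF \<delta>_pfun FM \<delta>_not_I] by blast
  then show "F \<eta> = 0" using IE(2)[of "\<lambda>y. F (M y)" y] smooth_cone_C[OF y(1)] M(2) by simp
qed

text \<open>
  Algebraically independent functions on the dual variety have algebraically independent pullbacks, hence
  independent differentials at a generic point of the conormal variety. These factor through the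
  differential of the conormal map, whose rank is therefore at least \<open>k\<close>.
\<close>
theorem generic_radical_bound:
  assumes k: "k \<le> transcendence_degree (cone (dual_variety X))" "0 < k" and Q0: "Q0 \<in> pfun" "Q0 \<notin> I"
  obtains y \<mu> where "y \<in> smooth_cone" "Q0 y \<noteq> 0" "\<delta> y \<noteq> 0" "vec.dim (radical \<mu> y) + k \<le> CARD('m)"
proof -
  let ?t = "transcendence_degree (cone (dual_variety X))"
  obtain g where g: "\<And>i. g i \<in> pfun" "alg_indep (cone (dual_variety X)) ?t g"
    using transcendence_degree_attained[of "cone (dual_variety X)"] k by auto
  have gk: "alg_indep (cone (dual_variety X)) k g" using alg_indep_mono[OF g(2) k(1)] by simp
  have "\<exists>\<psi>. \<psi> \<in> polys UNIV \<and> (\<forall>\<eta>. g i \<eta> = \<psi> (vec_nth \<eta>))" for i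
  proof -
    obtain p where p: "g i = poly_fun p" using pfun_imp_poly_fun[OF g(1)] by auto
    have "poly_eval p \<in> polys UNIV" by (rule poly_eval_in_polys) (simp add: vars_in_def)
    with p show ?thesis by auto
  qed
  then obtain \<psi> where \<psi>: "\<And>i. \<psi> i \<in> polys UNIV" "\<And>i \<eta>. g i \<eta> = \<psi> i (vec_nth \<eta>)" by metis
  define h where "h i z = \<psi> i (\<lambda>j. vec_nth (conormal_map z) j)" for i z
  have h: "h i \<in> R" for i
    unfolding h_def[abs_def] by (rule polys_subst[OF \<psi>(1) conormal_map_R])
  have hg: "h i z = g i (conormal_map z)" for i z by (simp add: h_def \<psi>(2))
  have ind: "alg_indep Y k h"
    unfolding alg_indep_def
  proof (intro ballI impI)
    fix \<phi> :: "(nat \<Rightarrow> complex) \<Rightarrow> complex"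
    assume \<phi>: "\<phi> \<in> polys {..<k}" "\<forall>z\<in>Y. \<phi> (\<lambda>i. h i z) = 0"
    have "(\<lambda>\<eta>. \<phi> (\<lambda>i. g i \<eta>)) \<in> pfun"
      unfolding pfun_def by (rule polys_subst[OF \<phi>(1) g(1)[unfolded pfun_def]])
    then have "\<forall>\<eta>\<in>cone (dual_variety X). \<phi> (\<lambda>i. g i \<eta>) = 0"
      using vanishing_on_dual[of "\<lambda>\<eta>. \<phi> (\<lambda>i. g i \<eta>)"] \<phi>(2) by (simp add: hg)
    then show "\<forall>x. \<phi> x = 0" using gk \<phi>(1) unfolding alg_indep_def by blast
  qed
  let ?D = "n + 1 + card S"
  have bound: "d \<le> ?D" if "\<And>i. i < d \<Longrightarrow> h i \<in> R" "alg_indep Y d h" for d h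
    by (rule transcendence_bound_Y[OF that])
  have "\<exists>Q\<in>R. (\<exists>z\<in>Y. Q z \<noteq> 0) \<and> (\<forall>z\<in>Y. Q z \<noteq> 0 \<longrightarrow> (\<forall>\<tau>.
      (\<forall>t<?D. tangent_vector R Y z (\<tau> t)) \<longrightarrow>
      (\<forall>x. (\<forall>j\<in>J. (\<Sum>t<?D. x t * \<tau> t (gen j)) = 0) \<longrightarrow> (\<forall>t<?D. x t = 0)) \<longrightarrow>
      (\<forall>c. (\<forall>t<?D. (\<Sum>i<k. c i * \<tau> t (h i)) = 0) \<longrightarrow> (\<forall>i<k. c i = 0))))"
    by (rule differentials_of_alg_indep[OF prime_Y finite_J bound h ind])
  then obtain Q where Q1: "Q \<in> R" and Q2: "(\<exists>z\<in>Y. Q z \<noteq> 0) \<and>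
    (\<forall>z\<in>Y. Q z \<noteq> 0 \<longrightarrow> (\<forall>\<tau>. (\<forall>t<?D. tangent_vector R Y z (\<tau> t)) \<longrightarrow>
      (\<forall>x. (\<forall>j\<in>J. (\<Sum>t<?D. x t * \<tau> t (gen j)) = 0) \<longrightarrow> (\<forall>t<?D. x t = 0)) \<longrightarrow>
      (\<forall>c. (\<forall>t<?D. (\<Sum>i<k. c i * \<tau> t (h i)) = 0) \<longrightarrow> (\<forall>i<k. c i = 0))))"
    by (rule bexE)
  note Q = Q1 conjunct1[OF Q2] conjunct2[OF Q2]
  obtain \<mu> where \<mu>: "(\<lambda>y. Q (y, \<mu>)) \<in> pfun" "(\<lambda>y. Q (y, \<mu>)) \<notin> I"
    by (rule R_not_vanishing[OF Q(1,2)])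
  have "(\<lambda>y. Q0 y * \<delta> y) \<in> pfun" "(\<lambda>y. Q0 y * \<delta> y) \<notin> I"
    by (rule pfun_mult[OF Q0(1) \<delta>_pfun], rule mult_not_I[OF Q0(1) \<delta>_pfun Q0(2) \<delta>_not_I])
  from smooth_cone_ex[OF pfun_mult[OF \<mu>(1) this(1)] mult_not_I[OF \<mu>(1) this(1) \<mu>(2) this(2)]]
  obtain y where y: "y \<in> smooth_cone" "Q (y, \<mu>) \<noteq> 0" "Q0 y \<noteq> 0" "\<delta> y \<noteq> 0" by auto
  have yC: "y \<in> C" by (rule smooth_cone_C[OF y(1)])
  let ?z = "(y, \<mu>)"
  have zY: "?z \<in> Y" using yC by (simp add: Y_def)
  obtain B where B: "B \<subseteq> T y" "vec.independent B" "T y \<subseteq> vec.span B" "card B = vec.dim (T y)"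
    by (rule vec.basis_exists[of "T y"])
  have finB: "finite B" using B(2) by (rule vec.finiteI_independent)
  obtain tb where tb: "bij_betw tb {..<n + 1} B"
    using ex_bij_betw_nat_finite[OF finB] B(4) dim_T[OF y(1)] by (auto simp: atLeast0LessThan)
  obtain \<sigma> where \<sigma>: "bij_betw \<sigma> {..<card S} S"
    using ex_bij_betw_nat_finite[of S] by (auto simp: atLeast0LessThan)
  have \<sigma>S: "\<sigma> t \<in> S" if "t < card S" for t using \<sigma> that by (auto simp: bij_betw_def)
  have tbT: "tb t \<in> T y" if "t < n + 1" for t using tb B(1) that by (auto simp: bij_betw_def)
  \<comment> \<open>The first \<open>n + 1\<close> tangent vectors move the point of the cone, the others the coefficients.\<close>
  define \<tau> where "\<tau> t = (if t < n + 1 then (\<lambda>F. dif (\<lambda>y. F (y, \<mu>)) y (tb t))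
    else (\<lambda>F. pd (\<sigma> (t - (n + 1))) (\<lambda>\<mu>. F (y, \<mu>)) \<mu>))"
    for t and F :: "(complex ^ 'm) \<times> ('m \<Rightarrow> complex) \<Rightarrow> complex"
  have tan: "\<forall>t<?D. tangent_vector R Y ?z (\<tau> t)"
    using tangent_vector_point[OF yC tbT] tangent_vector_coefficient[OF yC] by (simp add: \<tau>_def[abs_def])
  have lin: "\<forall>t<?D. x t = 0" if x: "\<forall>j\<in>J. (\<Sum>t<?D. x t * \<tau> t (gen j)) = 0" for x
  proof -
    have Inl: "(\<Sum>t<n + 1. x t * vec_nth (tb t) j) = 0" for j
    proof -
      have "\<tau> t (gen (Inl j)) = vec_nth (tb t) j" if "t < n + 1" for t
        using that by (simp add: \<tau>_def gen_def)
      moreover have "\<tau> (n + 1 + t) (gen (Inl j)) = 0" for t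
        by (simp add: \<tau>_def gen_def)
      moreover have "(\<Sum>t<?D. x t * \<tau> t (gen (Inl j))) = 0" using x by (simp add: J_def)
      ultimately show ?thesis unfolding sum_lessThan_add by simp
    qed
    have Inr: "(\<Sum>t<card S. x (n + 1 + t) * (if \<sigma> t = i then 1 else 0)) = 0" if "i \<in> S" for i
    proof -
      have "\<tau> t (gen (Inr i)) = 0" if "t < n + 1" for t
        using that by (simp add: \<tau>_def gen_def)
      moreover have "\<tau> (n + 1 + t) (gen (Inr i)) = (if \<sigma> t = i then 1 else 0)" for t
        by (simp add: \<tau>_def gen_def pd_coord)
      moreover have "(\<Sum>t<?D. x t * \<tau> t (gen (Inr i))) = 0" using x that by (simp add: J_def)
      ultimately show ?thesis unfolding sum_lessThan_add by simp
    qed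
    have low: "x t = 0" if t: "t < n + 1" for t
    proof -
      have "(\<Sum>t<n + 1. x t *s tb t) = 0"
        using Inl by (simp add: Finite_Cartesian_Product.vec_eq_iff)
      moreover have inj: "inj_on tb {..<n + 1}" and im: "tb ` {..<n + 1} = B" using tb by (auto simp: bij_betw_def)
      ultimately have "(\<Sum>p\<in>B. x (inv_into {..<n + 1} tb p) *s p) = 0"
        unfolding im[symmetric] sum.reindex[OF inj] by (simp add: inv_into_f_f[OF inj])
      then have "x (inv_into {..<n + 1} tb (tb t)) = 0"
        using vec.independentD[OF B(2) finB order_refl, of "\<lambda>p. x (inv_into {..<n + 1} tb p)" "tb t"] im t by auto
      then show ?thesis using inv_into_f_f[OF inj] t by simp
    qed
    have high: "x (n + 1 + t) = 0" if t: "t < card S" for t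
    proof -
      have "(\<Sum>s<card S. x (n + 1 + s) * (if \<sigma> s = \<sigma> t then 1 else 0)) = (\<Sum>s<card S. if s = t then x (n + 1 + t) else 0)"
        using \<sigma> t by (intro sum.cong) (auto simp: bij_betw_def inj_on_def)
      with Inr[OF \<sigma>S[OF t]] t show ?thesis by simp
    qed
    show ?thesis
    proof (intro allI impI)
      fix t assume t: "t < ?D"
      show "x t = 0"
      proof (cases "t < n + 1")
        case False
        then have "t - (n + 1) < card S" "t = n + 1 + (t - (n + 1))" using t by auto
        then show ?thesis using high by metis
      qed (rule low)
    qed
  qed
  have indep: "\<forall>i<k. c i = 0" if "\<forall>t<?D. (\<Sum>i<k. c i * \<tau> t (h i)) = 0" for c
    using Q(3)[rule_format, OF zY y(2), of \<tau> c] tan lin that by blast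
  define E where "E t = (\<chi> j. \<tau> t (\<lambda>z. vec_nth (conormal_map z) j))" for t
  define p where "p i = (\<chi> j. pd j (\<psi> i) (\<lambda>j. vec_nth (conormal_map ?z) j))" for i
  have \<tau>h: "\<tau> t (h i) = bd (p i) (E t)" if "t < ?D" for t i
  proof -
    have "\<tau> t (h i) = (\<Sum>j\<in>UNIV. pd j (\<psi> i) (\<lambda>j. vec_nth (conormal_map ?z) j) * \<tau> t (\<lambda>z. vec_nth (conormal_map z) j))"
      unfolding h_def[abs_def] using tan that
      by (intro point_derivation_chain[of "gen ` J" ?z "\<tau> t" "\<psi> i" UNIV "\<lambda>j z. vec_nth (conormal_map z) j"] \<psi> conormal_map_R)
        (auto simp: tangent_vector_def)
    then show ?thesis by (simp add: bd_def p_def E_def)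
  qed
  let ?E = "E ` {..<?D}"
  obtain B' where B': "B' \<subseteq> ?E" "vec.independent B'" "?E \<subseteq> vec.span B'" "card B' = vec.dim ?E"
    by (rule vec.basis_exists[of ?E])
  have "k \<le> vec.dim ?E"
  proof (rule ccontr)
    assume "\<not> k \<le> vec.dim ?E"
    then have "card B' < card {..<k}" using B'(4) by simp
    then obtain x where x: "\<exists>i\<in>{..<k}. x i \<noteq> 0" "\<And>e. e \<in> B' \<Longrightarrow> (\<Sum>i<k. bd (p i) e * x i) = 0"
      using underdetermined_system[OF vec.finiteI_independent[OF B'(2)], of "{..<k}" "\<lambda>e i. bd (p i) e"] by auto
    let ?P = "\<Sum>i<k. x i *s p i"
    have P: "bd e ?P = (\<Sum>i<k. bd (p i) e * x i)" for e
      by (simp add: bd_sum_right bd_scale_right bd_commute[of e] mult.commute)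
    have "(\<Sum>i<k. x i * \<tau> t (h i)) = 0" if t: "t < ?D" for t
    proof -
      have "E t \<in> vec.span B'" using B'(3) t by blast
      then have "bd (E t) ?P = 0" using bd_span_zero[of B' ?P "E t"] x(2) by (simp add: P)
      then show ?thesis using t by (simp add: P \<tau>h mult.commute)
    qed
    with indep[of x] x(1) show False by blast
  qed
  moreover have "radical \<mu> y \<subseteq> {u. \<forall>x\<in>?E. bd x u = 0}"
  proof
    fix u assume u: "u \<in> radical \<mu> y"
    have "bd (E t) u = 0" if t: "t < ?D" for t
    proof (cases "t < n + 1")
      case True
      have "E t = hess_covector \<mu> y (tb t)"
        using True by (simp add: E_def \<tau>_def conormal_map_deriv_point Finite_Cartesian_Product.vec_eq_iff)
      then show ?thesis using u tbT[OF True] by (simp add: bd_hess_covector radical_def)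
    next
      case False
      define j where "j = \<sigma> (t - (n + 1))"
      have s: "j \<in> S" using \<sigma>S[of "t - (n + 1)"] t False unfolding j_def by simp
      have "\<tau> t = (\<lambda>F. pd j (\<lambda>\<mu>. F (y, \<mu>)) \<mu>)" using False by (simp add: \<tau>_def[abs_def] j_def)
      then have "E t = grad (f j) y"
        by (simp add: E_def conormal_map_deriv_coefficient[OF s] Finite_Cartesian_Product.vec_eq_iff)
      then show ?thesis using u f[OF s] by (simp add: bd_grad radical_def T_def)
    qed
    then show "u \<in> {u. \<forall>x\<in>?E. bd x u = 0}" by auto
  qed
  then have "vec.dim (radical \<mu> y) \<le> vec.dim {u. \<forall>x\<in>?E. bd x u = 0}" by (rule vec.dim_subset)
  ultimately have "vec.dim (radical \<mu> y) + k \<le> CARD('m)" using dim_annihilator[of ?E] by simp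
  with y that show ?thesis by blast
qed

end

section \<open>The second fundamental form in an adapted frame\<close>

context conormal
begin

lemma hess_form_commute: "hess_form \<mu> y w u = hess_form \<mu> y u w"
  unfolding hess_form_def using hess_commute[OF f_pfun] by (intro sum.cong) auto

lemma hess_form_add: "hess_form \<mu> y w (u + u') = hess_form \<mu> y w u + hess_form \<mu> y w u'"
  and hess_form_scale: "hess_form \<mu> y w (c *s u) = c * hess_form \<mu> y w u"
  by (simp_all add: bd_hess_covector[symmetric] bd_add_right bd_scale_right)

lemma hess_form_sum: "hess_form \<mu> y w (\<Sum>i\<in>A. c i *s g i) = (\<Sum>i\<in>A. c i * hess_form \<mu> y w (g i))"
  by (simp add: bd_hess_covector[symmetric] bd_sum_right bd_scale_right)

text \<open>This identifies the Hessian form with the second fundamental form: differentiate \<open>df\<^sub>i(s) = 0\<close> along \<open>w\<close>.\<close>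
lemma hess_form_section:
  assumes "y \<in> smooth_cone" "s \<in> tfields" "w \<in> T y"
  shows "hess_form \<mu> y w (s y) = - bd (conormal_map (y, \<mu>)) (vdif s y w)"
proof -
  have "hess_form \<mu> y w (s y) = (\<Sum>i\<in>S. \<mu> i * - dif (f i) y (vdif s y w))"
    unfolding hess_form_def using hess_section[OF assms(2) f smooth_cone_C[OF assms(1)] assms(3)] by (intro sum.cong) auto
  then show ?thesis by (simp add: conormal_map_def bd_sum_left bd_scale_left bd_grad sum_negf)
qed

lemma gauss_kernel_subset_radical:
  assumes y: "y \<in> smooth_cone"
  shows "gauss_kernel X y \<subseteq> radical \<mu> y"
proof
  fix u assume u: "u \<in> gauss_kernel X y"
  then have uT: "u \<in> T y" and us: "\<And>s. s \<in> tfields \<Longrightarrow> vdif s y u \<in> T y"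
    unfolding gauss_kernel_eq[OF smooth_cone_nonzero[OF y]] by auto
  have "hess_form \<mu> y w u = 0" if w: "w \<in> T y" for w
  proof -
    obtain s where s: "s \<in> tfields" "s y = w" by (rule tangent_section_through[OF y w])
    have "hess_form \<mu> y u w = 0" using hess_form_section[OF y s(1) uT, of \<mu>] conormal_map_normal[OF us[OF s(1)]] s(2) by simp
    then show ?thesis using hess_form_commute by metis
  qed
  with uT show "u \<in> radical \<mu> y" by (simp add: radical_def)
qed

lemma subspace_radical: "vec.subspace (radical \<mu> y)"
  using subspace_T[of y] by (auto simp: radical_def vec.subspace_def hess_form_add hess_form_scale) (simp add: bd_hess_covector[symmetric])

text \<open>
  The hyperplane with frame coordinates \<open>\<xi>\<^sub>\<alpha>\<close> is a conormal vector, and so a value of the conormal map. In the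
  frame, the matrix of its Hessian form is minus the given matrix in the indices above \<open>l\<close>; the entries
  with one index at most \<open>l\<close> and the other above vanish, since \<open>\<omega>\<^sub>p\<^sup>\<alpha>\<close> involves no other
  \<open>\<omega>\<^sup>q\<close>. So the radical is spanned by the first \<open>l + 1\<close> vertices at most.
\<close>
lemma radical_bound_of_nonsingular_form:
  assumes v: "v \<in> smooth_cone" "\<delta> v \<noteq> 0" and frame: "adapted_frame X l n v A" and nm: "n < CARD('m)" "l \<le> n"
    and coeff: "fundamental_coefficients X l n v A b"
    and det: "Determinant.det (Matrix.mat (n - l) (n - l)
        (\<lambda>(i, j). \<Sum>\<alpha>\<in>{n<..<CARD('m)}. \<xi> \<alpha> * b \<alpha> (l + 1 + i) (l + 1 + j))) \<noteq> 0"
  obtains \<mu> where "vec.dim (radical \<mu> v) \<le> l + 1"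
proof -
  let ?m = "CARD('m)"
  define a where "a u = A u v" for u
  have v0: "v \<noteq> 0" by (rule smooth_cone_nonzero[OF v(1)])
  have A0: "A 0 = (\<lambda>y. y)" and Ap: "\<And>u. u < ?m \<Longrightarrow> pmap (A u)" and At: "\<And>u. u \<le> n \<Longrightarrow> A u \<in> tfields"
    and spT: "vec.span (a ` {..n}) = T v" and spV: "vec.span (a ` {..<?m}) = UNIV"
    using frame unfolding adapted_frame_def a_def
    by (auto simp: polynomial_map_iff tangent_section_iff affine_tangent_point[OF v0])
  obtain d where d: "\<And>i j. i < ?m \<Longrightarrow> j < ?m \<Longrightarrow> bd (a i) (d j) = (if i = j then 1 else 0)"
    "\<And>x. x = (\<Sum>k<?m. bd x (d k) *s a k)" by (rule frame_dual[OF spV], rule that) assumption+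
  have aT: "a u \<in> T v" if "u \<le> n" for u using spT that vec.span_base[of "a u" "a ` {..n}"] by auto
  obtain \<omega> where conn: "\<And>u w. u < ?m \<Longrightarrow> w \<in> T v \<Longrightarrow> vdif (A u) v w = (\<Sum>k<?m. \<omega> u k w *s a k)"
    and \<omega>: "\<And>\<alpha> p w. \<alpha> \<in> {n<..<?m} \<Longrightarrow> p \<in> {l<..n} \<Longrightarrow> w \<in> T v \<Longrightarrow>
      \<omega> p \<alpha> w = (\<Sum>q\<in>{l<..n}. b \<alpha> p q * \<omega> 0 q w)"
    using coeff unfolding fundamental_coefficients_def connection_forms_def a_def affine_tangent_point[OF v0]
    using Ap by (auto simp: frechet_pmap)
  have \<omega>0: "\<omega> 0 q (a i) = (if i = q then 1 else 0)" if q: "q < ?m" and i: "i \<le> n" for q i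
  proof -
    have "vdif (A 0) v (a i) = a i"
      by (simp add: A0 vdif_def Finite_Cartesian_Product.vec_eq_iff)
    then have eq: "a i = (\<Sum>k<?m. \<omega> 0 k (a i) *s a k)" using conn[of 0 "a i"] aT[OF i] nm by simp
    have "bd (a i) (d q) = (\<Sum>k<?m. \<omega> 0 k (a i) * bd (a k) (d q))"
      by (subst eq) (simp add: bd_sum_left bd_scale_left)
    also have "\<dots> = (\<Sum>k<?m. if k = q then \<omega> 0 q (a i) else 0)"
      using d(1) q by (intro sum.cong) auto
    finally show ?thesis using q d(1)[of i q] i nm by simp
  qed
  define \<eta> where "\<eta> = (\<Sum>\<alpha>\<in>{n<..<?m}. \<xi> \<alpha> *s d \<alpha>)"
  have \<eta>a: "bd \<eta> (a u) = (if n < u then \<xi> u else 0)" if u: "u < ?m" for u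
  proof -
    have "bd \<eta> (a u) = (\<Sum>\<alpha>\<in>{n<..<?m}. if \<alpha> = u then \<xi> u else 0)"
      unfolding \<eta>_def bd_sum_left bd_scale_left using d(1) u
      by (intro sum.cong) (auto simp: bd_commute[of "d _"])
    then show ?thesis using u by simp
  qed
  have \<eta>T: "bd \<eta> w = 0" if "w \<in> T v" for w
  proof -
    have "bd x \<eta> = 0" if "x \<in> a ` {..n}" for x
      using that \<eta>a nm by (auto simp: bd_commute[of _ \<eta>])
    then have "bd w \<eta> = 0" using bd_span_zero[of "a ` {..n}" \<eta> w] that unfolding spT by blast
    then show ?thesis by (simp add: bd_commute)
  qed
  obtain \<mu> where \<mu>: "\<eta> = (\<Sum>i\<in>S. \<mu> i *s grad (f i) v)" by (rule normal_span[OF v \<eta>T])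
  have G\<eta>: "conormal_map (v, \<mu>) = \<eta>" by (simp add: conormal_map_def \<mu>)
  have \<eta>vdif: "bd \<eta> (vdif (A p) v w) = (\<Sum>\<alpha>\<in>{n<..<?m}. \<xi> \<alpha> * \<omega> p \<alpha> w)" if "p < ?m" "w \<in> T v" for p w
  proof -
    have "bd \<eta> (vdif (A p) v w) = (\<Sum>k<?m. \<omega> p k w * (if n < k then \<xi> k else 0))"
      unfolding conn[OF that] bd_sum_right bd_scale_right using \<eta>a by (intro sum.cong) auto
    also have "\<dots> = (\<Sum>k\<in>{n<..<?m}. \<omega> p k w * (if n < k then \<xi> k else 0))"
      by (rule sum.mono_neutral_right) auto
    finally show ?thesis by (simp add: mult.commute)
  qed
  define \<Phi> where "\<Phi> p q = (\<Sum>\<alpha>\<in>{n<..<?m}. \<xi> \<alpha> * b \<alpha> p q)" for p q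
  have HA: "hess_form \<mu> v (a i) (a p) = (if l < i then - \<Phi> p i else 0)" if p: "p \<in> {l<..n}" and i: "i \<le> n" for i p
  proof -
    have "\<omega> p \<alpha> (a i) = (if l < i then b \<alpha> p i else 0)" if \<alpha>: "\<alpha> \<in> {n<..<?m}" for \<alpha>
    proof -
      have "\<omega> p \<alpha> (a i) = (\<Sum>q\<in>{l<..n}. if q = i then b \<alpha> p i else 0)"
        unfolding \<omega>[OF \<alpha> p aT[OF i]] using \<omega>0 i nm by (intro sum.cong) auto
      then show ?thesis using i by simp
    qed
    then have "bd \<eta> (vdif (A p) v (a i)) = (if l < i then \<Phi> p i else 0)"
      using \<eta>vdif[of p "a i"] aT[OF i] p nm by (simp add: \<Phi>_def)
    then show ?thesis
      using hess_form_section[OF v(1) At aT[OF i], of p \<mu>] p unfolding G\<eta> by (simp add: a_def)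
  qed
  have "radical \<mu> v \<subseteq> vec.span (a ` {..l})"
  proof
    fix u assume u: "u \<in> radical \<mu> v"
    then have uT: "u \<in> T v" and uH: "\<And>w. w \<in> T v \<Longrightarrow> hess_form \<mu> v w u = 0" by (auto simp: radical_def)
    obtain c where c: "u = (\<Sum>i\<in>{..n}. c i *s a i)"
      by (rule span_image_sum[of u a "{..n}"]) (use uT spT in auto)
    have "(\<Sum>j<n - l. \<Phi> (l + 1 + i) (l + 1 + j) * c (l + 1 + j)) = 0" if i: "i < n - l" for i
    proof -
      let ?q = "l + 1 + i"
      have q: "?q \<in> {l<..n}" using i by auto
      have "0 = (\<Sum>j\<le>n. c j * hess_form \<mu> v (a ?q) (a j))"
        using uH[OF aT[of ?q]] q unfolding c hess_form_sum by simp
      also have "\<dots> = (\<Sum>j\<le>n. c j * hess_form \<mu> v (a j) (a ?q))"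
        unfolding hess_form_commute[of \<mu> v "a ?q"] ..
      also have "\<dots> = (\<Sum>j\<le>n. c j * (if l < j then - \<Phi> ?q j else 0))"
        using HA[OF q] by (intro sum.cong) auto
      also have "\<dots> = (\<Sum>j\<in>{l<..n}. c j * (if l < j then - \<Phi> ?q j else 0))"
        by (rule sum.mono_neutral_right) auto
      also have "\<dots> = (\<Sum>j\<in>{l<..n}. - (\<Phi> ?q j * c j))"
        by (rule sum.cong) auto
      also have "\<dots> = - (\<Sum>j<n - l. \<Phi> ?q (l + 1 + j) * c (l + 1 + j))"
        unfolding sum_negf[symmetric]
        by (rule sum.reindex_bij_witness[of _ "\<lambda>j. l + 1 + j" "\<lambda>j. j - (l + 1)"]) auto
      finally show ?thesis by simp
    qed
    then have "\<forall>j<n - l. c (l + 1 + j) = 0"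
      using det unfolding det_mat_nonzero_iff[of "n - l"] \<Phi>_def[symmetric]
      by (elim allE[of _ "\<lambda>j. c (l + 1 + j)"]) blast
    then have "c j = 0" if "j \<in> {l<..n}" for j
    proof -
      have "j - (l + 1) < n - l" "l + 1 + (j - (l + 1)) = j" using that by auto
      with \<open>\<forall>j<n - l. c (l + 1 + j) = 0\<close> show ?thesis by metis
    qed
    then have "u = (\<Sum>i\<in>{..l}. c i *s a i)"
      unfolding c using nm by (intro sum.mono_neutral_right) auto
    also have "\<dots> \<in> vec.span (a ` {..l})" by (intro vec.span_sum vec.span_scale vec.span_base) auto
    finally show "u \<in> vec.span (a ` {..l})" .
  qed
  then have "vec.dim (radical \<mu> v) \<le> vec.dim (a ` {..l})"
    using vec.dim_subset vec.dim_span by metis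
  also have "\<dots> \<le> card (a ` {..l})" by (rule vec.dim_le_card') simp
  also have "\<dots> \<le> l + 1" using card_image_le[of "{..l}" a] by simp
  finally show ?thesis by (rule that)
qed

text \<open>
  The kernel of the Gauss map lies in the radical, so the two are equal by dimension. A frame that starts
  with \<open>y\<close> and a basis of this kernel, and continues with bases of the tangent space and of the whole
  space, is adapted. A vector annihilated by the matrix of the Hessian form in the remaining tangent
  directions would be in the radical, hence zero.
\<close>
lemma nonsingular_form_of_radical_bound:
  assumes y: "y \<in> smooth_cone" "\<delta> y \<noteq> 0" and leaf: "leaf_through X l (point y) (gauss_kernel X y)"
    and radical: "vec.dim (radical \<mu> y) \<le> l + 1" and nm: "n < CARD('m)" "l \<le> n"
  shows "\<exists>\<Phi>\<in>second_fundamental_form X l n (point y). \<not> singular_form \<Phi>"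
proof -
  let ?m = "CARD('m)" and ?W = "gauss_kernel X y"
  have y0: "y \<noteq> 0" by (rule smooth_cone_nonzero[OF y(1)])
  have subW: "vec.subspace ?W" and dimW: "vec.dim ?W = l + 1" using leaf by (auto simp: leaf_through_def)
  have W_eq: "?W = radical \<mu> y"
    using vec.subspace_dim_equal[OF subW subspace_radical gauss_kernel_subset_radical[OF y(1)]] radical dimW by simp
  have WT: "?W \<subseteq> T y" unfolding W_eq radical_def by auto
  have ind_y: "vec.independent {y}" using y0 by simp
  obtain B1 where B1: "{y} \<subseteq> B1" "B1 \<subseteq> ?W" "vec.independent B1" "vec.span B1 = ?W" "finite B1" "card B1 = vec.dim ?W"
    by (rule extend_basis_in_subspace[OF ind_y _ subW]) (use self_gauss_kernel[OF y(1)] in auto)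
  obtain B2 where B2: "B1 \<subseteq> B2" "B2 \<subseteq> T y" "vec.independent B2" "vec.span B2 = T y" "finite B2" "card B2 = vec.dim (T y)"
    by (rule extend_basis_in_subspace[OF B1(3) order_trans[OF B1(2) WT] subspace_T])
  obtain B3 where B3: "B2 \<subseteq> B3" "B3 \<subseteq> UNIV" "vec.independent B3" "vec.span B3 = UNIV" "finite B3"
      "card B3 = vec.dim (UNIV :: (complex ^ 'm) set)"
    by (rule extend_basis_in_subspace[OF B2(3) subset_UNIV vec.subspace_UNIV])
  have cards: "card B1 = l + 1" "card B2 = n + 1" "card B3 = ?m"
    using B1(6) B2(6) B3(6) dimW dim_T[OF y(1)] by (simp_all add: vec.dim_UNIV card_cart_basis)
  have "bij_betw (\<lambda>_ :: nat. y) {..<1} {y}" by (simp add: bij_betw_def inj_on_def lessThan_Suc)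
  from extend_enumeration[OF this B1(1,5) cards(1)] obtain a1 where
    a1: "bij_betw a1 {..<l + 1} B1" "\<And>i. i < 1 \<Longrightarrow> a1 i = y" by metis
  from extend_enumeration[OF a1(1) B2(1,5) cards(2)] obtain a2 where
    a2: "bij_betw a2 {..<n + 1} B2" "\<And>i. i < l + 1 \<Longrightarrow> a2 i = a1 i" by metis
  from extend_enumeration[OF a2(1) B3(1,5) cards(3)] obtain a where
    a: "bij_betw a {..<?m} B3" "\<And>i. i < n + 1 \<Longrightarrow> a i = a2 i" by metis
  have a0: "a 0 = y" using a(2)[of 0] a2(2)[of 0] a1(2)[of 0] by simp
  have "a ` {..<n + 1} = a2 ` {..<n + 1}" using a(2) by (intro image_cong) auto
  then have im2: "a ` {..n} = B2" using a2(1) by (simp add: bij_betw_def lessThan_Suc_atMost)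
  have "a ` {..<l + 1} = a1 ` {..<l + 1}" using a(2) a2(2) nm by (intro image_cong) auto
  then have im1: "a ` {..l} = B1" using a1(1) by (simp add: bij_betw_def lessThan_Suc_atMost)
  have im3: "a ` {..<?m} = B3" using a(1) by (simp add: bij_betw_def)
  have spV: "vec.span (a ` {..<?m}) = UNIV" unfolding im3 by (rule B3(4))
  obtain d where d: "\<And>i j. i < ?m \<Longrightarrow> j < ?m \<Longrightarrow> bd (a i) (d j) = (if i = j then 1 else 0)"
    "\<And>x. x = (\<Sum>k<?m. bd x (d k) *s a k)" by (rule frame_dual[OF spV], rule that) assumption+
  have aT: "a u \<in> T y" if "u \<le> n" for u using B2(2) im2 that by auto
  have aW: "a u \<in> ?W" if "u \<le> l" for u using B1(2) im1 that by auto
  have "\<exists>s. s \<in> tfields \<and> s y = a u" if "u \<le> n" for u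
    using tangent_section_through[OF y(1) aT[OF that]] by metis
  then obtain s where s: "\<And>u. u \<le> n \<Longrightarrow> s u \<in> tfields" "\<And>u. u \<le> n \<Longrightarrow> s u y = a u" by metis
  define A where "A u = (if u = 0 then (\<lambda>y. y) else if u \<le> n then s u else (\<lambda>_. a u))" for u
  have At: "A u \<in> tfields" if "u \<le> n" for u using that s(1) identity_tfields by (simp add: A_def)
  have Ap: "pmap (A u)" for u using At[of u] tfields_pmap by (cases "u \<le> n") (auto simp: A_def pmap_const)
  have Ay: "A u y = a u" for u using s(2) a0 by (simp add: A_def)
  have frame: "adapted_frame X l n y A"
    unfolding adapted_frame_def Ay using leaf
    by (simp add: A_def[of 0] Ap At polynomial_map_iff tangent_section_iff affine_tangent_point[OF y0]
        im1 im2 im3 B1(4) B2(4) B3(4))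
  define \<omega> where "\<omega> u k w = bd (vdif (A u) y w) (d k)" for u k w
  have Td: "bd w (d k) = 0" if w: "w \<in> T y" and k: "n < k" "k < ?m" for w k
  proof -
    have "bd x (d k) = 0" if "x \<in> a ` {..n}" for x using that d(1) k nm by auto
    then show ?thesis using bd_span_zero[of "a ` {..n}" "d k" w] w B2(4) im2 by simp
  qed
  define b where "b \<alpha> p q = \<omega> p \<alpha> (a q)" for \<alpha> p q
  have conn: "connection_forms X y A \<omega>"
    unfolding connection_forms_def Ay \<omega>_def frechet_pmap[OF Ap] using d(2) by blast
  have coeff: "\<omega> p \<alpha> w = (\<Sum>q\<in>{l<..n}. b \<alpha> p q * \<omega> 0 q w)"
    if \<alpha>: "\<alpha> \<in> {n<..<?m}" and p: "p \<in> {l<..n}" and w: "w \<in> T y" for \<alpha> p w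
  proof -
    have \<omega>0: "\<omega> 0 q w = bd w (d q)" for q
    proof -
      have "vdif (A 0) y w = w" by (simp add: A_def vdif_def Finite_Cartesian_Product.vec_eq_iff)
      then show ?thesis by (simp add: \<omega>_def)
    qed
    have lin: "\<omega> p \<alpha> (\<Sum>k\<in>K. c k *s x k) = (\<Sum>k\<in>K. c k * \<omega> p \<alpha> (x k))" for K :: "nat set" and c x
      unfolding \<omega>_def
    proof (induction K rule: infinite_finite_induct)
      case (insert k K)
      then show ?case by (simp add: vdif_plus_right vdif_scale_right bd_add_left bd_scale_left)
    qed (simp_all add: vdif_def bd_def)
    have low: "\<omega> p \<alpha> (a i) = 0" if i: "i \<le> l" for i
    proof -
      have "vdif (A p) y (a i) \<in> T y"
        using aW[OF i] At[of p] p unfolding gauss_kernel_eq[OF y0] by auto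
      then show ?thesis unfolding \<omega>_def using Td \<alpha> by auto
    qed
    have "\<omega> p \<alpha> w = (\<Sum>k<?m. bd w (d k) * \<omega> p \<alpha> (a k))"
      by (subst d(2)[of w]) (rule lin)
    also have "\<dots> = (\<Sum>q\<in>{l<..n}. bd w (d q) * \<omega> p \<alpha> (a q))"
      using Td[OF w] low nm by (intro sum.mono_neutral_right) (auto simp: not_less)
    finally show ?thesis by (simp add: b_def \<omega>0 mult.commute)
  qed
  have fund: "fundamental_coefficients X l n y A b"
    unfolding fundamental_coefficients_def affine_tangent_point[OF y0] using conn coeff by blast
  define \<eta> where "\<eta> = conormal_map (y, \<mu>)"
  have \<eta>T: "bd \<eta> w = 0" if "w \<in> T y" for w unfolding \<eta>_def by (rule conormal_map_normal[OF that])
  define \<xi> where "\<xi> \<alpha> = bd \<eta> (a \<alpha>)" for \<alpha>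
  have form: "(\<Sum>\<alpha>\<in>{n<..<?m}. \<xi> \<alpha> * b \<alpha> p q) = - hess_form \<mu> y (a p) (a q)" if p: "p \<le> n" and q: "q \<le> n" for p q
  proof -
    let ?x = "vdif (A p) y (a q)"
    have "bd \<eta> ?x = (\<Sum>k<?m. bd ?x (d k) * bd \<eta> (a k))"
      by (subst d(2)[of ?x]) (simp add: bd_sum_right bd_scale_right)
    also have "\<dots> = (\<Sum>\<alpha>\<in>{n<..<?m}. bd ?x (d \<alpha>) * bd \<eta> (a \<alpha>))"
      using \<eta>T[OF aT] by (intro sum.mono_neutral_right) (auto simp: not_less)
    also have "\<dots> = (\<Sum>\<alpha>\<in>{n<..<?m}. \<xi> \<alpha> * b \<alpha> p q)"
      by (simp add: \<xi>_def b_def \<omega>_def mult.commute)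
    finally have "(\<Sum>\<alpha>\<in>{n<..<?m}. \<xi> \<alpha> * b \<alpha> p q) = - hess_form \<mu> y (a q) (A p y)"
      using hess_form_section[OF y(1) At[OF p] aT[OF q], of \<mu>] by (simp add: \<eta>_def)
    then show ?thesis unfolding Ay using hess_form_commute by metis
  qed
  let ?\<Phi> = "Matrix.mat (n - l) (n - l) (\<lambda>(i, j). \<Sum>\<alpha>\<in>{n<..<?m}. \<xi> \<alpha> * b \<alpha> (l + 1 + i) (l + 1 + j))"
  have "Determinant.det ?\<Phi> \<noteq> 0"
    unfolding det_mat_nonzero_iff
  proof (intro allI impI)
    fix c j assume c: "\<forall>i<n - l. (\<Sum>j<n - l. (\<Sum>\<alpha>\<in>{n<..<?m}. \<xi> \<alpha> * b \<alpha> (l + 1 + i) (l + 1 + j)) * c j) = 0"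
      and j: "j < n - l"
    define u where "u = (\<Sum>j<n - l. c j *s a (l + 1 + j))"
    have uT: "u \<in> T y"
      unfolding u_def using aT subspace_T[of y] by (intro vec.subspace_sum vec.subspace_scale) auto
    have Ha: "hess_form \<mu> y (a p) u = 0" if p: "p \<le> n" for p
    proof (cases "p \<le> l")
      case True
      then have "hess_form \<mu> y u (a p) = 0" using aW[OF True] uT unfolding W_eq radical_def by blast
      then show ?thesis using hess_form_commute by metis
    next
      case False
      then have i: "p - (l + 1) < n - l" "l + 1 + (p - (l + 1)) = p" using p by auto
      have "0 = (\<Sum>j<n - l. (\<Sum>\<alpha>\<in>{n<..<?m}. \<xi> \<alpha> * b \<alpha> p (l + 1 + j)) * c j)"
        using c[rule_format, OF i(1)] unfolding i(2) by simp
      also have "\<dots> = (\<Sum>j<n - l. - hess_form \<mu> y (a p) (a (l + 1 + j)) * c j)"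
        using form p by (intro sum.cong) auto
      also have "\<dots> = - hess_form \<mu> y (a p) u"
        unfolding u_def hess_form_sum by (simp add: sum_negf mult.commute)
      finally show ?thesis by simp
    qed
    have "hess_form \<mu> y w u = 0" if w: "w \<in> T y" for w
    proof -
      have "bd x (hess_covector \<mu> y u) = 0" if "x \<in> a ` {..n}" for x
        using that Ha by (auto simp: bd_commute[of _ "hess_covector _ _ _"] bd_hess_covector hess_form_commute[of \<mu> y u])
      then have "bd w (hess_covector \<mu> y u) = 0"
        using bd_span_zero[of "a ` {..n}" "hess_covector \<mu> y u" w] w B2(4) im2 by simp
      then show ?thesis by (simp add: bd_commute[of w] bd_hess_covector hess_form_commute[of \<mu> y u])
    qed
    then have "u \<in> vec.span (a ` {..l})" using uT B1(4) im1 unfolding W_eq radical_def by auto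
    moreover have "bd x (d (l + 1 + j)) = 0" if "x \<in> a ` {..l}" for x
      using that d(1) j nm by auto
    ultimately have "bd u (d (l + 1 + j)) = 0" using bd_span_zero by blast
    moreover have "bd u (d (l + 1 + j)) = (\<Sum>i<n - l. if i = j then c j else 0)"
      unfolding u_def bd_sum_left bd_scale_left using d(1) j nm by (intro sum.cong) auto
    ultimately show "c j = 0" using j by simp
  qed
  then have "\<not> singular_form ?\<Phi>" by (simp add: singular_form_def)
  moreover have "?\<Phi> \<in> second_fundamental_form X l n (point y)"
    unfolding second_fundamental_form_def using y0 frame fund by blast
  ultimately show ?thesis by blast
qed

end

section \<open>Dual degeneracy and singular second fundamental forms\<close>

theorem theorem4:
  fixes X :: "'m::finite proj set" and N n r l :: nat
  assumes "CARD('m) = N + 1"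
    and "irreducible_variety X"
    and "proj_dim X = int n"
    and "X \<subseteq> zariski_closure (smooth_points X)"
    and "has_gauss_rank X r"
    and "0 < r" and "r < n"
    and "l = n - r"
  shows "proj_dim (dual_variety X) < int N - int l - 1 \<longleftrightarrow>
    (\<forall>x\<in>smooth_points X. \<forall>\<Phi>\<in>second_fundamental_form X l n x. singular_form \<Phi>)"
proof -
  interpret dense_smooth_variety X n
    by unfold_locales (use assms in auto)
  let ?t = "transcendence_degree (cone (dual_variety X))"
  have "(\<lambda>_. 1) \<notin> I" using prime_C unfolding prime_on_def I_def by auto
  then obtain v0 where v0: "v0 \<in> smooth_cone" using smooth_cone_ex[OF pfun_const, of 1] by auto
  obtain S0 f0 e0 where con0: "conormal X n S0 f0 e0" by (rule conormal_ex[OF v0])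
  have nN: "n \<le> N" using conormal.card_S[OF con0] assms(1) by simp
  have ln: "l \<le> n" "l < N" "n < CARD('m)" using assms nN by auto
  \<comment> \<open>The cone over the dual variety has this dimension when there is no degeneracy.\<close>
  define k where "k = N - l"
  have k: "0 < k" "l + 1 + k = CARD('m)" using ln assms(1) by (auto simp: k_def)
  have "proj_dim (dual_variety X) < int N - int l - 1 \<longleftrightarrow> \<not> k \<le> ?t"
    unfolding proj_dim_def k_def using ln by auto
  also have "k \<le> ?t \<longleftrightarrow> (\<exists>x\<in>smooth_points X. \<exists>\<Phi>\<in>second_fundamental_form X l n x. \<not> singular_form \<Phi>)"
  proof
    assume kt: "k \<le> ?t"
    obtain Z where Z: "zariski_closed Z" "\<not> X \<subseteq> Z"
      "\<And>v. v \<noteq> 0 \<Longrightarrow> point v \<in> smooth_points X - Z \<Longrightarrow> gauss_rank_at X v = r"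
      using assms(5) unfolding has_gauss_rank_def by blast
    obtain Q where Q: "Q \<in> pfun" "\<And>y. y \<in> cone Z \<Longrightarrow> Q y = 0" "\<exists>y\<in>C. Q y \<noteq> 0"
      by (rule closed_separating_function[OF Z(1,2)], rule that) assumption+
    have QI: "Q \<notin> I" using Q(3) by (auto simp: I_def)
    have dim_kernel: "vec.dim (gauss_kernel X y) = l + 1" if y: "y \<in> smooth_cone" "Q y \<noteq> 0" for y
    proof -
      have "point y \<notin> Z" using Q(2)[of y] y mem_cone[OF smooth_cone_nonzero[OF y(1)]] by blast
      then have "gauss_rank_at X y = r" using Z(3)[OF smooth_cone_nonzero[OF y(1)]] y(1) by (simp add: smooth_cone_def)
      then have "n + 1 - vec.dim (gauss_kernel X y) = r"
        unfolding gauss_rank_at_def affine_tangent_point[OF smooth_cone_nonzero[OF y(1)]] dim_T[OF y(1)] .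
      \<comment> \<open>The difference of dimensions is not truncated, as \<open>r\<close> is positive.\<close>
      then show ?thesis using assms(6-8) by simp
    qed
    interpret conormal X n S0 f0 e0 by (rule con0)
    obtain y \<mu> where y: "y \<in> smooth_cone" "Q y \<noteq> 0" "\<delta> y \<noteq> 0" "vec.dim (radical \<mu> y) + k \<le> CARD('m)"
      by (rule generic_radical_bound[OF kt k(1) Q(1) QI])
    have "leaf_through X l (point y) (gauss_kernel X y)"
      by (rule leaf_through_generic[OF Q(1) dim_kernel y(1,2)])
    moreover have "vec.dim (radical \<mu> y) \<le> l + 1" using y(4) k(2) by simp
    ultimately have "\<exists>\<Phi>\<in>second_fundamental_form X l n (point y). \<not> singular_form \<Phi>"
      by (intro nonsingular_form_of_radical_bound[OF y(1,3)] ln)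
    moreover have "point y \<in> smooth_points X" using y(1) by (simp add: smooth_cone_def)
    ultimately show "\<exists>x\<in>smooth_points X. \<exists>\<Phi>\<in>second_fundamental_form X l n x. \<not> singular_form \<Phi>" by blast
  next
    assume "\<exists>x\<in>smooth_points X. \<exists>\<Phi>\<in>second_fundamental_form X l n x. \<not> singular_form \<Phi>"
    then obtain x \<Phi> where x: "x \<in> smooth_points X" "\<Phi> \<in> second_fundamental_form X l n x" "\<not> singular_form \<Phi>"
      by blast
    then obtain v A b \<xi> where v: "v \<noteq> 0" "point v = x" and frame: "adapted_frame X l n v A"
      and coeff: "fundamental_coefficients X l n v A b"
      and \<Phi>: "\<Phi> = Matrix.mat (n - l) (n - l)
        (\<lambda>(i, j). \<Sum>\<alpha>\<in>{n<..<CARD('m)}. \<xi> \<alpha> * b \<alpha> (l + 1 + i) (l + 1 + j))"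
      unfolding second_fundamental_form_def by blast
    have vS: "v \<in> smooth_cone" using v x(1) by (simp add: smooth_cone_def)
    obtain S f e where con: "conormal X n S f e"
      and det: "Determinants.det (rows_mat (\<lambda>i. if i \<in> S then grad (f i) v else e i)) \<noteq> 0"
      by (rule conormal_ex[OF vS])
    interpret conormal X n S f e by (rule con)
    have \<delta>v: "\<delta> v \<noteq> 0" using det unfolding \<delta>_def row_def[abs_def] .
    have "Determinant.det (Matrix.mat (n - l) (n - l)
        (\<lambda>(i, j). \<Sum>\<alpha>\<in>{n<..<CARD('m)}. \<xi> \<alpha> * b \<alpha> (l + 1 + i) (l + 1 + j))) \<noteq> 0"
      using x(3) unfolding singular_form_def \<Phi> .
    then obtain \<mu> where "vec.dim (radical \<mu> v) \<le> l + 1"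
      by (rule radical_bound_of_nonsingular_form[OF vS \<delta>v frame ln(3,1) coeff])
    then show "k \<le> ?t"
      using k by (intro dual_transcendence_lower_bound[OF vS \<delta>v, of \<mu>]) auto
  qed
  finally show ?thesis by blast
qed

end
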